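(* Let $X$ be a complex Banach space and $T\in\mathcal{B}(X)$. The following statements are equivalent: 1) $\sigma_{e}(T)=\sigma_{B}(T)$; 2) $T$ and $T^*$ have SVEP at every $\lambda\notin\sigma_{e}(T)$; 3) $T$ and $T^*$ have SVEP at every $\lambda\notin\sigma_{BF}(T)$; 4) $\sigma_{BF}(T)=\sigma_{D}(T)$; 5) $T$ and $T^*$ have SVEP at every $\lambda\notin\sigma_{pBF}(T)$; 6) $\sigma_{gD}(T)=\sigma_{pBF}(T)$.
   Context: $\mathcal{B}(X)$ is the algebra of bounded linear operators on $X$; $T^*$ is the adjoint of $T$ acting on the dual space $X^*$; $N(T)$, $R(T)$ are kernel and range. The ascent is $a(T)=\min\{p: N(T^p)=N(T^{p+1})\}$ and the descent is $d(T)=\min\{q: R(T^q)=R(T^{q+1})\}$ ($\infty$ if no such integer exists). $T$ is Browder if it is Fredholm with $a(T)<\infty$ and $d(T)<\infty$. $T$ is B-Fredholm if for some integer $n\ge 0$ the range $R(T^n)$ is closed and the restriction of $T$ to $R(T^n)$ is Fredholm. $T$ is Drazin invertible if there exist a positive integer $k$ and $S\in\mathcal{B}(X)$ with $ST=TS$, $T^{k+1}S=T^k$, $S^2T=S$. $T$ is pseudo B-Fredholm (resp. generalized Drazin invertible) if there are closed $T$-invariant subspaces $X_1,X_2$ with $X=X_1\oplus X_2$ such that $T_{|X_1}$ is Fredholm (resp. invertible) and $T_{|X_2}$ is quasi-nilpotent. The sets of $\lambda\in\mathbb{C}$ such that $T-\lambda I$ is not Fredholm, Browder, B-Fredholm,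 Drazin invertible, pseudo B-Fredholm, generalized Drazin invertible are denoted $\sigma_e(T)$, $\sigma_B(T)$, $\sigma_{BF}(T)$, $\sigma_D(T)$, $\sigma_{pBF}(T)$, $\sigma_{gD}(T)$, respectively. An operator $S$ on a complex Banach space $Y$ has SVEP (the single valued extension property) at $\lambda_0\in\mathbb{C}$ if for every connected open neighbourhood $U$ of $\lambda_0$ the only analytic function $f:U\to Y$ with $(S-zI)f(z)=0$ for all $z\in U$ is $f\equiv 0$. *)

theory Defs
  imports "HOL-Analysis.Analysis" "HOL-Library.Extended_Nat"
begin

section \<open>Complex Banach spaces\<close>

class complex_normed_vector = real_normed_vector +
  fixes scaleC :: "complex \<Rightarrow> 'a \<Rightarrow> 'a"  (infixr \<open>*\<^sub>C\<close> 75)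
  assumes scaleC_add_right: "c *\<^sub>C (x + y) = c *\<^sub>C x + c *\<^sub>C y"
    and scaleC_add_left: "(c + d) *\<^sub>C x = c *\<^sub>C x + d *\<^sub>C x"
    and scaleC_scaleC: "c *\<^sub>C d *\<^sub>C x = (c * d) *\<^sub>C x"
    and scaleR_scaleC: "r *\<^sub>R x = complex_of_real r *\<^sub>C x"
    and norm_scaleC: "norm (c *\<^sub>C x) = cmod c * norm x"

class complex_banach = complex_normed_vector + banach

instantiation complex :: complex_banach
begin

definition scaleC_complex :: "complex \<Rightarrow> complex \<Rightarrow> complex"
  where "scaleC_complex c x = c * x"

instance
  by standard (simp_all add: scaleC_complex_def algebra_simps scaleR_conv_of_real norm_mult)

end

lemma scaleC_one: "1 *\<^sub>C x = (x :: 'a::complex_normed_vector)"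
  using scaleR_scaleC[of 1 x] by simp

interpretation complex_vector: vector_space "scaleC :: complex \<Rightarrow> 'a \<Rightarrow> 'a::complex_normed_vector"
  by standard (simp_all add: scaleC_add_right scaleC_add_left scaleC_scaleC scaleC_one)

abbreviation csubspace :: "'a::complex_normed_vector set \<Rightarrow> bool"
  where "csubspace \<equiv> complex_vector.subspace"

abbreviation cspan :: "'a::complex_normed_vector set \<Rightarrow> 'a set"
  where "cspan \<equiv> complex_vector.span"


section \<open>Bounded operators, the dual space and the adjoint\<close>

definition bounded_clinear ::
    "('a::complex_normed_vector \<Rightarrow> 'b::complex_normed_vector) \<Rightarrow> bool"
  where "bounded_clinear f \<longleftrightarrow> bounded_linear f \<and> (\<forall>c x. f (c *\<^sub>C x) = c *\<^sub>C f x)"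

lemma bounded_clinear_cmult:
  assumes "bounded_clinear (f :: 'a::complex_normed_vector \<Rightarrow> complex)"
  shows "bounded_clinear (\<lambda>x. c * f x)"
  using assms
  by (auto simp: bounded_clinear_def scaleC_complex_def intro: bounded_linear_const_mult)

typedef (overloaded) 'a cdual = "{f :: 'a::complex_normed_vector \<Rightarrow> complex. bounded_clinear f}"
  morphisms cdual_apply Abs_cdual
  by (rule exI[of _ "\<lambda>x. 0"]) (simp add: bounded_clinear_def scaleC_complex_def)

setup_lifting type_definition_cdual

lemma bounded_linear_cdual_apply: "bounded_linear (cdual_apply f)"
  using cdual_apply[of f] by (simp add: bounded_clinear_def)

lemma cdual_apply_scaleC: "cdual_apply f (c *\<^sub>C x) = c * cdual_apply f x"
  using cdual_apply[of f] by (simp add: bounded_clinear_def scaleC_complex_def)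

instantiation cdual :: (complex_normed_vector) complex_normed_vector
begin

lift_definition norm_cdual :: "'a cdual \<Rightarrow> real" is onorm .

lift_definition zero_cdual :: "'a cdual" is "\<lambda>x. 0"
  by (simp add: bounded_clinear_def scaleC_complex_def)

lift_definition plus_cdual :: "'a cdual \<Rightarrow> 'a cdual \<Rightarrow> 'a cdual" is "\<lambda>f g x. f x + g x"
  by (simp add: bounded_clinear_def scaleC_complex_def bounded_linear_add algebra_simps)

lift_definition minus_cdual :: "'a cdual \<Rightarrow> 'a cdual \<Rightarrow> 'a cdual" is "\<lambda>f g x. f x - g x"
  by (simp add: bounded_clinear_def scaleC_complex_def bounded_linear_sub algebra_simps)

lift_definition uminus_cdual :: "'a cdual \<Rightarrow> 'a cdual" is "\<lambda>f x. - f x"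
  by (simp add: bounded_clinear_def scaleC_complex_def bounded_linear_minus)

lift_definition scaleC_cdual :: "complex \<Rightarrow> 'a cdual \<Rightarrow> 'a cdual" is "\<lambda>c f x. c * f x"
  by (rule bounded_clinear_cmult)

definition scaleR_cdual :: "real \<Rightarrow> 'a cdual \<Rightarrow> 'a cdual"
  where "scaleR_cdual r f = complex_of_real r *\<^sub>C f"

definition dist_cdual :: "'a cdual \<Rightarrow> 'a cdual \<Rightarrow> real"
  where "dist_cdual f g = norm (f - g)"

definition sgn_cdual :: "'a cdual \<Rightarrow> 'a cdual"
  where "sgn_cdual f = inverse (norm f) *\<^sub>R f"

definition uniformity_cdual :: "('a cdual \<times> 'a cdual) filter"
  where "uniformity_cdual = (INF e\<in>{0 <..}. principal {(f, g). dist f g < e})"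

definition open_cdual :: "'a cdual set \<Rightarrow> bool"
  where "open_cdual S = (\<forall>f\<in>S. \<forall>\<^sub>F (f', g) in uniformity. f' = f \<longrightarrow> g \<in> S)"

lemma norm_scaleC_cdual: "norm (c *\<^sub>C f) = cmod c * norm f" for f :: "'a cdual"
proof (transfer, rule antisym)
  fix c and f :: "'a \<Rightarrow> complex"
  assume f: "bounded_clinear f"
  have le: "onorm (\<lambda>x. d * g x) \<le> cmod d * onorm g"
    if "bounded_clinear g" for d and g :: "'a \<Rightarrow> complex"
  proof (rule onorm_bound)
    have bl: "bounded_linear g"
      using that by (simp add: bounded_clinear_def)
    show "0 \<le> cmod d * onorm g"
      by (simp add: onorm_pos_le[OF bl])
    show "norm (d * g x) \<le> cmod d * onorm g * norm x" for x
      using mult_left_mono[OF onorm[OF bl, of x], of "cmod d"]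
      by (simp add: norm_mult mult.assoc)
  qed
  show "onorm (\<lambda>x. c * f x) \<le> cmod c * onorm f"
    by (rule le[OF f])
  show "cmod c * onorm f \<le> onorm (\<lambda>x. c * f x)"
  proof (cases "c = 0")
    case True
    then show ?thesis by (simp add: onorm_zero)
  next
    case False
    have "onorm f \<le> cmod (inverse c) * onorm (\<lambda>x. c * f x)"
      using le[OF bounded_clinear_cmult[OF f, of c], of "inverse c"] False
      by (simp add: mult.assoc[symmetric])
    then show ?thesis
      using False by (simp add: norm_divide field_simps)
  qed
qed

instance
proof
  fix f g h :: "'a cdual" and r s :: real and c d :: complex and S :: "'a cdual set"
  show "f + g + h = f + (g + h)" "f + g = g + f" "0 + f = f" "- f + f = 0" "f - g = f + - g"
    by (transfer; simp add: fun_eq_iff)+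
  show "r *\<^sub>R (f + g) = r *\<^sub>R f + r *\<^sub>R g" "(r + s) *\<^sub>R f = r *\<^sub>R f + s *\<^sub>R f"
    "r *\<^sub>R s *\<^sub>R f = (r * s) *\<^sub>R f" "1 *\<^sub>R f = f"
    unfolding scaleR_cdual_def by (transfer; simp add: fun_eq_iff algebra_simps)+
  show "c *\<^sub>C (f + g) = c *\<^sub>C f + c *\<^sub>C g" "(c + d) *\<^sub>C f = c *\<^sub>C f + d *\<^sub>C f"
    "c *\<^sub>C d *\<^sub>C f = (c * d) *\<^sub>C f"
    by (transfer; simp add: fun_eq_iff algebra_simps)+
  show "r *\<^sub>R f = complex_of_real r *\<^sub>C f"
    by (simp add: scaleR_cdual_def)
  show "norm (c *\<^sub>C f) = cmod c * norm f"
    by (rule norm_scaleC_cdual)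
  show "norm (r *\<^sub>R f) = \<bar>r\<bar> * norm f"
    by (simp add: scaleR_cdual_def norm_scaleC_cdual)
  show "sgn f = inverse (norm f) *\<^sub>R f" "dist f g = norm (f - g)"
    by (simp_all add: sgn_cdual_def dist_cdual_def)
  show "(uniformity :: ('a cdual \<times> 'a cdual) filter) =
      (INF e\<in>{0 <..}. principal {(f, g). dist f g < e})"
    by (rule uniformity_cdual_def)
  show "open S = (\<forall>f\<in>S. \<forall>\<^sub>F (f', g) in uniformity. f' = f \<longrightarrow> g \<in> S)"
    by (rule open_cdual_def)
  show "norm f = 0 \<longleftrightarrow> f = 0"
    by transfer (auto simp: bounded_clinear_def onorm_eq_0 fun_eq_iff)
  show "norm (f + g) \<le> norm f + norm g"
    by transfer (simp add: bounded_clinear_def onorm_triangle)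
qed

end

lemma norm_cdual_apply: "cmod (cdual_apply f x) \<le> norm f * norm x"
  by transfer (simp add: bounded_clinear_def onorm)

instance cdual :: (complex_normed_vector) complex_banach
proof
  fix F :: "nat \<Rightarrow> 'a cdual"
  assume cau: "Cauchy F"
  let ?G = "\<lambda>n. Blinfun (cdual_apply (F n))"
  have app: "blinfun_apply (?G n) = cdual_apply (F n)" for n
    by (simp add: bounded_linear_Blinfun_apply bounded_linear_cdual_apply)
  have "dist (?G m) (?G n) = dist (F m) (F n)" for m n
    by (simp add: dist_norm norm_blinfun.rep_eq minus_blinfun.rep_eq app
        norm_cdual.rep_eq minus_cdual.rep_eq)
  with cau have "Cauchy ?G"
    by (simp add: Cauchy_def)
  then obtain g where g: "?G \<longlonglongrightarrow> g"
    using Cauchy_convergent convergent_def by blast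
  have lim: "(\<lambda>n. cdual_apply (F n) x) \<longlonglongrightarrow> blinfun_apply g x" for x
    using blinfun.tendsto[OF g tendsto_const[of x]] by (simp add: app)
  have "blinfun_apply g (c *\<^sub>C x) = c * blinfun_apply g x" for c x
    using LIMSEQ_unique[OF lim[of "c *\<^sub>C x"]] tendsto_mult_left[OF lim[of x], of c]
    by (simp add: cdual_apply_scaleC)
  then have bc: "bounded_clinear (blinfun_apply g)"
    by (simp add: bounded_clinear_def scaleC_complex_def blinfun.bounded_linear_right)
  have "dist (F n) (Abs_cdual (blinfun_apply g)) = dist (?G n) g" for n
    using bc
    by (simp add: dist_norm norm_blinfun.rep_eq minus_blinfun.rep_eq app
        norm_cdual.rep_eq minus_cdual.rep_eq Abs_cdual_inverse)
  with g have "F \<longlonglongrightarrow> Abs_cdual (blinfun_apply g)"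
    by (subst (asm) tendsto_dist_iff, subst tendsto_dist_iff) simp
  then show "convergent F"
    by (rule convergentI)
qed

text \<open>The Banach space adjoint (no complex conjugation); meaningful for bounded \<open>T\<close>.\<close>

definition adjoint_op ::
    "('a::complex_normed_vector \<Rightarrow> 'a) \<Rightarrow> 'a cdual \<Rightarrow> 'a cdual"
  where "adjoint_op T f = Abs_cdual (\<lambda>x. cdual_apply f (T x))"

lemma cdual_apply_adjoint_op:
  assumes "bounded_clinear T"
  shows "cdual_apply (adjoint_op T f) x = cdual_apply f (T x)"
proof -
  have "bounded_clinear (\<lambda>x. cdual_apply f (T x))"
    using assms bounded_linear_compose[OF bounded_linear_cdual_apply[of f], of T]
    by (simp add: bounded_clinear_def cdual_apply_scaleC scaleC_complex_def)
  then show ?thesis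
    by (simp add: adjoint_op_def Abs_cdual_inverse)
qed


section \<open>Classes of operators\<close>

text \<open>
  Since closed subspaces are not types, the restriction of an operator \<open>T\<close> to a
  \<open>T\<close>-invariant subspace \<open>M\<close> is represented by the pair \<open>M\<close>, \<open>T\<close>; the whole space
  is \<open>M = UNIV\<close>. Below, \<open>M\<close> is always a \<open>T\<close>-invariant linear subspace.
\<close>

abbreviation shift :: "('a::complex_normed_vector \<Rightarrow> 'a) \<Rightarrow> complex \<Rightarrow> 'a \<Rightarrow> 'a"
  where "shift T l \<equiv> (\<lambda>x. T x - l *\<^sub>C x)"

definition kernel :: "('a::complex_normed_vector \<Rightarrow> 'a) \<Rightarrow> 'a set"
  where "kernel T = {x. T x = 0}"

text \<open>
  Finite-dimensional kernel and finite-codimensional range in \<open>M\<close>. (When \<open>M\<close> is closed and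
  \<open>T\<close> is bounded, finite codimension implies that the range is closed.)
\<close>

definition fredholm_on :: "'a::complex_normed_vector set \<Rightarrow> ('a \<Rightarrow> 'a) \<Rightarrow> bool"
  where "fredholm_on M T \<longleftrightarrow>
    (\<exists>B. finite B \<and> M \<inter> kernel T = cspan B) \<and>
    (\<exists>B. finite B \<and> M = cspan (T ` M \<union> B))"

abbreviation fredholm :: "('a::complex_normed_vector \<Rightarrow> 'a) \<Rightarrow> bool"
  where "fredholm T \<equiv> fredholm_on UNIV T"

definition ascent :: "('a::complex_normed_vector \<Rightarrow> 'a) \<Rightarrow> enat"
  where "ascent T = Inf {enat p | p. kernel (T ^^ p) = kernel (T ^^ (p + 1))}"

definition descent :: "('a::complex_normed_vector \<Rightarrow> 'a) \<Rightarrow> enat"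
  where "descent T = Inf {enat q | q. range (T ^^ q) = range (T ^^ (q + 1))}"

definition browder :: "('a::complex_normed_vector \<Rightarrow> 'a) \<Rightarrow> bool"
  where "browder T \<longleftrightarrow> fredholm T \<and> ascent T < \<infinity> \<and> descent T < \<infinity>"

definition b_fredholm :: "('a::complex_normed_vector \<Rightarrow> 'a) \<Rightarrow> bool"
  where "b_fredholm T \<longleftrightarrow>
    (\<exists>n. closed (range (T ^^ n)) \<and> fredholm_on (range (T ^^ n)) T)"

definition drazin_invertible :: "('a::complex_normed_vector \<Rightarrow> 'a) \<Rightarrow> bool"
  where "drazin_invertible T \<longleftrightarrow>
    (\<exists>k S. k > 0 \<and> bounded_clinear S \<and> S \<circ> T = T \<circ> S \<and>
       (T ^^ (k + 1)) \<circ> S = T ^^ k \<and> (S ^^ 2) \<circ> T = S)"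

definition bounded_clinear_on :: "'a::complex_normed_vector set \<Rightarrow> ('a \<Rightarrow> 'a) \<Rightarrow> bool"
  where "bounded_clinear_on M S \<longleftrightarrow>
    S ` M \<subseteq> M \<and>
    (\<forall>x\<in>M. \<forall>y\<in>M. S (x + y) = S x + S y) \<and>
    (\<forall>c. \<forall>x\<in>M. S (c *\<^sub>C x) = c *\<^sub>C S x) \<and>
    (\<exists>K. \<forall>x\<in>M. norm (S x) \<le> K * norm x)"

definition invertible_on :: "'a::complex_normed_vector set \<Rightarrow> ('a \<Rightarrow> 'a) \<Rightarrow> bool"
  where "invertible_on M T \<longleftrightarrow>
    (\<exists>S. bounded_clinear_on M S \<and> (\<forall>x\<in>M. S (T x) = x \<and> T (S x) = x))"

definition spectrum_on :: "'a::complex_normed_vector set \<Rightarrow> ('a \<Rightarrow> 'a) \<Rightarrow> complex set"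
  where "spectrum_on M T = {l. \<not> invertible_on M (shift T l)}"

text \<open>Inclusion rather than equality, because the spectrum is empty when \<open>M = {0}\<close>.\<close>

definition quasinilpotent_on :: "'a::complex_normed_vector set \<Rightarrow> ('a \<Rightarrow> 'a) \<Rightarrow> bool"
  where "quasinilpotent_on M T \<longleftrightarrow> spectrum_on M T \<subseteq> {0}"

text \<open>\<open>X\<close> is the direct sum of the closed \<open>T\<close>-invariant subspaces \<open>X1\<close> and \<open>X2\<close>.\<close>

definition reducing_pair ::
    "('a::complex_normed_vector \<Rightarrow> 'a) \<Rightarrow> 'a set \<Rightarrow> 'a set \<Rightarrow> bool"
  where "reducing_pair T X1 X2 \<longleftrightarrow>
    csubspace X1 \<and> closed X1 \<and> T ` X1 \<subseteq> X1 \<and>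
    csubspace X2 \<and> closed X2 \<and> T ` X2 \<subseteq> X2 \<and>
    X1 \<inter> X2 = {0} \<and> (\<forall>x. \<exists>u\<in>X1. \<exists>v\<in>X2. x = u + v)"

definition pseudo_b_fredholm :: "('a::complex_normed_vector \<Rightarrow> 'a) \<Rightarrow> bool"
  where "pseudo_b_fredholm T \<longleftrightarrow>
    (\<exists>X1 X2. reducing_pair T X1 X2 \<and> fredholm_on X1 T \<and> quasinilpotent_on X2 T)"

definition gen_drazin_invertible :: "('a::complex_normed_vector \<Rightarrow> 'a) \<Rightarrow> bool"
  where "gen_drazin_invertible T \<longleftrightarrow>
    (\<exists>X1 X2. reducing_pair T X1 X2 \<and> invertible_on X1 T \<and> quasinilpotent_on X2 T)"


section \<open>Spectra\<close>

definition \<sigma>_e :: "('a::complex_normed_vector \<Rightarrow> 'a) \<Rightarrow> complex set"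
  where "\<sigma>_e T = {l. \<not> fredholm (shift T l)}"

definition \<sigma>_B :: "('a::complex_normed_vector \<Rightarrow> 'a) \<Rightarrow> complex set"
  where "\<sigma>_B T = {l. \<not> browder (shift T l)}"

definition \<sigma>_BF :: "('a::complex_normed_vector \<Rightarrow> 'a) \<Rightarrow> complex set"
  where "\<sigma>_BF T = {l. \<not> b_fredholm (shift T l)}"

definition \<sigma>_D :: "('a::complex_normed_vector \<Rightarrow> 'a) \<Rightarrow> complex set"
  where "\<sigma>_D T = {l. \<not> drazin_invertible (shift T l)}"

definition \<sigma>_pBF :: "('a::complex_normed_vector \<Rightarrow> 'a) \<Rightarrow> complex set"
  where "\<sigma>_pBF T = {l. \<not> pseudo_b_fredholm (shift T l)}"

definition \<sigma>_gD :: "('a::complex_normed_vector \<Rightarrow> 'a) \<Rightarrow> complex set"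
  where "\<sigma>_gD T = {l. \<not> gen_drazin_invertible (shift T l)}"


section \<open>The single valued extension property\<close>

text \<open>
  The library's \<open>holomorphic_on\<close> covers scalar-valued functions only. On an open set \<open>U\<close>, a function
  with values in a complex Banach space is analytic iff it is complex differentiable at every
  point, i.e. Frechet differentiable with a derivative of the form \<open>h \<mapsto> h D\<close>.
\<close>

definition vec_analytic_on ::
    "(complex \<Rightarrow> 'b::complex_normed_vector) \<Rightarrow> complex set \<Rightarrow> bool"
  where "vec_analytic_on f U \<longleftrightarrow>
    (\<forall>z\<in>U. \<exists>D. (f has_derivative (\<lambda>h. h *\<^sub>C D)) (at z))"

definition svep_at :: "('b::complex_normed_vector \<Rightarrow> 'b) \<Rightarrow> complex \<Rightarrow> bool"
  where "svep_at S l \<longleftrightarrow>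
    (\<forall>U f. open U \<and> connected U \<and> l \<in> U \<and> vec_analytic_on f U \<and>
       (\<forall>z\<in>U. shift S z (f z) = 0) \<longrightarrow> (\<forall>z\<in>U. f z = 0))"

end

theory Submission
  imports Defs "HOL-Complex_Analysis.Conformal_Mappings"
begin

text \<open>
  Write \<open>\<rho>\<close> for the set of \<open>z\<close> such that \<open>T - z\<close> is bijective. All six statements are equivalent to the
  condition (C): every point outside the essential spectrum is a limit of points of \<open>\<rho>\<close>.

  If \<open>l\<close> is in the closure of \<open>\<rho>\<close>, then \<open>T\<close> and \<open>T*\<close> have the single valued extension property
  at \<open>l\<close>, by the identity theorem (\<open>svep_at_if_in_closure_resolvent_set\<close>). Moreover, at such a point
  ``Fredholm'' improves to ``Browder'', ``B-Fredholm'' to ``Drazin invertible'' and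
  ``pseudo B-Fredholm'' to ``generalized Drazin invertible''. The three improvements are one fact about
  the restriction of \<open>A = T - l\<close> to a closed invariant subspace \<open>M\<close>
  (\<open>bij_betw_funpow_image_if_near_bij\<close>): if that restriction is Fredholm and 0 is a limit of points \<open>z\<close>
  for which \<open>A - z\<close> is bijective on \<open>M\<close>, then ascent and descent of the restriction are finite. Indeed
  infinite ascent gives vectors \<open>x\<^sub>0 \<noteq> 0\<close>, \<open>x\<^sub>1\<close>, ... of geometric growth with \<open>A x\<^sub>0 = 0\<close> and
  \<open>A x\<^sub>n\<^sub>+\<^sub>1 = x\<^sub>n\<close>, and infinite descent gives functionals that form such a chain for the transpose
  (\<open>ex_backward_chain\<close>, \<open>ex_dual_chain\<close>). The power series \<open>\<Sum>n. z\<^sup>n x\<^sub>n\<close> is an eigenvector of \<open>A\<close> for the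
  eigenvalue \<open>z\<close>, so it vanishes for \<open>z\<close> arbitrarily close to 0, against \<open>x\<^sub>0 \<noteq> 0\<close>; likewise for the
  functionals.

  Next, B-Fredholm and pseudo B-Fredholm points are limits of Fredholm points, since the Fredholm
  property on a closed invariant subspace is stable under small shifts (\<open>fredholm_on_shift\<close>). So under
  (C) they too are in the closure of \<open>\<rho>\<close>, and all six statements follow from (C).

  Conversely, each of the three equalities of spectra makes every Fredholm point generalized Drazin
  invertible, since Browder operators are Drazin invertible and these are generalized Drazin invertible;
  and a generalized Drazin invertible point has a punctured neighbourhood in \<open>\<rho>\<close>
  (\<open>in_closure_resolvent_set_if_gen_drazin_invertible\<close>). Each of the three statements on the single valued
  extension property contains that property at the Fredholm points, where it excludes the two kinds of
  chains above, now on the whole space: they would yield nonzero analytic families of eigenvectors of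
  \<open>T\<close> or of \<open>T*\<close> (\<open>drazin_invertible_if_svep\<close>). Hence Fredholm points are again Drazin invertible.
\<close>

section \<open>Open mappings between closed subspaces\<close>

text \<open>
  The iteration common to the open mapping theorem and to the stability of surjectivity under
  small perturbations: an approximate solution whose error is a fixed fraction of the right-hand
  side is applied to the successive errors, and the corrections in \<open>W\<close> are dominated by a geometric series.
  The set \<open>Y\<close> of right-hand sides need only contain all the errors.
\<close>

lemma approx_surj:
  fixes f :: "'b::banach \<Rightarrow> 'c::real_normed_vector"
  assumes f: "bounded_linear f" and W: "subspace W" "closed W"
    and K: "0 \<le> K" and q: "0 \<le> q" "q < 1"
    and step: "\<And>y. y \<in> Y \<Longrightarrow> \<exists>x\<in>W. norm x \<le> K * norm y \<and> y - f x \<in> Y \<and> norm (y - f x) \<le> q * norm y"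
    and y: "y \<in> Y"
  shows "\<exists>x\<in>W. f x = y \<and> norm x \<le> K / (1 - q) * norm y"
proof -
  interpret f: bounded_linear f by (rule f)
  obtain h where h: "\<And>y. y \<in> Y \<Longrightarrow> h y \<in> W \<and> norm (h y) \<le> K * norm y \<and> y - f (h y) \<in> Y \<and> norm (y - f (h y)) \<le> q * norm y"
    using step by metis
  \<comment> \<open>\<open>r n\<close> is the error left after \<open>n\<close> corrections, \<open>h (r n)\<close> the next correction.\<close>
  define r where "r n = ((\<lambda>y. y - f (h y)) ^^ n) y" for n
  have r_Suc: "r (Suc n) = r n - f (h (r n))" for n
    by (simp add: r_def)
  have r_0: "r 0 = y"
    by (simp add: r_def)
  have rY: "r n \<in> Y" for n
  proof (induction n)
    case (Suc n)
    then show ?case unfolding r_Suc using h by blast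
  qed (simp add: r_0 y)
  have rn: "norm (r n) \<le> q ^ n * norm y" for n
  proof (induction n)
    case (Suc n)
    have "norm (r (Suc n)) \<le> q * norm (r n)"
      using h[OF rY[of n]] by (simp add: r_Suc)
    also have "\<dots> \<le> q * (q ^ n * norm y)"
      using Suc q by (intro mult_left_mono) auto
    finally show ?case by (simp add: mult.assoc)
  qed (simp add: r_0)
  define x where "x n = h (r n)" for n
  have xn: "norm (x n) \<le> q ^ n * (K * norm y)" for n
  proof -
    have "norm (x n) \<le> K * norm (r n)" using h[OF rY[of n]] by (simp add: x_def)
    also have "\<dots> \<le> K * (q ^ n * norm y)" using rn K by (intro mult_left_mono) auto
    finally show ?thesis by (simp add: mult_ac)
  qed
  have geo: "(\<lambda>n. q ^ n * (K * norm y)) sums (1 / (1 - q) * (K * norm y))"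
    using q by (intro sums_mult2 geometric_sums) auto
  have sumn: "summable (\<lambda>n. norm (x n))"
    using xn by (intro summable_comparison_test'[OF sums_summable[OF geo], of 0]) auto
  then have sumx: "summable x" by (rule summable_norm_cancel)
  have part: "(\<Sum>i<n. x i) \<in> W" for n
    unfolding x_def by (intro subspace_sum[OF W(1)] conjunct1[OF h] rY)
  have xW: "suminf x \<in> W"
    by (rule closed_sequentially[OF W(2) part summable_LIMSEQ[OF sumx]])
  have tele: "f (\<Sum>i<n. x i) = y - r n" for n
    by (induction n) (simp_all add: f.zero f.add r_Suc x_def r_0)
  have "r \<longlonglongrightarrow> 0"
  proof (rule Lim_null_comparison)
    show "\<forall>\<^sub>F n in sequentially. norm (r n) \<le> q ^ n * norm y" using rn by simp
    show "(\<lambda>n. q ^ n * norm y) \<longlonglongrightarrow> 0"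
      using q by (intro tendsto_mult_left_zero LIMSEQ_realpow_zero) auto
  qed
  then have "(\<lambda>n. y - r n) \<longlonglongrightarrow> y - 0" by (intro tendsto_intros)
  moreover have "(\<lambda>n. f (\<Sum>i<n. x i)) \<longlonglongrightarrow> f (suminf x)"
    by (intro f.tendsto summable_LIMSEQ sumx)
  ultimately have "f (suminf x) = y"
    using LIMSEQ_unique by (fastforce simp: tele)
  moreover have "norm (suminf x) \<le> K / (1 - q) * norm y"
  proof -
    have "norm (suminf x) \<le> (\<Sum>n. norm (x n))" by (rule summable_norm[OF sumn])
    also have "\<dots> \<le> (\<Sum>n. q ^ n * (K * norm y))"
      by (intro suminf_le xn sumn sums_summable[OF geo])
    also have "\<dots> = K / (1 - q) * norm y" using sums_unique[OF geo] by simp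
    finally show ?thesis .
  qed
  ultimately show ?thesis using xW by blast
qed

text \<open>
  Closed subspaces are not types, so the theorem is stated for the restriction of an operator to a
  closed subspace \<open>W\<close> with closed image. By Baire's theorem the closure of the image of some ball has
  interior in \<open>f ` W\<close>; differences of points of that ball then solve \<open>f x = y\<close> up to an arbitrarily
  small error with a controlled norm, and the iteration above removes the error.
\<close>

theorem open_mapping:
  fixes f :: "'b::banach \<Rightarrow> 'c::banach"
  assumes f: "bounded_linear f" and W: "subspace W" "closed W" and V: "closed (f ` W)"
  obtains C where "C > 0" "\<And>y. y \<in> f ` W \<Longrightarrow> \<exists>x\<in>W. f x = y \<and> norm x \<le> C * norm y"
proof -
  interpret f: bounded_linear f by (rule f)
  let ?V = "f ` W"
  define A where "A n = closure (f ` (W \<inter> cball 0 (real n)))" for n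
  have subV: "subspace ?V"
    by (rule linear_subspace_image[OF _ W(1)]) (rule f.linear_axioms)
  have AV: "A n \<subseteq> ?V" for n
    unfolding A_def by (rule closure_minimal[OF _ V]) blast
  have cover: "\<Union> (range A) = ?V"
  proof
    show "?V \<subseteq> \<Union> (range A)"
    proof
      fix y assume "y \<in> ?V"
      then obtain x where x: "x \<in> W" "y = f x" by blast
      obtain n where "norm x \<le> real n" using real_arch_simple by blast
      then have "y \<in> f ` (W \<inter> cball 0 (real n))" using x by auto
      then show "y \<in> \<Union> (range A)" using closure_subset by (fastforce simp: A_def)
    qed
  qed (use AV in blast)
  have cm: "completely_metrizable_space (top_of_set ?V)"
    using V by (simp add: completely_metrizable_space_closedin completely_metrizable_space_euclidean)
  have "\<exists>n. top_of_set ?V interior_of (A n) \<noteq> {}"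
  proof (rule ccontr)
    assume "\<not> ?thesis"
    then have "top_of_set ?V interior_of \<Union> (range A) = {}"
    proof (intro Baire_category_alt)
      fix B assume "B \<in> range A"
      then obtain n where n: "B = A n" by blast
      have "closedin (top_of_set ?V) (A n)"
        by (rule closed_subset[OF AV]) (simp add: A_def)
      then show "closedin (top_of_set ?V) B \<and> top_of_set ?V interior_of B = {}"
        using \<open>\<not> _\<close> n by blast
    qed (use cm in auto)
    then show False
      using cover subspace_0[OF subV] interior_of_topspace[of "top_of_set ?V"] by auto
  qed
  then obtain n y0 where "y0 \<in> top_of_set ?V interior_of (A n)" by blast
  then obtain U where U: "openin (top_of_set ?V) U" "U \<subseteq> A n" "y0 \<in> U"
    by (auto simp: interior_of_def)
  then obtain r where r: "r > 0" "ball y0 r \<inter> ?V \<subseteq> A n" and y0: "y0 \<in> ?V"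
    by (meson openin_contains_ball order_trans subsetD)
  have small: "\<exists>x\<in>W. norm x \<le> 2 * real n \<and> norm (y - f x) \<le> e"
    if y: "y \<in> ?V" "norm y < r" and e: "e > 0" for y e
  proof -
    have "y0 + y \<in> A n" "y0 \<in> A n"
      using r y y0 subspace_add[OF subV] by (auto simp: dist_norm)
    then obtain x1 x2 where x: "x1 \<in> W" "x2 \<in> W" "norm x1 \<le> real n" "norm x2 \<le> real n"
      "dist (f x1) (y0 + y) < e/2" "dist (f x2) y0 < e/2"
    proof -
      have "\<forall>d>0. \<exists>x\<in>f ` (W \<inter> cball 0 (real n)). dist x z < d" if "z \<in> A n" for z
        using that unfolding A_def closure_approachable by blast
      note ap = this[rule_format, OF _ half_gt_zero[OF e]]
      show ?thesis
        using ap[OF \<open>y0 + y \<in> A n\<close>] ap[OF \<open>y0 \<in> A n\<close>] that by auto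
    qed
    have "norm (y - f (x1 - x2)) = norm ((f x2 - y0) - (f x1 - (y0 + y)))"
      by (simp add: f.diff algebra_simps)
    also have "\<dots> \<le> norm (f x2 - y0) + norm (f x1 - (y0 + y))" by (rule norm_triangle_ineq4)
    finally have "norm (y - f (x1 - x2)) \<le> e" using x by (simp add: dist_norm)
    moreover have "norm (x1 - x2) \<le> 2 * real n" using norm_triangle_ineq4[of x1 x2] x by simp
    ultimately show ?thesis using subspace_diff[OF W(1) x(1,2)] by blast
  qed
  define K where "K = 4 * real n / r"
  have step: "\<exists>x\<in>W. norm x \<le> K * norm y \<and> y - f x \<in> ?V \<and> norm (y - f x) \<le> 1/2 * norm y"
    if y: "y \<in> ?V" for y
  proof (cases "y = 0")
    case True
    then show ?thesis using subspace_0[OF W(1)] subspace_0[OF subV] by (auto simp: f.zero)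
  next
    case False
    define t where "t = r / (2 * norm y)"
    have t: "t > 0" using r False by (simp add: t_def)
    have "norm (t *\<^sub>R y) < r" using r False by (simp add: t_def)
    then obtain x where x: "x \<in> W" "norm x \<le> 2 * real n" "norm (t *\<^sub>R y - f x) \<le> r/4"
      using small[OF subspace_scale[OF subV y], of t "r/4"] r by auto
    let ?x = "inverse t *\<^sub>R x"
    have W': "?x \<in> W" by (rule subspace_scale[OF W(1) x(1)])
    have "norm ?x \<le> inverse t * (2 * real n)" using x t by (simp add: mult_left_mono)
    also have "\<dots> = K * norm y" using r by (simp add: t_def K_def)
    finally have n1: "norm ?x \<le> K * norm y" .
    have "y - f ?x = inverse t *\<^sub>R (t *\<^sub>R y - f x)"
      using t by (simp add: f.scale algebra_simps)
    then have "norm (y - f ?x) = inverse t * norm (t *\<^sub>R y - f x)" using t by simp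
    also have "\<dots> \<le> inverse t * (r/4)" using x t by (simp add: mult_left_mono)
    also have "\<dots> = 1/2 * norm y" using r by (simp add: t_def)
    finally show ?thesis using W' n1 subspace_diff[OF subV y] by blast
  qed
  have K: "0 \<le> K" using r by (simp add: K_def)
  have fin: "\<exists>x\<in>W. f x = y \<and> norm x \<le> K / (1 - 1/2) * norm y" if "y \<in> ?V" for y
    by (rule approx_surj[OF f W K _ _ step that]) auto
  show ?thesis
  proof (rule that)
    show "2 * K + 1 > 0" using K by simp
    fix y assume "y \<in> ?V"
    then obtain x where "x \<in> W" "f x = y" "norm x \<le> 2 * K * norm y" using fin[of y] by auto
    then show "\<exists>x\<in>W. f x = y \<and> norm x \<le> (2 * K + 1) * norm y"
      by (intro bexI[of _ x]) (auto simp: distrib_right intro: add_increasing2)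
  qed
qed

section \<open>Complex-linear preliminaries\<close>

lemma csubspace_imp_subspace: "csubspace M \<Longrightarrow> subspace M"
  unfolding subspace_def complex_vector.subspace_def by (simp add: scaleR_scaleC)

lemma bounded_clinear_bounded_linear: "bounded_clinear f \<Longrightarrow> bounded_linear f"
  by (simp add: bounded_clinear_def)

lemma bounded_clinear_linear: "bounded_clinear f \<Longrightarrow> Vector_Spaces.linear scaleC scaleC f"
  unfolding bounded_clinear_def
  by (intro Vector_Spaces.linear.intro complex_vector.vector_space_axioms module_hom.intro
      complex_vector.module_axioms module_hom_axioms.intro)
    (auto simp: bounded_linear.linear linear_add)

lemma bounded_clinear_module_hom: "bounded_clinear f \<Longrightarrow> module_hom scaleC scaleC f"
  using bounded_clinear_linear Vector_Spaces.linear.axioms by blast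

lemma csubspace_image: "bounded_clinear f \<Longrightarrow> csubspace M \<Longrightarrow> csubspace (f ` M)"
  by (rule module_hom.subspace_image[OF bounded_clinear_module_hom])

lemma csubspace_kernel: "bounded_clinear f \<Longrightarrow> csubspace (kernel f)"
  unfolding kernel_def by (rule module_hom.subspace_kernel[OF bounded_clinear_module_hom])

lemma cspan_image: "bounded_clinear f \<Longrightarrow> cspan (f ` B) = f ` cspan B"
  by (rule module_hom.span_image[OF bounded_clinear_module_hom])

lemma closed_kernel: "bounded_clinear f \<Longrightarrow> closed (kernel f)"
  unfolding kernel_def
  by (intro closed_Collect_eq continuous_intros linear_continuous_on bounded_clinear_bounded_linear)

lemma bounded_linear_scaleC: "bounded_linear (\<lambda>x. c *\<^sub>C x :: 'a::complex_normed_vector)"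
  by (rule bounded_linear_intro[of _ "cmod c"])
    (simp_all add: scaleC_add_right scaleR_scaleC scaleC_scaleC norm_scaleC mult.commute)

lemma bounded_linear_scaleC_left: "bounded_linear (\<lambda>c. c *\<^sub>C x :: 'a::complex_normed_vector)"
  by (rule bounded_linear_intro[of _ "norm x"])
    (simp_all add: scaleC_add_left scaleR_scaleC scaleC_scaleC norm_scaleC scaleC_complex_def)

lemma bounded_clinear_compose:
  "bounded_clinear f \<Longrightarrow> bounded_clinear g \<Longrightarrow> bounded_clinear (\<lambda>x. f (g x))"
  by (simp add: bounded_clinear_def bounded_linear_compose)

lemma bounded_clinear_ident: "bounded_clinear (\<lambda>x. x)"
  by (simp add: bounded_clinear_def bounded_linear_ident)

lemma bounded_clinear_funpow:
  "bounded_clinear (f :: 'a::complex_normed_vector \<Rightarrow> 'a) \<Longrightarrow> bounded_clinear (f ^^ n)"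
proof (induction n)
  case (Suc n)
  then show ?case using bounded_clinear_compose[of f "f ^^ n"] by (simp add: comp_def)
qed (simp add: bounded_clinear_ident id_def)

lemma bounded_clinear_shift: "bounded_clinear f \<Longrightarrow> bounded_clinear (shift f l)"
  by (simp add: bounded_clinear_def bounded_linear_sub bounded_linear_scaleC scaleC_scaleC
      complex_vector.scale_right_diff_distrib mult.commute)

lemma cspan_subspace_Un:
  assumes "csubspace R"
  shows "cspan (R \<union> B) = {r + v | r v. r \<in> R \<and> v \<in> cspan B}"
proof -
  have "cspan R = R" using assms by (simp only: complex_vector.span_eq_iff)
  then show ?thesis using complex_vector.span_Un[of R B] by (simp only:)
qed

section \<open>Finite-dimensional subspaces\<close>

text \<open>
  Convergent sequences are bounded, so closedness can be tested inside balls.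
\<close>

lemma closed_if_compact_Int_cball:
  fixes N :: "'a::real_normed_vector set"
  assumes "\<And>r. compact (N \<inter> cball 0 r)"
  shows "closed N"
  unfolding closed_sequential_limits
proof (intro allI impI, elim conjE)
  fix x l assume x: "\<forall>n. x n \<in> N" "x \<longlonglongrightarrow> l"
  obtain r where r: "\<And>n. norm (x n) \<le> r"
    using convergent_imp_Bseq[of x] x(2) by (auto simp: convergent_def Bseq_def)
  have "l \<in> N \<inter> cball 0 r"
    by (rule closed_sequentially[OF compact_imp_closed[OF assms] _ x(2)]) (use x(1) r in auto)
  then show "l \<in> N" by blast
qed

text \<open>
  Induction on the spanning set. If \<open>b\<close> is at distance \<open>d > 0\<close> from the (closed) span of the others,
  the coefficient of \<open>b\<close> in \<open>x\<close> is at most \<open>norm x / d\<close>, so the ball lies in the continuous image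
  of a product of two compact sets.
\<close>

lemma compact_cspan_Int_cball:
  fixes B :: "'a::complex_normed_vector set"
  assumes "finite B"
  shows "compact (cspan B \<inter> cball 0 r)"
  using assms
proof (induction B arbitrary: r)
  case empty
  then show ?case by (simp add: Int_insert_left)
next
  case (insert b B)
  let ?N = "cspan B"
  show ?case
  proof (cases "b \<in> ?N")
    case True
    then show ?thesis using insert.IH by (simp add: complex_vector.span_redundant)
  next
    case False
    have clN: "closed ?N" by (rule closed_if_compact_Int_cball) (rule insert.IH)
    have neN: "?N \<noteq> {}" using complex_vector.span_zero by blast
    define d where "d = infdist b ?N"
    have d: "d > 0"
      unfolding d_def by (rule infdist_pos_not_in_closed[OF clN neN False])
    have coef: "cmod k * d \<le> norm (n + k *\<^sub>C b)" if n: "n \<in> ?N" for n k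
    proof (cases "k = 0")
      case False
      have "- (inverse k *\<^sub>C n) \<in> ?N"
        by (intro complex_vector.span_neg complex_vector.span_scale n)
      then have "d \<le> dist b (- (inverse k *\<^sub>C n))" unfolding d_def by (rule infdist_le)
      then have "cmod k * d \<le> cmod k * norm (b + inverse k *\<^sub>C n)"
        by (intro mult_left_mono) (auto simp: dist_norm)
      also have "\<dots> = norm (k *\<^sub>C (b + inverse k *\<^sub>C n))" by (simp add: norm_scaleC)
      also have "k *\<^sub>C (b + inverse k *\<^sub>C n) = n + k *\<^sub>C b"
        using False by (simp add: scaleC_add_right scaleC_scaleC scaleC_one)
      finally show ?thesis .
    qed simp
    define R where "R = r + r / d * norm b"
    define K where "K = (\<lambda>(n, k). n + k *\<^sub>C b) ` ((?N \<inter> cball 0 R) \<times> cball 0 (r / d))"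
    have "compact K"
      unfolding K_def case_prod_unfold
      by (intro compact_continuous_image compact_Times insert.IH compact_cball
          continuous_intros bounded_linear.continuous_on[OF bounded_linear_scaleC_left])
    moreover have "cspan (insert b B) \<inter> cball 0 r = K \<inter> cball 0 r"
    proof (intro equalityI subsetI)
      fix x assume x: "x \<in> cspan (insert b B) \<inter> cball 0 r"
      then obtain k where k: "x - k *\<^sub>C b \<in> ?N" by (auto simp: complex_vector.span_insert)
      have "cmod k * d \<le> r" using coef[OF k, of k] x by simp
      then have kd: "cmod k \<le> r / d" using d by (simp add: field_simps)
      have "norm (x - k *\<^sub>C b) \<le> norm x + norm (k *\<^sub>C b)" by (rule norm_triangle_ineq4)
      also have "\<dots> \<le> R"
        using x kd unfolding R_def norm_scaleC by (intro add_mono mult_right_mono) auto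
      finally show "x \<in> K \<inter> cball 0 r"
        using x k kd unfolding K_def by (auto intro!: image_eqI[of _ _ "(x - k *\<^sub>C b, k)"])
    next
      fix x assume x: "x \<in> K \<inter> cball 0 r"
      then obtain n k where "n \<in> ?N" "x = n + k *\<^sub>C b" by (auto simp: K_def)
      then have "x - k *\<^sub>C b \<in> ?N" by simp
      then show "x \<in> cspan (insert b B) \<inter> cball 0 r"
        using x by (auto simp: complex_vector.span_insert)
    qed
    ultimately show ?thesis by (auto intro: compact_Int_closed)
  qed
qed

lemma closed_cspan_finite: "finite B \<Longrightarrow> closed (cspan B)"
  by (rule closed_if_compact_Int_cball) (rule compact_cspan_Int_cball)

text \<open>
  This is what makes the finiteness of the kernel stable under perturbation. The unit sphere of \<open>L\<close>
  stays close to a ball of \<open>cspan B\<close>, which is compact and thus covered by finitely many small balls.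
  Picking a point of \<open>L\<close> near each centre gives a finite-dimensional \<open>E \<subseteq> L\<close> that approximates every
  \<open>x\<close> in \<open>L\<close> with error at most \<open>3/4 * norm x\<close>, and iterating the approximation gives \<open>L = E\<close>.
\<close>

lemma finite_dim_if_near_finite_dim:
  fixes L :: "'a::complex_banach set"
  assumes B: "finite B" and L: "csubspace L"
    and near: "\<And>x. x \<in> L \<Longrightarrow> \<exists>n\<in>cspan B. norm (x - n) \<le> norm x / 4"
  shows "\<exists>B'. finite B' \<and> L = cspan B'"
proof -
  obtain k where k: "finite k" "cspan B \<inter> cball 0 2 \<subseteq> (\<Union>x\<in>k. ball x (1/8))"
    using compact_cspan_Int_cball[OF B, of 2] unfolding compact_eq_totally_bounded
    by (meson zero_less_divide_1_iff zero_less_numeral)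
  \<comment> \<open>The radii fit together as \<open>1/4 + 1/8 \<le> 3/8\<close> and \<open>3/8 + 3/8 = 3/4\<close>;
    the default value 0 keeps \<open>h c\<close> in \<open>L\<close>.\<close>
  define h where "h c = (if \<exists>x\<in>L. norm (x - c) < 3/8 then SOME x. x \<in> L \<and> norm (x - c) < 3/8 else 0)" for c
  have h1: "h c \<in> L \<and> norm (h c - c) < 3/8" if "x \<in> L" "norm (x - c) < 3/8" for x c
    using that someI[of "\<lambda>x. x \<in> L \<and> norm (x - c) < 3/8" x] by (auto simp: h_def)
  have hL: "h c \<in> L" for c
    using h1[of _ c] complex_vector.subspace_0[OF L] by (cases "\<exists>x\<in>L. norm (x - c) < 3/8") (auto simp: h_def)
  let ?E = "cspan (h ` k)"
  have EL: "?E \<subseteq> L" by (rule complex_vector.span_minimal[OF _ L]) (use hL in blast)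
  have unit: "\<exists>e\<in>?E. norm (x - e) \<le> 3/4" if x: "x \<in> L" "norm x = 1" for x
  proof -
    obtain n where n: "n \<in> cspan B" "norm (x - n) \<le> 1/4" using near[OF x(1)] x(2) by auto
    have "norm n \<le> norm x + norm (x - n)" using norm_triangle_sub[of n x] by (simp add: norm_minus_commute)
    then have "n \<in> cspan B \<inter> cball 0 2" using n x by simp
    then obtain c where c: "c \<in> k" "dist c n < 1/8" using k by auto
    have "norm (x - c) \<le> norm (x - n) + norm (n - c)" by (metis diff_add_cancel norm_diff_triangle_ineq add_diff_eq norm_triangle_ineq)
    then have xc: "norm (x - c) < 3/8" using n c by (simp add: dist_norm norm_minus_commute)
    have "norm (x - h c) \<le> norm (x - c) + norm (h c - c)"
      using norm_triangle_ineq4[of "x - c" "h c - c"] by simp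
    then have "norm (x - h c) \<le> 3/4" using xc h1[OF x(1) xc] by simp
    then show ?thesis using c by (intro bexI[of _ "h c"] complex_vector.span_base) auto
  qed
  have step: "\<exists>e\<in>?E. norm e \<le> 7/4 * norm x \<and> x - e \<in> L \<and> norm (x - e) \<le> 3/4 * norm x"
    if x: "x \<in> L" for x
  proof (cases "x = 0")
    case True
    then show ?thesis using complex_vector.span_zero complex_vector.subspace_0[OF L] by auto
  next
    case False
    let ?c = "complex_of_real (norm x)"
    have "norm (inverse ?c *\<^sub>C x) = 1" using False by (simp add: norm_scaleC norm_inverse)
    then obtain e where e: "e \<in> ?E" "norm (inverse ?c *\<^sub>C x - e) \<le> 3/4"
      using unit complex_vector.subspace_scale[OF L x] by blast
    have eq: "x - ?c *\<^sub>C e = ?c *\<^sub>C (inverse ?c *\<^sub>C x - e)"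
      using False by (simp add: complex_vector.scale_right_diff_distrib scaleC_scaleC scaleC_one)
    have le: "norm (x - ?c *\<^sub>C e) \<le> 3/4 * norm x"
      unfolding eq norm_scaleC using mult_left_mono[OF e(2), of "norm x"] by (simp add: mult.commute)
    have ce: "?c *\<^sub>C e \<in> ?E" by (rule complex_vector.span_scale[OF e(1)])
    have "norm (?c *\<^sub>C e) \<le> norm x + norm (x - ?c *\<^sub>C e)"
      using norm_triangle_ineq4[of x "x - ?c *\<^sub>C e"] by simp
    with le have "norm (?c *\<^sub>C e) \<le> 7/4 * norm x" by simp
    then show ?thesis using ce le EL complex_vector.subspace_diff[OF L x] by blast
  qed
  have "L \<subseteq> ?E"
  proof
    fix x assume "x \<in> L"
    from approx_surj[OF bounded_linear_ident csubspace_imp_subspace closed_cspan_finite _ _ _ step this]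
    show "x \<in> ?E" using k(1) by (auto simp: complex_vector.subspace_span)
  qed
  then show ?thesis using EL k(1) by blast
qed

text \<open>
  A vector of \<open>B\<close> is kept exactly when it is not yet in the span of \<open>R\<close> and the previous ones.
\<close>

lemma algebraic_complement_in_finite_extension:
  fixes R :: "'a::complex_normed_vector set"
  assumes R: "csubspace R" and B: "finite B"
  shows "\<exists>B'\<subseteq>B. cspan (R \<union> B') = cspan (R \<union> B) \<and> R \<inter> cspan B' = {0}"
  using B
proof (induction B)
  case empty
  then show ?case using complex_vector.subspace_0[OF R] by auto
next
  case (insert b B)
  from insert.IH obtain B' where B': "B' \<subseteq> B" "cspan (R \<union> B') = cspan (R \<union> B)" "R \<inter> cspan B' = {0}" by (elim exE conjE)
  show ?case
  proof (cases "b \<in> cspan (R \<union> B)")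
    case True
    then show ?thesis using B' by (intro exI[of _ B']) (auto simp: complex_vector.span_redundant)
  next
    case False
    have "v = 0" if v: "v \<in> R" "v \<in> cspan (insert b B')" for v
    proof -
      obtain k where k: "v - k *\<^sub>C b \<in> cspan B'" using v(2) by (auto simp: complex_vector.span_insert)
      have "k = 0"
      proof (rule ccontr)
        assume "k \<noteq> 0"
        have "v - (v - k *\<^sub>C b) \<in> cspan (R \<union> B')"
        proof (rule complex_vector.span_diff)
          show "v \<in> cspan (R \<union> B')" by (rule complex_vector.span_base) (simp add: v(1))
          show "v - k *\<^sub>C b \<in> cspan (R \<union> B')"
            by (rule complex_vector.span_mono[THEN subsetD, OF _ k]) blast
        qed
        then have "inverse k *\<^sub>C k *\<^sub>C b \<in> cspan (R \<union> B')"
          using complex_vector.span_scale by (metis diff_diff_eq2 add_diff_cancel_left' )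
        then show False using False B'(2) \<open>k \<noteq> 0\<close> by (simp add: scaleC_scaleC scaleC_one)
      qed
      then show ?thesis using k v B'(3) by auto
    qed
    then have "R \<inter> cspan (insert b B') = {0}"
      using complex_vector.subspace_0[OF R] complex_vector.span_zero by blast
    moreover have "cspan (R \<union> insert b B') = cspan (R \<union> insert b B)"
      using B'(2) by (simp add: complex_vector.span_insert)
    ultimately show ?thesis using B'(1) by (intro exI[of _ "insert b B'"]) auto
  qed
qed

text \<open>
  After adding an algebraic complement \<open>F\<close> of the range, the map \<open>(x, v) \<mapsto> f x + v\<close> has closed image,
  so the open mapping theorem bounds the \<open>F\<close>-component of a vector by the norm of that vector.
  Hence the \<open>F\<close>-component of a limit of points of the range is 0.
\<close>

lemma closed_range_if_finite_codim:
  fixes f :: "'b::banach \<Rightarrow> 'c::complex_banach"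
  assumes f: "bounded_linear f" and W: "subspace W" "closed W"
    and R: "csubspace (f ` W)" and B: "finite B" and V: "closed (cspan (f ` W \<union> B))"
  shows "closed (f ` W)"
proof -
  interpret f: bounded_linear f by (rule f)
  obtain B' where B': "B' \<subseteq> B" "cspan (f ` W \<union> B') = cspan (f ` W \<union> B)" "f ` W \<inter> cspan B' = {0}"
    using algebraic_complement_in_finite_extension[OF R B] by blast
  have fin: "finite B'" using B' B finite_subset by blast
  define g where "g p = f (fst p) + snd p" for p
  have g: "bounded_linear g" unfolding g_def
    by (intro bounded_linear_add bounded_linear_compose[OF f] bounded_linear_fst bounded_linear_snd)
  let ?F = "cspan B'"
  have F: "subspace ?F" by (simp add: csubspace_imp_subspace)
  have gW: "g ` (W \<times> ?F) = cspan (f ` W \<union> B)"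
    unfolding B'(2)[symmetric] cspan_subspace_Un[OF R, of B'] by (force simp: g_def)
  obtain C where C: "C > 0" "\<And>y. y \<in> g ` (W \<times> ?F) \<Longrightarrow> \<exists>x\<in>W \<times> ?F. g x = y \<and> norm x \<le> C * norm y"
    using open_mapping[OF g subspace_Times[OF W(1) F] closed_Times[OF W(2) closed_cspan_finite[OF fin]]] V gW
    by metis
  show ?thesis unfolding closed_sequential_limits
  proof (intro allI impI, elim conjE)
    fix y l assume y: "\<forall>n. y n \<in> f ` W" "y \<longlonglongrightarrow> l"
    have inV: "f ` W \<subseteq> g ` (W \<times> ?F)"
      unfolding gW by (meson Un_upper1 complex_vector.span_superset order_trans)
    have "l \<in> g ` (W \<times> ?F)"
    proof (rule closed_sequentially[OF _ _ y(2)])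
      show "closed (g ` (W \<times> ?F))" using V by (simp only: gW)
      show "y n \<in> g ` (W \<times> ?F)" for n using y(1) inV by blast
    qed
    then obtain x v where l: "x \<in> W" "v \<in> ?F" "l = f x + v" by (auto simp: g_def)
    have subV: "subspace (g ` (W \<times> ?F))"
      unfolding gW by (simp add: csubspace_imp_subspace)
    have bd: "norm v \<le> C * norm (y n - l)" for n
    proof -
      have "y n - l \<in> g ` (W \<times> ?F)"
        using y(1) inV \<open>l \<in> _\<close> by (intro subspace_diff[OF subV]) auto
      then obtain x' v' where x': "x' \<in> W" "v' \<in> ?F" "f x' + v' = y n - l" "norm (x', v') \<le> C * norm (y n - l)"
        using C(2) by (fastforce simp: g_def)
      obtain w where w: "w \<in> W" "y n = f w" using y(1) by blast
      have "v + v' = f (w - x - x')"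
        using x'(3) l(3) w(2) by (simp add: f.diff f.add algebra_simps)
      moreover have "w - x - x' \<in> W" using l(1) x'(1) w(1) W(1) by (simp add: subspace_diff)
      ultimately have "v + v' \<in> f ` W \<inter> ?F"
        using complex_vector.span_add[OF l(2) x'(2)] by blast
      then have "v = - v'" using B'(3) by (simp add: eq_neg_iff_add_eq_0)
      then show ?thesis using x'(4) norm_snd_le[of v' x'] by simp
    qed
    have "(\<lambda>n. C * norm (y n - l)) \<longlonglongrightarrow> C * norm (l - l)"
      by (intro tendsto_intros y)
    then have "norm v \<le> 0"
      using bd by (intro LIMSEQ_le_const[of "\<lambda>n. C * norm (y n - l)"]) auto
    then show "l \<in> f ` W" using l by simp
  qed
qed

section \<open>Functionals vanishing on a closed subspace\<close>

text \<open>
  A Hahn--Banach theorem is needed twice: to scalarize analytic functions with values in a Banach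
  space, and to find a first functional that annihilates a closed subspace. The argument below uses
  that a minimal sublinear functional is linear.
\<close>

definition sublinear :: "('a::real_vector \<Rightarrow> real) \<Rightarrow> bool"
  where "sublinear p \<longleftrightarrow>
    (\<forall>x y. p (x + y) \<le> p x + p y) \<and> (\<forall>t>0. \<forall>x. p (t *\<^sub>R x) \<le> t * p x)"

lemma sublinear_add: "sublinear p \<Longrightarrow> p (x + y) \<le> p x + p y"
  by (simp add: sublinear_def)

lemma sublinear_scale: "sublinear p \<Longrightarrow> t > 0 \<Longrightarrow> p (t *\<^sub>R x) = t * p x"
proof (rule antisym)
  assume p: "sublinear p" and t: "t > 0"
  then show "p (t *\<^sub>R x) \<le> t * p x" by (simp add: sublinear_def)
  have "p (inverse t *\<^sub>R (t *\<^sub>R x)) \<le> inverse t * p (t *\<^sub>R x)"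
    using p t unfolding sublinear_def by (meson positive_imp_inverse_positive)
  then show "t * p x \<le> p (t *\<^sub>R x)" using t by (simp add: field_simps)
qed

lemma sublinear_zero: "sublinear p \<Longrightarrow> p 0 = 0"
  using sublinear_scale[of p 2 0] by simp

lemma sublinear_lower: "sublinear p \<Longrightarrow> - p (- x) \<le> p x"
  using sublinear_add[of p x "- x"] sublinear_zero[of p] by simp

text \<open>
  For sublinear \<open>p\<close> this is a sublinear functional below \<open>p\<close> whose value at \<open>- y\<close> is at most \<open>- p y\<close>.
  It differs from \<open>p\<close> unless \<open>p (x + y) = p x + p y\<close> for all \<open>x\<close>.
\<close>

definition directional_reduct :: "('a::real_vector \<Rightarrow> real) \<Rightarrow> 'a \<Rightarrow> 'a \<Rightarrow> real"
  where "directional_reduct p y x = (INF t\<in>{0..}. p (x + t *\<^sub>R y) - t * p y)"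

lemma directional_reduct_le:
  assumes p: "sublinear p" and t: "0 \<le> t"
  shows "directional_reduct p y x \<le> p (x + t *\<^sub>R y) - t * p y"
  unfolding directional_reduct_def
proof (rule cINF_lower)
  show "bdd_below ((\<lambda>t. p (x + t *\<^sub>R y) - t * p y) ` {0..})"
  proof (rule bdd_belowI2)
    fix s :: real assume s: "s \<in> {0..}"
    have "s * p y = p (s *\<^sub>R y)"
      using s sublinear_scale[OF p, of s y] sublinear_zero[OF p] by (cases "s = 0") auto
    also have "\<dots> \<le> p (x + s *\<^sub>R y) + p (- x)"
      using sublinear_add[OF p, of "x + s *\<^sub>R y" "- x"] by simp
    finally show "- p (- x) \<le> p (x + s *\<^sub>R y) - s * p y" by simp
  qed
qed (use t in simp)

lemma directional_reduct_greatest: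
  "(\<And>t. 0 \<le> t \<Longrightarrow> c \<le> p (x + t *\<^sub>R y) - t * p y) \<Longrightarrow> c \<le> directional_reduct p y x"
  unfolding directional_reduct_def by (rule cINF_greatest) auto

lemma sublinear_directional_reduct:
  assumes p: "sublinear p"
  shows "sublinear (directional_reduct p y)"
  unfolding sublinear_def
proof (intro conjI allI impI)
  fix x1 x2
  have "directional_reduct p y (x1 + x2) - directional_reduct p y x1 \<le> directional_reduct p y x2"
  proof (rule directional_reduct_greatest)
    fix t2 :: real assume t2: "0 \<le> t2"
    have "directional_reduct p y (x1 + x2) - (p (x2 + t2 *\<^sub>R y) - t2 * p y) \<le> directional_reduct p y x1"
    proof (rule directional_reduct_greatest)
      fix t1 :: real assume t1: "0 \<le> t1"
      have "directional_reduct p y (x1 + x2) \<le> p (x1 + x2 + (t1 + t2) *\<^sub>R y) - (t1 + t2) * p y"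
        by (rule directional_reduct_le[OF p]) (use t1 t2 in simp)
      also have "x1 + x2 + (t1 + t2) *\<^sub>R y = (x1 + t1 *\<^sub>R y) + (x2 + t2 *\<^sub>R y)"
        by (simp add: scaleR_add_left)
      also have "p \<dots> \<le> p (x1 + t1 *\<^sub>R y) + p (x2 + t2 *\<^sub>R y)" by (rule sublinear_add[OF p])
      finally show "directional_reduct p y (x1 + x2) - (p (x2 + t2 *\<^sub>R y) - t2 * p y)
          \<le> p (x1 + t1 *\<^sub>R y) - t1 * p y"
        by (simp add: distrib_right)
    qed
    then show "directional_reduct p y (x1 + x2) - directional_reduct p y x1 \<le> p (x2 + t2 *\<^sub>R y) - t2 * p y"
      by simp
  qed
  then show "directional_reduct p y (x1 + x2) \<le> directional_reduct p y x1 + directional_reduct p y x2"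
    by simp
next
  fix s :: real and x assume s: "0 < s"
  have "directional_reduct p y (s *\<^sub>R x) / s \<le> directional_reduct p y x"
  proof (rule directional_reduct_greatest)
    fix t :: real assume t: "0 \<le> t"
    have "directional_reduct p y (s *\<^sub>R x) \<le> p (s *\<^sub>R x + (s * t) *\<^sub>R y) - s * t * p y"
      by (rule directional_reduct_le[OF p]) (use s t in simp)
    also have "s *\<^sub>R x + (s * t) *\<^sub>R y = s *\<^sub>R (x + t *\<^sub>R y)" by (simp add: scaleR_add_right)
    also have "p \<dots> - s * t * p y = s * (p (x + t *\<^sub>R y) - t * p y)"
      using sublinear_scale[OF p s] by (simp add: right_diff_distrib)
    finally show "directional_reduct p y (s *\<^sub>R x) / s \<le> p (x + t *\<^sub>R y) - t * p y"
      using s by (simp add: divide_le_eq mult.commute)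
  qed
  then show "directional_reduct p y (s *\<^sub>R x) \<le> s * directional_reduct p y x"
    using s by (simp add: divide_le_eq mult.commute)
qed

text \<open>
  Zorn's lemma: the pointwise infimum of a chain is finite because \<open>q x \<ge> - p (- x)\<close> for every
  sublinear \<open>q \<le> p\<close>, and it is subadditive because any two members of the chain are comparable.
\<close>

lemma ex_minimal_sublinear:
  assumes p: "sublinear p"
  shows "\<exists>m. sublinear m \<and> m \<le> p \<and> (\<forall>q. sublinear q \<and> q \<le> m \<longrightarrow> q = m)"
proof -
  define A where "A = {q. sublinear q \<and> q \<le> p}"
  let ?R = "relation_of (\<lambda>q r. r \<le> q) A"
  have "\<exists>m\<in>A. \<forall>q\<in>A. q \<le> m \<longrightarrow> q = m"
  proof (rule predicate_Zorn)
    show "partial_order_on A ?R"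
      by (rule partial_order_on_relation_ofI) auto
    fix C assume C: "C \<in> Chains ?R"
    then have CA: "C \<subseteq> A" by (auto simp: Chains_def relation_of_def)
    have chain: "q \<le> r \<or> r \<le> q" if "q \<in> C" "r \<in> C" for q r
      using C that by (auto simp: Chains_def relation_of_def)
    show "\<exists>u\<in>A. \<forall>q\<in>C. u \<le> q"
    proof (cases "C = {}")
      case True
      then show ?thesis using p by (auto simp: A_def)
    next
      case False
      define u where "u x = (INF q\<in>C. q x)" for x
      have "bdd_below ((\<lambda>q. q x) ` C)" for x
      proof (rule bdd_belowI2)
        fix q assume "q \<in> C"
        then have q: "sublinear q" "q \<le> p" using CA by (auto simp: A_def)
        have "q (- x) \<le> p (- x)" using q(2) by (simp add: le_fun_def)
        then show "- p (- x) \<le> q x" using sublinear_lower[OF q(1), of x] by linarith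
      qed
      then have lower: "u x \<le> q x" if "q \<in> C" for q x
        unfolding u_def using that by (rule cINF_lower)
      have greatest: "c \<le> u x" if "\<And>q. q \<in> C \<Longrightarrow> c \<le> q x" for c x
        unfolding u_def using that False by (intro cINF_greatest)
      have "sublinear u" unfolding sublinear_def
      proof (intro conjI allI impI)
        fix x y
        have "u (x + y) - u x \<le> u y"
        proof (rule greatest)
          fix q2 assume q2: "q2 \<in> C"
          have "u (x + y) - q2 y \<le> u x"
          proof (rule greatest)
            fix q1 assume q1: "q1 \<in> C"
            obtain q where q: "q \<in> C" "q \<le> q1" "q \<le> q2" using chain[OF q1 q2] q1 q2 by blast
            have "u (x + y) \<le> q (x + y)" by (rule lower[OF q(1)])
            also have "\<dots> \<le> q x + q y" using q(1) CA by (intro sublinear_add) (auto simp: A_def)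
            also have "\<dots> \<le> q1 x + q2 y" using q(2,3) by (auto simp: le_fun_def intro: add_mono)
            finally show "u (x + y) - q2 y \<le> q1 x" by simp
          qed
          then show "u (x + y) - u x \<le> q2 y" by simp
        qed
        then show "u (x + y) \<le> u x + u y" by simp
      next
        fix t :: real and x assume t: "0 < t"
        have "u (t *\<^sub>R x) / t \<le> u x"
        proof (rule greatest)
          fix q assume q: "q \<in> C"
          have "u (t *\<^sub>R x) \<le> q (t *\<^sub>R x)" by (rule lower[OF q])
          also have "\<dots> = t * q x" using q CA t by (intro sublinear_scale) (auto simp: A_def)
          finally show "u (t *\<^sub>R x) / t \<le> q x" using t by (simp add: divide_le_eq mult.commute)
        qed
        then show "u (t *\<^sub>R x) \<le> t * u x" using t by (simp add: divide_le_eq mult.commute)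
      qed
      moreover have "u \<le> p"
      proof (rule le_funI)
        fix x
        obtain q where q: "q \<in> C" using False by blast
        then have "q \<le> p" using CA by (auto simp: A_def)
        then show "u x \<le> p x" using lower[OF q, of x] by (auto simp: le_fun_def intro: order_trans)
      qed
      ultimately show ?thesis using lower by (intro bexI[of _ u]) (auto simp: A_def le_fun_def)
    qed
  qed
  then obtain m where m: "m \<in> A" "\<And>q. q \<in> A \<Longrightarrow> q \<le> m \<Longrightarrow> q = m" by blast
  have "q = m" if "sublinear q" "q \<le> m" for q
    using m(1) that by (intro m(2)) (auto simp: A_def)
  then show ?thesis using m(1) by (auto simp: A_def)
qed

text \<open>
  Minimality forces the directional reduct to equal \<open>m\<close>; evaluated at \<open>t = 1\<close> this says that \<open>m\<close> is
  superadditive.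
\<close>

lemma linear_if_minimal_sublinear:
  assumes m: "sublinear m" and min: "\<And>q. sublinear q \<Longrightarrow> q \<le> m \<Longrightarrow> q = m"
  shows "linear m"
proof -
  have add: "m (x + y) = m x + m y" for x y
  proof (rule antisym)
    have "directional_reduct m y = m"
      by (rule min[OF sublinear_directional_reduct[OF m]])
        (auto simp: le_fun_def intro: order_trans[OF directional_reduct_le[OF m, of 0]])
    then show "m x + m y \<le> m (x + y)" using directional_reduct_le[OF m, of 1 y x] by simp
  qed (rule sublinear_add[OF m])
  have neg: "m (- x) = - m x" for x using add[of x "- x"] sublinear_zero[OF m] by simp
  show ?thesis
  proof (rule linearI)
    fix r :: real and x
    consider "r > 0" | "r = 0" | "r < 0" by linarith
    then show "m (r *\<^sub>R x) = r *\<^sub>R m x"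
    proof cases
      case 3
      then show ?thesis using sublinear_scale[OF m, of "- r" x] neg[of "r *\<^sub>R x"] by simp
    qed (use sublinear_scale[OF m] sublinear_zero[OF m] in auto)
  qed (rule add)
qed

text \<open>
  A minimal functional below the directional reduct takes at \<open>- y\<close> a value at most \<open>- p y\<close>.
\<close>

lemma linear_below_sublinear:
  assumes p: "sublinear p"
  shows "\<exists>f. linear f \<and> f \<le> p \<and> p y \<le> f y"
proof -
  let ?q = "directional_reduct p y"
  obtain m where m: "sublinear m" "m \<le> ?q" "\<forall>q. sublinear q \<and> q \<le> m \<longrightarrow> q = m"
    using ex_minimal_sublinear[OF sublinear_directional_reduct[OF p, of y]] by blast
  have lin: "linear m" using m by (intro linear_if_minimal_sublinear) auto
  have "?q \<le> p"
    by (auto simp: le_fun_def intro: order_trans[OF directional_reduct_le[OF p, of 0]])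
  then have "m \<le> p" using m(2) by (rule order_trans[rotated])
  have "m (- y) \<le> - p y"
    using m(2) directional_reduct_le[OF p, of 1 y "- y"] sublinear_zero[OF p]
    by (auto simp: le_fun_def intro: order_trans)
  then have "p y \<le> m y" using linear_neg[OF lin] by simp
  with lin \<open>m \<le> p\<close> show ?thesis by blast
qed

lemma sublinear_infdist:
  fixes V :: "'a::real_normed_vector set"
  assumes V: "subspace V"
  shows "sublinear (\<lambda>x. infdist x V)"
proof -
  have ne: "V \<noteq> {}" using subspace_0[OF V] by blast
  have greatest: "c \<le> infdist x V" if "\<And>v. v \<in> V \<Longrightarrow> c \<le> dist x v" for c x
    unfolding infdist_notempty[OF ne] using that ne by (intro cINF_greatest)
  show ?thesis unfolding sublinear_def
  proof (intro conjI allI impI)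
    fix x y
    have "infdist (x + y) V - infdist x V \<le> infdist y V"
    proof (rule greatest)
      fix v assume v: "v \<in> V"
      have "infdist (x + y) V - dist y v \<le> infdist x V"
      proof (rule greatest)
        fix w assume w: "w \<in> V"
        have "infdist (x + y) V \<le> dist (x + y) (w + v)"
          by (rule infdist_le[OF subspace_add[OF V w v]])
        also have "\<dots> \<le> dist x w + dist y v" by (rule dist_triangle_add)
        finally show "infdist (x + y) V - dist y v \<le> dist x w" by simp
      qed
      then show "infdist (x + y) V - infdist x V \<le> dist y v" by simp
    qed
    then show "infdist (x + y) V \<le> infdist x V + infdist y V" by simp
  next
    fix t :: real and x assume t: "0 < t"
    have "infdist (t *\<^sub>R x) V / t \<le> infdist x V"
    proof (rule greatest)
      fix v assume v: "v \<in> V"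
      have "infdist (t *\<^sub>R x) V \<le> dist (t *\<^sub>R x) (t *\<^sub>R v)"
        by (rule infdist_le[OF subspace_scale[OF V v]])
      also have "\<dots> = t * dist x v"
        using t by (simp add: dist_norm flip: scaleR_diff_right)
      finally show "infdist (t *\<^sub>R x) V / t \<le> dist x v" using t by (simp add: divide_le_eq mult.commute)
    qed
    then show "infdist (t *\<^sub>R x) V \<le> t * infdist x V" using t by (simp add: divide_le_eq mult.commute)
  qed
qed

text \<open>
  The distance to \<open>V\<close> is sublinear, vanishes on \<open>V\<close> and is positive at \<open>y\<close>; a real-linear \<open>f\<close> below it
  with maximal value at \<open>y\<close> is complexified as \<open>x \<mapsto> f x - \<i> f (\<i> x)\<close>.
\<close>

theorem ex_functional_separating:
  fixes V :: "'a::complex_normed_vector set"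
  assumes V: "csubspace V" "closed V" and y: "y \<notin> V"
  shows "\<exists>\<phi> :: 'a \<Rightarrow> complex. bounded_clinear \<phi> \<and> (\<forall>v\<in>V. \<phi> v = 0) \<and> \<phi> y \<noteq> 0"
proof -
  have sV: "subspace V" by (rule csubspace_imp_subspace[OF V(1)])
  have neV: "V \<noteq> {}" using subspace_0[OF sV] by blast
  obtain f where f: "linear f" "f \<le> (\<lambda>x. infdist x V)" "infdist y V \<le> f y"
    using linear_below_sublinear[OF sublinear_infdist[OF sV], of y] by blast
  have le: "f x \<le> infdist x V" for x using f(2) by (simp add: le_fun_def)
  have f0: "f v = 0" if "v \<in> V" for v
    using le[of v] le[of "- v"] that subspace_neg[OF sV that] linear_neg[OF f(1), of v] by simp
  have bd: "\<bar>f x\<bar> \<le> norm x" for x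
    using le[of x] le[of "- x"] linear_neg[OF f(1), of x]
      infdist_le[OF subspace_0[OF sV], of x] infdist_le[OF subspace_0[OF sV], of "- x"] by simp
  have fy: "f y \<noteq> 0"
    using f(3) infdist_pos_not_in_closed[OF V(2) neV y] by simp
  define \<phi> where "\<phi> x = Complex (f x) (- f (\<i> *\<^sub>C x))" for x
  have fadd: "f (a + b) = f a + f b" for a b by (rule linear_add[OF f(1)])
  have fsc: "f (r *\<^sub>R a) = r * f a" for r a using linear_scale[OF f(1)] by simp
  have fc: "f (c *\<^sub>C x) = Re c * f x + Im c * f (\<i> *\<^sub>C x)" for c x
  proof -
    have "c *\<^sub>C x = Re c *\<^sub>R x + Im c *\<^sub>R (\<i> *\<^sub>C x)"
      unfolding scaleR_scaleC scaleC_scaleC scaleC_add_left[symmetric]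
      by (simp add: complex_eq[of c, symmetric] mult.commute)
    then show ?thesis by (simp add: fadd fsc)
  qed
  have "bounded_linear \<phi>"
  proof (rule bounded_linear_intro[of _ 2])
    show "\<phi> (x + z) = \<phi> x + \<phi> z" for x z
      by (simp add: \<phi>_def scaleC_add_right fadd complex_eq_iff)
    show "\<phi> (r *\<^sub>R x) = r *\<^sub>R \<phi> x" for r x
    proof -
      have "\<i> *\<^sub>C (r *\<^sub>R x) = r *\<^sub>R (\<i> *\<^sub>C x)" by (simp add: scaleR_scaleC scaleC_scaleC mult.commute)
      then show ?thesis by (simp add: \<phi>_def fsc complex_eq_iff)
    qed
    show "norm (\<phi> x) \<le> norm x * 2" for x
    proof -
      have "cmod (\<phi> x) \<le> \<bar>f x\<bar> + \<bar>f (\<i> *\<^sub>C x)\<bar>"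
        using cmod_le[of "\<phi> x"] by (simp add: \<phi>_def)
      then show ?thesis using bd[of x] bd[of "\<i> *\<^sub>C x"] by (simp add: norm_scaleC)
    qed
  qed
  moreover have "\<phi> (c *\<^sub>C x) = c *\<^sub>C \<phi> x" for c x
    using fc[of c x] fc[of "\<i> * c" x]
    by (simp add: \<phi>_def scaleC_scaleC scaleC_complex_def complex_eq_iff)
  ultimately have "bounded_clinear \<phi>" by (simp add: bounded_clinear_def)
  moreover have "\<phi> v = 0" if "v \<in> V" for v
    using that f0 complex_vector.subspace_scale[OF V(1)] by (simp add: \<phi>_def complex_eq_iff)
  moreover have "\<phi> y \<noteq> 0" using fy by (simp add: \<phi>_def complex_eq_iff)
  ultimately show ?thesis by blast
qed

section \<open>Power series with vector coefficients\<close>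

text \<open>
  The radius \<open>1 / (2 * C)\<close>, half of what the growth of the coefficients allows, makes the series of
  derivatives converge uniformly by comparison with \<open>\<Sum>n. n * (1/2) ^ (n - 1)\<close>.
\<close>

lemma vec_power_series:
  fixes x :: "nat \<Rightarrow> 'b::complex_banach"
  assumes x: "\<And>n. norm (x n) \<le> K * C ^ n" and C: "C > 0"
  obtains f where "\<And>z. cmod z < 1 / (2 * C) \<Longrightarrow> (\<lambda>n. z ^ n *\<^sub>C x n) sums f z"
    and "vec_analytic_on f (ball 0 (1 / (2 * C)))" and "f 0 = x 0"
proof -
  let ?S = "ball (0::complex) (1 / (2 * C))"
  have K: "K \<ge> 0" using order_trans[OF norm_ge_zero x[of 0]] by simp
  define c where "c n = of_nat n * (1/2) ^ (n - 1) * (K * C)" for n :: nat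
  have sumc: "summable c"
  proof -
    have "summable (\<lambda>n. of_nat n * (1/2::real) ^ (n - 1))"
      using geometric_deriv_sums[of "1/2::real"] sums_summable
      by (subst summable_Suc_iff[symmetric]) auto
    then show ?thesis unfolding c_def by (rule summable_mult2)
  qed
  define d where "d n z = (of_nat n * z ^ (n - 1)) *\<^sub>C x n" for n and z :: complex
  have dn: "norm (d n z) \<le> c n" if z: "z \<in> ?S" for n z
  proof (cases n)
    case (Suc m)
    have zC: "cmod z * C \<le> 1/2" using z C by (simp add: field_simps)
    have "cmod z ^ m * norm (x (Suc m)) \<le> cmod z ^ m * (K * C ^ Suc m)"
      by (intro mult_left_mono x) auto
    also have "\<dots> = (cmod z * C) ^ m * (K * C)" by (simp add: power_mult_distrib)
    also have "\<dots> \<le> (1/2) ^ m * (K * C)"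
      using zC C K by (intro mult_right_mono power_mono) auto
    finally have "of_nat (Suc m) * (cmod z ^ m * norm (x (Suc m))) \<le> of_nat (Suc m) * ((1/2) ^ m * (K * C))"
      by (intro mult_left_mono) auto
    then show ?thesis
      unfolding d_def c_def Suc norm_scaleC norm_mult norm_power norm_of_nat by (simp add: mult.assoc)
  qed (simp add: d_def c_def)
  define D where "D z = (\<Sum>n. d n z)" for z
  have unif: "uniform_limit ?S (\<lambda>n z. \<Sum>i<n. d i z) D sequentially"
    unfolding D_def by (rule Weierstrass_m_test[OF dn sumc])
  have sums_at_0: "(\<lambda>n. 0 ^ n *\<^sub>C x n) sums x 0"
    using sums_If_finite_set[of "{0::nat}" x]
    by (simp add: power_0_left if_distrib[of "\<lambda>c. c *\<^sub>C _"] scaleC_one cong: if_cong)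
  have "\<exists>g. \<forall>z\<in>?S. (\<lambda>n. z ^ n *\<^sub>C x n) sums g z \<and> (g has_derivative (\<lambda>h. h *\<^sub>C D z)) (at z within ?S)"
  proof (rule has_derivative_series[where f' = "\<lambda>n z h. h *\<^sub>C d n z"])
    show "convex ?S" by simp
    show "((\<lambda>z. z ^ n *\<^sub>C x n) has_derivative (\<lambda>h. h *\<^sub>C d n z)) (at z within ?S)" for n z
    proof -
      have "((\<lambda>z. z ^ n) has_derivative (\<lambda>h. (of_nat n * z ^ (n - 1)) * h)) (at z within ?S)"
        using DERIV_power[OF DERIV_ident, of n z ?S] by (simp add: has_field_derivative_def)
      from bounded_linear.has_derivative[OF bounded_linear_scaleC_left this, of "x n"]
      show ?thesis by (simp add: d_def scaleC_scaleC mult.commute)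
    qed
    fix e :: real assume "e > 0"
    with unif have "\<forall>\<^sub>F n in sequentially. \<forall>z\<in>?S. dist (\<Sum>i<n. d i z) (D z) < e"
      unfolding uniform_limit_iff by blast
    then show "\<forall>\<^sub>F n in sequentially. \<forall>z\<in>?S. \<forall>h.
        norm ((\<Sum>i<n. h *\<^sub>C d i z) - h *\<^sub>C D z) \<le> e * norm h"
    proof eventually_elim
      case (elim n)
      show ?case
      proof (intro ballI allI)
        fix z h :: complex assume "z \<in> ?S"
        then have "norm ((\<Sum>i<n. d i z) - D z) \<le> e"
          using elim by (simp add: dist_norm less_imp_le)
        then have "norm (h *\<^sub>C ((\<Sum>i<n. d i z) - D z)) \<le> e * norm h"
          unfolding norm_scaleC mult.commute[of e] by (rule mult_left_mono) simp
        then show "norm ((\<Sum>i<n. h *\<^sub>C d i z) - h *\<^sub>C D z) \<le> e * norm h"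
          by (simp add: complex_vector.scale_right_diff_distrib complex_vector.scale_sum_right)
      qed
    qed
  next
    show "0 \<in> ?S" using C by simp
    show "(\<lambda>n. 0 ^ n *\<^sub>C x n) sums x 0" by (rule sums_at_0)
  qed
  then obtain g where g: "\<And>z. z \<in> ?S \<Longrightarrow> (\<lambda>n. z ^ n *\<^sub>C x n) sums g z"
    "\<And>z. z \<in> ?S \<Longrightarrow> (g has_derivative (\<lambda>h. h *\<^sub>C D z)) (at z within ?S)" by blast
  show ?thesis
  proof (rule that[of g])
    show "(\<lambda>n. z ^ n *\<^sub>C x n) sums g z" if "cmod z < 1 / (2 * C)" for z
      using that by (intro g) simp
    show "vec_analytic_on g ?S"
      unfolding vec_analytic_on_def using g(2) by (metis at_within_open open_ball)
    have "(\<lambda>n. 0 ^ n *\<^sub>C x n) sums g 0" using C by (intro g) simp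
    then show "g 0 = x 0" using sums_at_0 sums_unique2 by blast
  qed
qed

lemma vec_analytic_on_imp_continuous_on: "vec_analytic_on f U \<Longrightarrow> continuous_on U f"
  unfolding vec_analytic_on_def
  by (metis continuous_at_imp_continuous_on has_derivative_continuous)

section \<open>Restrictions to closed invariant subspaces\<close>

text \<open>
  The setting for the restriction of \<open>T\<close> to a subspace that is a Banach space in its own right: the
  whole space, the range of a power of \<open>T\<close>, or a summand of a reducing pair.
\<close>

locale closed_invariant_subspace =
  fixes T :: "'a::complex_banach \<Rightarrow> 'a" and M :: "'a set"
  assumes T: "bounded_clinear T"
    and M: "csubspace M" "closed M"
    and invariant: "T ` M \<subseteq> M"
begin

sublocale T: bounded_linear T
  by (rule bounded_clinear_bounded_linear[OF T])

lemma T_scaleC: "T (c *\<^sub>C x) = c *\<^sub>C T x"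
  using T by (simp add: bounded_clinear_def)

lemma subM: "subspace M"
  by (rule csubspace_imp_subspace[OF M(1)])

lemma funpow_linear: "bounded_clinear (T ^^ n)"
  by (rule bounded_clinear_funpow[OF T])

lemma funpow_add: "(T ^^ n) (x + y) = (T ^^ n) x + (T ^^ n) y"
  using bounded_clinear_bounded_linear[OF funpow_linear] by (simp add: bounded_linear.linear linear_add)

lemma funpow_diff: "(T ^^ n) (x - y) = (T ^^ n) x - (T ^^ n) y"
  using bounded_clinear_bounded_linear[OF funpow_linear] by (simp add: bounded_linear.linear linear_diff)

lemma funpow_scaleC: "(T ^^ n) (c *\<^sub>C x) = c *\<^sub>C (T ^^ n) x"
  using funpow_linear by (simp add: bounded_clinear_def)

lemma funpow_zero: "(T ^^ n) 0 = 0"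
  using bounded_clinear_bounded_linear[OF funpow_linear] by (simp add: bounded_linear.linear linear_0)

lemma funpow_Suc_in: "T ((T ^^ n) x) = (T ^^ n) (T x)"
  by (simp add: funpow_swap1)

lemma funpow_in: "x \<in> M \<Longrightarrow> (T ^^ n) x \<in> M"
  by (induction n) (use invariant in auto)

lemma funpow_subspace: "closed_invariant_subspace (T ^^ n) M"
  using funpow_linear M funpow_in by (simp add: closed_invariant_subspace_def image_subset_iff)

lemma csubspace_funpow_image: "csubspace ((T ^^ n) ` M)"
  by (rule csubspace_image[OF funpow_linear M(1)])

lemma funpow_image_antimono: "m \<le> n \<Longrightarrow> (T ^^ n) ` M \<subseteq> (T ^^ m) ` M"
proof
  fix y assume mn: "m \<le> n" and "y \<in> (T ^^ n) ` M"
  then obtain x where "x \<in> M" "y = (T ^^ m) ((T ^^ (n - m)) x)"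
    by (metis (no_types, lifting) comp_apply funpow_add imageE le_add_diff_inverse Nat.funpow_add)
  then show "y \<in> (T ^^ m) ` M" using funpow_in by blast
qed

lemma invariant_funpow_image: "T ` (T ^^ n) ` M \<subseteq> (T ^^ n) ` M"
  using invariant by (auto simp: funpow_Suc_in)

lemma shift_invariant: "shift T z ` M \<subseteq> M"
  using invariant M(1) by (auto intro: complex_vector.subspace_diff complex_vector.subspace_scale)

lemma shift_subspace: "closed_invariant_subspace (shift T z) M"
  using shift_invariant by (simp add: closed_invariant_subspace_def bounded_clinear_shift T M)

text \<open>
  The open mapping theorem for \<open>(x, v) \<mapsto> T x + v\<close>, where \<open>v\<close> ranges over a finite-dimensional supplement
  of the range. Surjective operators are the case \<open>B = {}\<close>.
\<close>

lemma open_mapping_finite_codim: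
  assumes B: "finite B" and M_eq: "M = cspan (T ` M \<union> B)"
  obtains C where "C > 0"
    "\<And>y. y \<in> M \<Longrightarrow> \<exists>x\<in>M. \<exists>v\<in>cspan B. y = T x + v \<and> norm x \<le> C * norm y \<and> norm v \<le> C * norm y"
proof -
  define g where "g p = T (fst p) + snd p" for p
  have g: "bounded_linear g" unfolding g_def
    by (intro bounded_linear_add bounded_linear_compose[OF T.bounded_linear_axioms] bounded_linear_fst bounded_linear_snd)
  have gM: "g ` (M \<times> cspan B) = M"
    by (subst (2) M_eq, subst cspan_subspace_Un[OF csubspace_image[OF T M(1)]]) (force simp: g_def)
  have sub: "subspace (M \<times> cspan B)"
    by (intro subspace_Times subM) (simp add: csubspace_imp_subspace)
  have cl: "closed (M \<times> cspan B)"
    by (intro closed_Times M closed_cspan_finite B)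
  obtain C where C: "C > 0" "\<And>y. y \<in> M \<Longrightarrow> \<exists>p\<in>M \<times> cspan B. g p = y \<and> norm p \<le> C * norm y"
    using open_mapping[OF g sub cl] M(2) gM by metis
  show ?thesis
  proof (rule that[OF C(1)])
    fix y assume "y \<in> M"
    then obtain x v where xv: "x \<in> M" "v \<in> cspan B" "T x + v = y" "norm (x, v) \<le> C * norm y"
      using C(2) by (fastforce simp: g_def)
    then have "norm x \<le> C * norm y" "norm v \<le> C * norm y"
      using norm_fst_le[of x v] norm_snd_le[of v x] by linarith+
    then show "\<exists>x\<in>M. \<exists>v\<in>cspan B. y = T x + v \<and> norm x \<le> C * norm y \<and> norm v \<le> C * norm y"
      using xv by blast
  qed
qed

lemma finite_codim_iff_decomp:
  "M = cspan (T ` M \<union> B) \<longleftrightarrow> B \<subseteq> M \<and> (\<forall>y\<in>M. \<exists>x\<in>M. \<exists>v\<in>cspan B. y = T x + v)"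
proof -
  have "cspan (T ` M \<union> B) \<subseteq> M \<longleftrightarrow> B \<subseteq> M"
    using invariant M(1) complex_vector.span_superset[of "T ` M \<union> B"]
      complex_vector.span_minimal[of "T ` M \<union> B" M] by blast
  moreover have "M \<subseteq> cspan (T ` M \<union> B) \<longleftrightarrow> (\<forall>y\<in>M. \<exists>x\<in>M. \<exists>v\<in>cspan B. y = T x + v)"
    unfolding cspan_subspace_Un[OF csubspace_image[OF T M(1)]] by blast
  ultimately show ?thesis by blast
qed

text \<open>
  The same supplement \<open>B\<close> works for all small \<open>z\<close>: a solution of \<open>y = T x + v\<close> solves the shifted equation
  up to the error \<open>z x\<close>, which is at most \<open>norm y / 2\<close>.
\<close>

lemma finite_codim_shift:
  assumes B: "finite B" and M_eq: "M = cspan (T ` M \<union> B)"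
  shows "\<exists>e>0. \<forall>z. cmod z < e \<longrightarrow> M = cspan (shift T z ` M \<union> B)"
proof -
  obtain C where C: "C > 0"
    "\<And>y. y \<in> M \<Longrightarrow> \<exists>x\<in>M. \<exists>v\<in>cspan B. y = T x + v \<and> norm x \<le> C * norm y \<and> norm v \<le> C * norm y"
    using open_mapping_finite_codim[OF B M_eq] by blast
  have main: "M = cspan (shift T z ` M \<union> B)" if z: "cmod z < 1 / (2 * C)" for z
  proof -
    interpret Tz: closed_invariant_subspace "shift T z" M by (rule shift_subspace)
    define g where "g p = shift T z (fst p) + snd p" for p
    have g: "bounded_linear g" unfolding g_def
      by (intro bounded_linear_add bounded_linear_compose[OF Tz.T.bounded_linear_axioms]
          bounded_linear_fst bounded_linear_snd)
    have sub: "subspace (M \<times> cspan B)"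
      by (intro subspace_Times subM) (simp add: csubspace_imp_subspace)
    have cl: "closed (M \<times> cspan B)"
      by (intro closed_Times M closed_cspan_finite B)
    have step: "\<exists>p\<in>M \<times> cspan B. norm p \<le> (C + C) * norm y \<and> y - g p \<in> M \<and> norm (y - g p) \<le> 1/2 * norm y"
      if y: "y \<in> M" for y
    proof -
      obtain x v where xv: "x \<in> M" "v \<in> cspan B" "y = T x + v" "norm x \<le> C * norm y" "norm v \<le> C * norm y"
        using C(2)[OF y] by blast
      have eq: "y - g (x, v) = z *\<^sub>C x" using xv(3) by (simp add: g_def)
      have "cmod z * norm x \<le> 1 / (2 * C) * (C * norm y)"
        using z xv(4) C(1) by (intro mult_mono) auto
      then have "norm (y - g (x, v)) \<le> 1/2 * norm y" unfolding eq norm_scaleC using C(1) by simp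
      moreover have "y - g (x, v) \<in> M" unfolding eq by (rule complex_vector.subspace_scale[OF M(1) xv(1)])
      moreover have "norm (x, v) \<le> (C + C) * norm y"
        using norm_Pair_le[of x v] xv(4,5) by (simp add: distrib_right)
      ultimately show ?thesis using xv(1,2) by blast
    qed
    have surj: "\<exists>p\<in>M \<times> cspan B. g p = y" if "y \<in> M" for y
      using approx_surj[OF g sub cl _ _ _ step that] C(1) by auto
    have "\<forall>y\<in>M. \<exists>x\<in>M. \<exists>v\<in>cspan B. y = shift T z x + v"
    proof
      fix y assume "y \<in> M"
      from surj[OF this] obtain p where "p \<in> M \<times> cspan B" "g p = y" by blast
      then show "\<exists>x\<in>M. \<exists>v\<in>cspan B. y = shift T z x + v"
        by (intro bexI[of _ "fst p"] bexI[of _ "snd p"]) (auto simp: g_def)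
    qed
    moreover have "B \<subseteq> M" using M_eq finite_codim_iff_decomp by (rule iffD1[THEN conjunct1, rotated])
    ultimately show ?thesis unfolding Tz.finite_codim_iff_decomp by (rule conjI[rotated])
  qed
  have pos: "1 / (2 * C) > 0" using C(1) by simp
  show ?thesis
    by (rule exI[of _ "1 / (2 * C)"]) (use pos main in blast)
qed

lemma bij_betw_iff_trivial_kernel:
  "bij_betw T M M \<longleftrightarrow> M \<inter> kernel T \<subseteq> {0} \<and> M = cspan (T ` M \<union> {})"
proof -
  have "T ` M = cspan (T ` M \<union> {})"
    by (simp only: Un_empty_right complex_vector.span_eq_iff[THEN iffD2, OF csubspace_image[OF T M(1)]])
  moreover have "inj_on T M \<longleftrightarrow> M \<inter> kernel T \<subseteq> {0}"
  proof
    assume inj: "inj_on T M"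
    show "M \<inter> kernel T \<subseteq> {0}"
    proof
      fix x assume "x \<in> M \<inter> kernel T"
      then show "x \<in> {0}"
        using inj_onD[OF inj, of x 0] subspace_0[OF subM] T.zero by (auto simp: kernel_def)
    qed
  next
    assume ker: "M \<inter> kernel T \<subseteq> {0}"
    show "inj_on T M"
    proof (rule inj_onI)
      fix x y assume "x \<in> M" "y \<in> M" "T x = T y"
      then have "x - y \<in> M \<inter> kernel T" by (simp add: kernel_def T.diff subspace_diff[OF subM])
      then show "x = y" using ker by auto
    qed
  qed
  ultimately show ?thesis unfolding bij_betw_def by metis
qed

lemma bounded_inverse:
  assumes bij: "bij_betw T M M"
  obtains C where "C > 0" "\<And>x. x \<in> M \<Longrightarrow> norm x \<le> C * norm (T x)"
proof -
  obtain C where C: "C > 0"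
    "\<And>y. y \<in> M \<Longrightarrow> \<exists>x\<in>M. \<exists>v\<in>cspan {}. y = T x + v \<and> norm x \<le> C * norm y \<and> norm v \<le> C * norm y"
    using open_mapping_finite_codim[OF finite.emptyI] bij unfolding bij_betw_iff_trivial_kernel by blast
  show ?thesis
  proof (rule that[OF C(1)])
    fix x assume x: "x \<in> M"
    then obtain x' where "x' \<in> M" "T x = T x'" "norm x' \<le> C * norm (T x)"
      using C(2)[of "T x"] subsetD[OF invariant imageI[OF x]] by auto
    then show "norm x \<le> C * norm (T x)" using bij x by (auto simp: bij_betw_def inj_on_def)
  qed
qed

lemma bij_betw_shift_small:
  assumes bij: "bij_betw T M M"
  shows "\<exists>e>0. \<forall>z. cmod z < e \<longrightarrow> bij_betw (shift T z) M M"
proof -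
  obtain e where e: "e > 0" "\<And>z. cmod z < e \<Longrightarrow> M = cspan (shift T z ` M \<union> {})"
    using finite_codim_shift[OF finite.emptyI] bij unfolding bij_betw_iff_trivial_kernel
    by (elim conjE exE) blast
  obtain C where C: "C > 0" "\<And>x. x \<in> M \<Longrightarrow> norm x \<le> C * norm (T x)"
    using bounded_inverse[OF bij] by blast
  have "bij_betw (shift T z) M M" if z: "cmod z < min e (1 / C)" for z
  proof -
    interpret Tz: closed_invariant_subspace "shift T z" M by (rule shift_subspace)
    have "x = 0" if x: "x \<in> M" "T x = z *\<^sub>C x" for x
    proof (rule ccontr)
      assume "x \<noteq> 0"
      have "norm x \<le> C * (cmod z * norm x)" using C(2)[OF x(1)] x(2) by (simp add: norm_scaleC)
      also have "\<dots> < norm x" using z C(1) \<open>x \<noteq> 0\<close> by (simp add: field_simps)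
      finally show False by simp
    qed
    then show ?thesis
      unfolding Tz.bij_betw_iff_trivial_kernel using e(2)[of z] z by (auto simp: kernel_def)
  qed
  then show ?thesis using e(1) C(1) by (intro exI[of _ "min e (1 / C)"]) auto
qed

text \<open>
  The bounded inverse theorem.
\<close>

lemma invertible_on_iff_bij_betw: "invertible_on M T \<longleftrightarrow> bij_betw T M M"
proof
  assume "invertible_on M T"
  then obtain S where S: "S ` M \<subseteq> M" "\<And>x. x \<in> M \<Longrightarrow> S (T x) = x \<and> T (S x) = x"
    by (auto simp: invertible_on_def bounded_clinear_on_def)
  then show "bij_betw T M M"
    using invariant by (intro bij_betw_byWitness[of _ S]) auto
next
  assume bij: "bij_betw T M M"
  define S where "S = inv_into M T"
  have S: "S y \<in> M" "T (S y) = y" if "y \<in> M" for y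
    using bij that by (auto simp: S_def bij_betw_def inv_into_into f_inv_into_f)
  have ST: "S (T x) = x" if "x \<in> M" for x
    using bij that by (auto simp: S_def bij_betw_def)
  have uniq: "S y = x" if "x \<in> M" "T x = y" for x y using ST that by blast
  obtain C where C: "C > 0" "\<And>x. x \<in> M \<Longrightarrow> norm x \<le> C * norm (T x)"
    using bounded_inverse[OF bij] by blast
  have "bounded_clinear_on M S"
    unfolding bounded_clinear_on_def
  proof (intro conjI ballI allI)
    show "S ` M \<subseteq> M" using S by blast
    show "S (x + y) = S x + S y" if "x \<in> M" "y \<in> M" for x y
      by (rule uniq) (use that S M(1) in \<open>auto simp: T.add complex_vector.subspace_add\<close>)
    show "S (c *\<^sub>C x) = c *\<^sub>C S x" if "x \<in> M" for c x
      by (rule uniq) (use that S M(1) in \<open>auto simp: T_scaleC complex_vector.subspace_scale\<close>)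
    show "\<exists>K. \<forall>x\<in>M. norm (S x) \<le> K * norm x"
      using C(2)[OF S(1)] S(2) by metis
  qed
  then show "invertible_on M T" using S ST by (auto simp: invertible_on_def)
qed

lemma closed_image_finite_codim:
  assumes B: "finite B" and M_eq: "M = cspan (T ` M \<union> B)"
  shows "closed (T ` M)"
  using M(2) M_eq
  by (intro closed_range_if_finite_codim[OF T.bounded_linear_axioms subM M(2) csubspace_image[OF T M(1)] B]) simp

text \<open>
  If \<open>M = T M + F\<close> and \<open>M = T\<^sup>n M + F'\<close> then \<open>M = T\<^sup>n\<^sup>+\<^sup>1 M + T\<^sup>n F + F'\<close>.
\<close>

lemma finite_codim_funpow:
  assumes B: "finite B" and M_eq: "M = cspan (T ` M \<union> B)"
  shows "\<exists>B'. finite B' \<and> M = cspan ((T ^^ n) ` M \<union> B')"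
proof (induction n)
  case 0
  have "M = cspan ((T ^^ 0) ` M \<union> {})"
    by (simp only: funpow.simps image_id id_apply Un_empty_right complex_vector.span_eq_iff[THEN iffD2, OF M(1)])
  then show ?case by blast
next
  case (Suc n)
  then obtain B' where B': "finite B'" "M = cspan ((T ^^ n) ` M \<union> B')" by blast
  interpret Tn: closed_invariant_subspace "T ^^ n" M
    by (rule funpow_subspace)
  interpret TSn: closed_invariant_subspace "T ^^ Suc n" M
    by (rule funpow_subspace)
  let ?B = "B' \<union> (T ^^ n) ` B"
  have BM: "B \<subseteq> M" "\<And>y. y \<in> M \<Longrightarrow> \<exists>x\<in>M. \<exists>v\<in>cspan B. y = T x + v"
    using M_eq finite_codim_iff_decomp by blast+
  have B'M: "B' \<subseteq> M" "\<And>y. y \<in> M \<Longrightarrow> \<exists>x\<in>M. \<exists>v\<in>cspan B'. y = (T ^^ n) x + v"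
    using B'(2) Tn.finite_codim_iff_decomp by blast+
  have "\<exists>x\<in>M. \<exists>v\<in>cspan ?B. y = (T ^^ Suc n) x + v" if y: "y \<in> M" for y
  proof -
    obtain x v where x: "x \<in> M" "v \<in> cspan B'" "y = (T ^^ n) x + v" using B'M(2)[OF y] by blast
    obtain u w where u: "u \<in> M" "w \<in> cspan B" "x = T u + w" using BM(2)[OF x(1)] by blast
    have "(T ^^ n) w \<in> cspan ((T ^^ n) ` B)" using u(2) cspan_image[OF funpow_linear] by blast
    then have "(T ^^ n) w + v \<in> cspan ?B"
      using x(2) by (intro complex_vector.span_add)
        (auto intro: complex_vector.span_mono[THEN subsetD, rotated])
    moreover have "y = (T ^^ Suc n) u + ((T ^^ n) w + v)"
      using x(3) u(3) by (simp add: funpow_add funpow_swap1 add.assoc)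
    ultimately show ?thesis using u(1) by blast
  qed
  then have "M = cspan ((T ^^ Suc n) ` M \<union> ?B)"
    unfolding TSn.finite_codim_iff_decomp using BM(1) B'M(1) funpow_in by blast
  moreover have "finite ?B" using B(1) B'(1) by simp
  ultimately show ?case by (intro exI[of _ ?B] conjI)
qed

lemma closed_funpow_image:
  assumes fred: "fredholm_on M T"
  shows "closed ((T ^^ n) ` M)"
proof -
  obtain B where B: "finite B" "M = cspan (T ` M \<union> B)" using fred by (auto simp: fredholm_on_def)
  obtain B' where B': "finite B'" "M = cspan ((T ^^ n) ` M \<union> B')"
    using finite_codim_funpow[OF B] by blast
  interpret Tn: closed_invariant_subspace "T ^^ n" M
    by (rule funpow_subspace)
  show ?thesis by (rule Tn.closed_image_finite_codim[OF B'])
qed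

text \<open>
  For the kernel: a solution \<open>x\<close> of \<open>T x = z x\<close> differs from an element of the kernel of \<open>T\<close> by a
  preimage of \<open>z x\<close>, which can be chosen of norm at most \<open>C * cmod z * norm x \<le> norm x / 4\<close>. So the
  kernel of the shifted operator is close to a finite-dimensional space.
\<close>

theorem fredholm_on_shift:
  assumes fred: "fredholm_on M T"
  shows "\<exists>e>0. \<forall>z. cmod z < e \<longrightarrow> fredholm_on M (shift T z)"
proof -
  obtain B where B: "finite B" "M = cspan (T ` M \<union> B)" using fred by (auto simp: fredholm_on_def)
  obtain N where N: "finite N" "M \<inter> kernel T = cspan N" using fred by (auto simp: fredholm_on_def)
  obtain e where e: "e > 0" "\<And>z. cmod z < e \<Longrightarrow> M = cspan (shift T z ` M \<union> B)"
    using finite_codim_shift[OF B] by blast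
  have cl: "closed (T ` M)" by (rule closed_image_finite_codim[OF B])
  obtain C where C: "C > 0" "\<And>y. y \<in> T ` M \<Longrightarrow> \<exists>x\<in>M. T x = y \<and> norm x \<le> C * norm y"
    using open_mapping[OF T.bounded_linear_axioms subM M(2) cl] by blast
  have "fredholm_on M (shift T z)" if z: "cmod z < min e (1 / (4 * C))" for z
  proof -
    let ?L = "M \<inter> kernel (shift T z)"
    have "csubspace ?L"
      by (intro complex_vector.subspace_inter M(1) csubspace_kernel bounded_clinear_shift T)
    moreover have "\<exists>n\<in>cspan N. norm (x - n) \<le> norm x / 4" if x: "x \<in> ?L" for x
    proof -
      have Tx: "T x = z *\<^sub>C x" "x \<in> M" using x by (auto simp: kernel_def)
      obtain u where u: "u \<in> M" "T u = T x" "norm u \<le> C * norm (T x)" using C(2)[of "T x"] Tx(2) by blast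
      have "x - u \<in> cspan N"
        unfolding N(2)[symmetric] using Tx(2) u(1,2) by (simp add: kernel_def T.diff subspace_diff[OF subM])
      moreover have "norm u \<le> norm x / 4"
      proof -
        have "C * norm (T x) \<le> C * (1 / (4 * C) * norm x)"
          unfolding Tx(1) norm_scaleC using z C(1) by (intro mult_left_mono mult_right_mono) auto
        then show ?thesis using u(3) C(1) by simp
      qed
      ultimately show ?thesis by (intro bexI[of _ "x - u"]) auto
    qed
    ultimately have "\<exists>B'. finite B' \<and> ?L = cspan B'"
      by (intro finite_dim_if_near_finite_dim[OF N(1)]) auto
    moreover have "\<exists>B. finite B \<and> M = cspan (shift T z ` M \<union> B)" using e(2)[of z] z B(1) by auto
    ultimately show ?thesis by (simp add: fredholm_on_def)
  qed
  then show ?thesis using e(1) C(1) by (intro exI[of _ "min e (1 / (4 * C))"]) auto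
qed

end

section \<open>Eigenvector chains and the stabilisation of kernels and ranges\<close>

lemma antimono_finite_dim_stabilises:
  fixes A :: "nat \<Rightarrow> 'a::complex_normed_vector set"
  assumes N: "finite N" and sub: "\<And>n. csubspace (A n)" and AN: "\<And>n. A n \<subseteq> cspan N"
    and anti: "\<And>m n. m \<le> n \<Longrightarrow> A n \<subseteq> A m"
  shows "\<exists>m. \<forall>n\<ge>m. A n = A m"
proof -
  obtain m where m: "\<And>n. complex_vector.dim (A m) \<le> complex_vector.dim (A n)"
    using ex_has_least_nat[of "\<lambda>_. True" 0 "\<lambda>n. complex_vector.dim (A n)"] by auto
  have "A n = A m" if n: "m \<le> n" for n
  proof (rule ccontr)
    assume "A n \<noteq> A m"
    then obtain x where x: "x \<in> A m" "x \<notin> A n" using anti[OF n] by blast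
    obtain b where b: "b \<subseteq> A n" "complex_vector.independent b" "A n \<subseteq> cspan b"
      "card b = complex_vector.dim (A n)" using complex_vector.basis_exists by blast
    obtain c where c: "c \<subseteq> A m" "complex_vector.independent c" "A m \<subseteq> cspan c"
      "card c = complex_vector.dim (A m)" using complex_vector.basis_exists by blast
    have finb: "finite b"
      using complex_vector.independent_span_bound[OF N b(2)] b(1) AN by blast
    have finc: "finite c"
      using complex_vector.independent_span_bound[OF N c(2)] c(1) AN by blast
    have "cspan b \<subseteq> A n" by (rule complex_vector.span_minimal[OF b(1) sub])
    then have xb: "x \<notin> cspan b" using x(2) by blast
    then have "complex_vector.independent (insert x b)"
      by (rule complex_vector.independent_insertI[OF _ b(2)])
    moreover have "insert x b \<subseteq> cspan c" using x(1) b(1) c(3) anti[OF n] by blast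
    ultimately have "card (insert x b) \<le> card c"
      using complex_vector.independent_span_bound[OF finc] by blast
    moreover have "x \<notin> b" using xb complex_vector.span_base by blast
    ultimately show False using finb b(4) c(4) m[of n] by simp
  qed
  then show ?thesis by blast
qed

text \<open>
  A chain with \<open>T (x 0) = 0\<close> and \<open>T (x (Suc n)) = x n\<close> turns into the eigenvector \<open>\<Sum>n. z\<^sup>n x\<^sub>n\<close> for the
  eigenvalue \<open>z\<close>, because applying \<open>T\<close> shifts the series by one place.
\<close>

lemma eigenvector_of_chain:
  fixes T :: "'b::complex_normed_vector \<Rightarrow> 'b"
  assumes T: "bounded_clinear T" and x: "T (x 0) = 0" "\<And>n. T (x (Suc n)) = x n"
    and s: "(\<lambda>n. z ^ n *\<^sub>C x n) sums s"
  shows "T s = z *\<^sub>C s"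
proof -
  interpret bounded_linear T by (rule bounded_clinear_bounded_linear[OF T])
  have Tc: "T (c *\<^sub>C y) = c *\<^sub>C T y" for c y using T by (simp add: bounded_clinear_def)
  have "(\<lambda>n. T (z ^ n *\<^sub>C x n)) sums T s" by (rule sums[OF s])
  then have "(\<lambda>n. T (z ^ Suc n *\<^sub>C x (Suc n))) sums T s"
    by (subst sums_Suc_iff) (simp add: Tc x)
  then have "(\<lambda>n. z *\<^sub>C (z ^ n *\<^sub>C x n)) sums T s" by (simp add: Tc x scaleC_scaleC)
  moreover have "(\<lambda>n. z *\<^sub>C (z ^ n *\<^sub>C x n)) sums (z *\<^sub>C s)"
    by (rule bounded_linear.sums[OF bounded_linear_scaleC s])
  ultimately show ?thesis by (rule sums_unique2)
qed

lemma continuous_zero_if_zeros_accumulate: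
  fixes f :: "complex \<Rightarrow> 'b::real_normed_vector"
  assumes cont: "continuous_on (ball 0 r) f" and r: "r > 0"
    and zeros: "\<And>e. e > 0 \<Longrightarrow> \<exists>z. cmod z < e \<and> f z = 0"
  shows "f 0 = 0"
proof (rule ccontr)
  assume "f 0 \<noteq> 0"
  moreover have "isCont f 0" using cont r by (simp add: continuous_on_eq_continuous_at)
  ultimately obtain d where d: "d > 0" "\<And>z. dist z 0 < d \<Longrightarrow> dist (f z) (f 0) < norm (f 0)"
    unfolding continuous_at_eps_delta by (metis zero_less_norm_iff)
  then show False using zeros[OF d(1)] by fastforce
qed

text \<open>
  For a chain of geometric growth the eigenvectors depend analytically on the eigenvalue and take the
  value \<open>x 0\<close> at \<open>l\<close>, so the single valued extension property makes them vanish.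
\<close>

lemma svep_at_chain_zero:
  fixes S :: "'b::complex_banach \<Rightarrow> 'b"
  assumes S: "bounded_clinear S" and svep: "svep_at S l"
    and x: "shift S l (x 0) = 0" "\<And>n. shift S l (x (Suc n)) = x n"
    and bd: "\<And>n. norm (x n) \<le> K * C ^ n" and C: "C > 0"
  shows "x 0 = 0"
proof -
  let ?r = "1 / (2 * C)"
  obtain f where f: "\<And>z. cmod z < ?r \<Longrightarrow> (\<lambda>n. z ^ n *\<^sub>C x n) sums f z"
    "vec_analytic_on f (ball 0 ?r)" "f 0 = x 0" using vec_power_series[OF bd C] by blast
  define g where "g z = f (z - l)" for z
  have "vec_analytic_on g (ball l ?r)"
    unfolding vec_analytic_on_def
  proof
    fix z assume "z \<in> ball l ?r"
    then have "z - l \<in> ball 0 ?r" by (simp add: dist_norm norm_minus_commute)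
    then obtain D where D: "(f has_derivative (\<lambda>h. h *\<^sub>C D)) (at (z - l))"
      using f(2) unfolding vec_analytic_on_def by blast
    have "((\<lambda>z. z - l) has_derivative (\<lambda>h. h)) (at z)" by (auto intro!: derivative_eq_intros)
    from has_derivative_compose[OF this D]
    show "\<exists>D. (g has_derivative (\<lambda>h. h *\<^sub>C D)) (at z)" by (auto simp: g_def[abs_def])
  qed
  moreover have "shift S z (g z) = 0" if z: "z \<in> ball l ?r" for z
  proof -
    have "shift S l (g z) = (z - l) *\<^sub>C g z"
      unfolding g_def using z
      by (intro eigenvector_of_chain[OF bounded_clinear_shift[OF S] x f(1)])
        (simp add: dist_norm norm_minus_commute)
    then show ?thesis by (simp add: complex_vector.scale_left_diff_distrib)
  qed
  moreover have "l \<in> ball l ?r" using C by simp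
  ultimately have "g l = 0"
    using svep unfolding svep_at_def by (metis open_ball connected_ball)
  then show ?thesis by (simp add: g_def f(3))
qed

definition clinear_on :: "'a::complex_normed_vector set \<Rightarrow> ('a \<Rightarrow> complex) \<Rightarrow> bool"
  where "clinear_on M \<phi> \<longleftrightarrow>
    (\<forall>x\<in>M. \<forall>y\<in>M. \<phi> (x + y) = \<phi> x + \<phi> y) \<and> (\<forall>c. \<forall>x\<in>M. \<phi> (c *\<^sub>C x) = c * \<phi> x)"

context closed_invariant_subspace
begin

text \<open>
  Infinite ascent produces a chain of geometric growth. The spaces \<open>N(T) \<inter> T\<^sup>n M\<close> decrease inside a
  finite-dimensional space, so they become constant from some \<open>m\<close> on, and the chain can start with a
  nonzero element of \<open>N(T)\<close> in the intersection \<open>R\<close> of all \<open>T\<^sup>n M\<close>. For \<open>y\<close> in \<open>R\<close>, any preimage in \<open>T\<^sup>m M\<close> is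
  again in \<open>R\<close>: it differs from a preimage in \<open>T\<^sup>n M\<close> by an element of
  \<open>N(T) \<inter> T\<^sup>m M = N(T) \<inter> T\<^sup>n M\<close>. The open mapping theorem for the power \<open>m + 1\<close> of \<open>T\<close> gives a
  preimage of controlled norm.
\<close>

lemma ex_backward_chain:
  assumes fred: "fredholm_on M T" and ker: "\<And>n. \<exists>x\<in>(T ^^ n) ` M. T x = 0 \<and> x \<noteq> 0"
  shows "\<exists>x K C. C > 0 \<and> T (x 0) = 0 \<and> x 0 \<noteq> 0 \<and>
    (\<forall>n. x n \<in> M \<and> T (x (Suc n)) = x n \<and> norm (x n) \<le> K * C ^ n)"
proof -
  obtain N where N: "finite N" "M \<inter> kernel T = cspan N" using fred by (auto simp: fredholm_on_def)
  define A where "A n = kernel T \<inter> (T ^^ n) ` M" for n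
  have "\<exists>m. \<forall>n\<ge>m. A n = A m"
  proof (rule antimono_finite_dim_stabilises[OF N(1)])
    show "csubspace (A n)" for n
      unfolding A_def by (intro complex_vector.subspace_inter csubspace_kernel T csubspace_funpow_image)
    show "A n \<subseteq> cspan N" for n
      unfolding A_def N(2)[symmetric] using funpow_in by blast
    show "A n \<subseteq> A m" if "m \<le> n" for m n
      unfolding A_def using funpow_image_antimono[OF that] by blast
  qed
  then obtain m where m: "\<And>n. n \<ge> m \<Longrightarrow> A n = A m" by blast
  define R where "R = (\<Inter>n. (T ^^ n) ` M)"
  have A_R: "A m \<subseteq> R"
  proof
    fix x assume x: "x \<in> A m"
    have "x \<in> (T ^^ n) ` M" for n
    proof (cases "m \<le> n")
      case True
      then have "x \<in> A n" using m x by blast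
      then show ?thesis by (simp add: A_def)
    next
      case False
      then show ?thesis using x funpow_image_antimono[of n m] by (auto simp: A_def)
    qed
    then show "x \<in> R" by (simp add: R_def)
  qed
  have bl: "bounded_linear (T ^^ n)" for n
    by (rule bounded_clinear_bounded_linear[OF funpow_linear])
  obtain C0 where C0: "C0 > 0"
    "\<And>y. y \<in> (T ^^ Suc m) ` M \<Longrightarrow> \<exists>w\<in>M. (T ^^ Suc m) w = y \<and> norm w \<le> C0 * norm y"
    using open_mapping[OF bl subM M(2) closed_funpow_image[OF fred]] by blast
  \<comment> \<open>The summand 1 only ensures that \<open>C\<close> is positive.\<close>
  define C where "C = onorm (T ^^ m) * C0 + 1"
  have C: "C > 0" using C0(1) onorm_pos_le[OF bl, of m] by (simp add: C_def add_nonneg_pos)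
  have step: "\<exists>x\<in>R. T x = y \<and> norm x \<le> C * norm y" if y: "y \<in> R" for y
  proof -
    have "y \<in> (T ^^ Suc m) ` M" using y unfolding R_def by blast
    then obtain w where w: "w \<in> M" "(T ^^ Suc m) w = y" "norm w \<le> C0 * norm y" using C0(2) by blast
    let ?x = "(T ^^ m) w"
    have Tx: "T ?x = y" using w(2) by simp
    have "norm ?x \<le> onorm (T ^^ m) * norm w" by (rule onorm[OF bl])
    also have "\<dots> \<le> onorm (T ^^ m) * (C0 * norm y)"
      by (intro mult_left_mono w onorm_pos_le bl)
    also have "\<dots> \<le> C * norm y" by (simp add: C_def distrib_right mult.assoc)
    finally have nx: "norm ?x \<le> C * norm y" .
    have "?x \<in> (T ^^ n) ` M" for n
    proof (cases "n \<le> m")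
      case True
      then show ?thesis using funpow_image_antimono[OF True] w(1) by blast
    next
      case False
      have "y \<in> (T ^^ Suc n) ` M" using y unfolding R_def by blast
      then obtain u where u: "u \<in> M" "y = T ((T ^^ n) u)" by auto
      have sub: "csubspace ((T ^^ m) ` M)" by (rule csubspace_funpow_image)
      have um: "(T ^^ n) u \<in> (T ^^ m) ` M" using funpow_image_antimono[of m n] False u(1) by auto
      have "?x - (T ^^ n) u \<in> (T ^^ m) ` M"
        by (rule complex_vector.subspace_diff[OF sub imageI[OF w(1)] um])
      moreover have "T (?x - (T ^^ n) u) = 0" unfolding T.diff Tx u(2) by simp
      ultimately have "?x - (T ^^ n) u \<in> A m" by (simp add: A_def kernel_def)
      then have "?x - (T ^^ n) u \<in> (T ^^ n) ` M" using m[of n] False by (auto simp: A_def)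
      from complex_vector.subspace_add[OF csubspace_funpow_image this imageI[OF u(1)]]
      show ?thesis by simp
    qed
    then show ?thesis using Tx nx by (intro bexI[of _ ?x]) (auto simp: R_def)
  qed
  then obtain h where h: "\<And>y. y \<in> R \<Longrightarrow> h y \<in> R \<and> T (h y) = y \<and> norm (h y) \<le> C * norm y"
    by metis
  obtain x0 where x0: "x0 \<in> R" "T x0 = 0" "x0 \<noteq> 0"
    using ker[of m] A_R by (auto simp: A_def kernel_def)
  define x where "x n = (h ^^ n) x0" for n
  have xR: "x n \<in> R" for n
  proof (induction n)
    case (Suc n)
    then show ?case using h by (simp add: x_def)
  qed (simp add: x_def x0)
  have "norm (x n) \<le> norm x0 * C ^ n" for n
  proof (induction n)
    case (Suc n)
    have "norm (x (Suc n)) \<le> C * norm (x n)" using h[OF xR[of n]] by (simp add: x_def)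
    also have "\<dots> \<le> C * (norm x0 * C ^ n)" using Suc C by (intro mult_left_mono) auto
    finally show ?case by (simp add: mult_ac)
  qed (simp add: x_def)
  moreover have "T (x (Suc n)) = x n" for n using h[OF xR[of n]] by (simp add: x_def)
  moreover have "x n \<in> M" for n
  proof -
    have "x n \<in> (T ^^ 0) ` M" using xR[of n] unfolding R_def by blast
    then show ?thesis by simp
  qed
  moreover have "x 0 = x0" by (simp add: x_def)
  ultimately show ?thesis using C x0 by metis
qed

text \<open>
  Infinite descent produces a chain for the transpose of the restriction of \<open>T\<close> to \<open>M\<close>. Let \<open>H\<close> be the
  union of the kernels of the powers of \<open>T\<close> in \<open>M\<close>. If \<open>T M + H\<close> were all of \<open>M\<close>, finitely many kernels
  would suffice and the descent would be finite; so some functional \<open>\<phi>0\<close> is nonzero on \<open>M\<close> and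
  vanishes on \<open>V = T M + H\<close>. The recursion \<open>\<phi>\<^sub>n\<^sub>+\<^sub>1 (T x + v) = \<phi>\<^sub>n x\<close>, with \<open>v\<close> in a finite-dimensional
  \<open>E\<close> such that \<open>M = T M + E\<close>, is consistent as long as all \<open>\<phi>\<^sub>n\<close> vanish on \<open>H\<close>. For this \<open>E\<close> is chosen with
  \<open>E \<inter> V \<subseteq> H\<close>: if \<open>T x + v\<close> is in \<open>H\<close>, then \<open>v\<close> is in \<open>V\<close>, hence in \<open>H\<close>, hence \<open>T x\<close> and \<open>x\<close>
  are in \<open>H\<close>.
\<close>

lemma ex_dual_chain:
  assumes fred: "fredholm_on M T"
    and desc: "\<And>n. \<not> (\<forall>y\<in>M. \<exists>x\<in>M. \<exists>v\<in>M. (T ^^ n) v = 0 \<and> y = T x + v)"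
  shows "\<exists>\<phi> K C. C > 0 \<and> (\<forall>x\<in>M. \<phi> 0 (T x) = 0) \<and> (\<exists>x\<in>M. \<phi> 0 x \<noteq> 0) \<and>
    (\<forall>n. clinear_on M (\<phi> n) \<and>
      (\<forall>x\<in>M. \<phi> (Suc n) (T x) = \<phi> n x \<and> cmod (\<phi> n x) \<le> K * C ^ n * norm x))"
proof -
  obtain B where B: "finite B" "M = cspan (T ` M \<union> B)" using fred by (auto simp: fredholm_on_def)
  define H where "H = {x\<in>M. \<exists>n. (T ^^ n) x = 0}"
  have HI: "x \<in> H" if "x \<in> M" "(T ^^ n) x = 0" for x n using that by (auto simp: H_def)
  have later: "(T ^^ n) x = 0" if x: "(T ^^ m) x = 0" and mn: "m \<le> n" for x m n
  proof -
    have "(T ^^ n) x = (T ^^ (n - m)) ((T ^^ m) x)"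
      using mn by (metis comp_apply Nat.funpow_add le_add_diff_inverse2)
    then show ?thesis by (simp add: x funpow_zero)
  qed
  have subH: "csubspace H"
    unfolding complex_vector.subspace_def
  proof (intro conjI ballI allI)
    show "0 \<in> H" by (rule HI[of _ 0]) (simp_all add: complex_vector.subspace_0[OF M(1)])
    fix x assume "x \<in> H"
    then obtain m where x: "x \<in> M" "(T ^^ m) x = 0" by (auto simp: H_def)
    show "c *\<^sub>C x \<in> H" for c
      by (rule HI[of _ m]) (simp_all add: x complex_vector.subspace_scale[OF M(1)] funpow_scaleC)
    fix y assume "y \<in> H"
    then obtain n where y: "y \<in> M" "(T ^^ n) y = 0" by (auto simp: H_def)
    show "x + y \<in> H"
      by (rule HI[of _ "max m n"])
        (simp_all add: x y complex_vector.subspace_add[OF M(1)] funpow_add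
          later[OF x(2)] later[OF y(2)])
  qed
  have HM: "H \<subseteq> M" by (auto simp: H_def)
  have T_H: "x \<in> H" if x: "x \<in> M" and Tx: "T x \<in> H" for x
  proof -
    obtain n where "(T ^^ n) (T x) = 0" using Tx by (auto simp: H_def)
    then show ?thesis using x by (intro HI[of _ "Suc n"]) (simp_all add: funpow_swap1)
  qed
  have subTM: "csubspace (T ` M)" by (rule csubspace_image[OF T M(1)])
  define V where "V = {t + s | t s. t \<in> T ` M \<and> s \<in> H}"
  have subV: "csubspace V" unfolding V_def by (rule complex_vector.subspace_sums[OF subTM subH])
  have TMV: "T ` M \<subseteq> V"
    using complex_vector.subspace_0[OF subH] by (force simp: V_def)
  have HV: "H \<subseteq> V"
    using complex_vector.subspace_0[OF subTM] by (force simp: V_def)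
  have VM: "V \<subseteq> M"
    unfolding V_def using invariant HM by (auto intro!: complex_vector.subspace_add[OF M(1)])
  have BM: "B \<subseteq> M" using B(2) finite_codim_iff_decomp by blast
  have "V \<noteq> M"
  proof
    assume VM: "V = M"
    have "\<forall>b\<in>B. \<exists>n. \<exists>x\<in>M. \<exists>v\<in>M. (T ^^ n) v = 0 \<and> b = T x + v"
    proof
      fix b assume "b \<in> B"
      then have "b \<in> V" using BM VM by blast
      then show "\<exists>n. \<exists>x\<in>M. \<exists>v\<in>M. (T ^^ n) v = 0 \<and> b = T x + v"
        unfolding V_def H_def by blast
    qed
    then obtain k where k: "\<And>b. b \<in> B \<Longrightarrow> \<exists>x\<in>M. \<exists>v\<in>M. (T ^^ k b) v = 0 \<and> b = T x + v" by metis
    define n where "n = Max (insert 0 (k ` B))"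
    have kn: "k b \<le> n" if "b \<in> B" for b using that B(1) by (simp add: n_def)
    let ?W = "{t + s | t s. t \<in> T ` M \<and> s \<in> M \<inter> kernel (T ^^ n)}"
    have "csubspace ?W"
      by (intro complex_vector.subspace_sums subTM complex_vector.subspace_inter M(1)
          csubspace_kernel funpow_linear)
    moreover have "T ` M \<subseteq> ?W"
      using complex_vector.subspace_0[OF M(1)] funpow_zero by (force simp: kernel_def)
    moreover have "B \<subseteq> ?W"
    proof
      fix b assume b: "b \<in> B"
      obtain x v where "x \<in> M" "v \<in> M" "(T ^^ k b) v = 0" "b = T x + v" using k[OF b] by blast
      then show "b \<in> ?W" using later[OF _ kn[OF b]] by (auto simp: kernel_def)
    qed
    ultimately have "M \<subseteq> ?W"
      by (subst B(2)) (intro complex_vector.span_minimal Un_least)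
    then have "\<forall>y\<in>M. \<exists>x\<in>M. \<exists>v\<in>M. (T ^^ n) v = 0 \<and> y = T x + v"
      unfolding kernel_def by blast
    then show False using desc by blast
  qed
  then obtain y0 where y0: "y0 \<in> M" "y0 \<notin> V" using VM by blast
  from algebraic_complement_in_finite_extension[OF subV B(1)]
  obtain B1 where B1: "B1 \<subseteq> B" "cspan (V \<union> B1) = cspan (V \<union> B)" "V \<inter> cspan B1 = {0}"
    by (elim exE conjE)
  have finB1: "finite B1" using B1(1) B(1) finite_subset by blast
  have spanV: "cspan (V \<union> B1) = M"
  proof
    show "cspan (V \<union> B1) \<subseteq> M"
      by (rule complex_vector.span_minimal[OF _ M(1)]) (use VM B1(1) BM in blast)
    show "M \<subseteq> cspan (V \<union> B1)"
      unfolding B1(2) by (subst B(2), rule complex_vector.span_mono) (use TMV in blast)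
  qed
  \<comment> \<open>Splitting each \<open>b\<close> along \<open>M = T M + H + cspan B1\<close>
    gives generators \<open>s b\<close> and \<open>w b\<close> of \<open>?E\<close> below.\<close>
  have "\<forall>b\<in>B. \<exists>s\<in>H. \<exists>w\<in>cspan B1. b - s - w \<in> T ` M"
  proof
    fix b assume "b \<in> B"
    then have "b \<in> cspan (V \<union> B1)" using BM spanV by blast
    then obtain v w where "v \<in> V" "w \<in> cspan B1" "b = v + w"
      unfolding cspan_subspace_Un[OF subV] by blast
    moreover then obtain t s where "t \<in> T ` M" "s \<in> H" "v = t + s" unfolding V_def by blast
    ultimately show "\<exists>s\<in>H. \<exists>w\<in>cspan B1. b - s - w \<in> T ` M"
      by (intro bexI[of _ s] bexI[of _ w]) (auto simp: algebra_simps)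
  qed
  then obtain s w where sw: "\<And>b. b \<in> B \<Longrightarrow> s b \<in> H \<and> w b \<in> cspan B1 \<and> b - s b - w b \<in> T ` M"
    by metis
  let ?E = "s ` B \<union> w ` B"
  have finE: "finite ?E" using B(1) by simp
  have spanB1M: "cspan B1 \<subseteq> M"
    by (rule complex_vector.span_minimal[OF _ M(1)]) (use B1(1) BM in blast)
  have EM: "?E \<subseteq> M" using sw HM spanB1M by blast
  have M_E: "M = cspan (T ` M \<union> ?E)"
  proof
    show "cspan (T ` M \<union> ?E) \<subseteq> M"
      by (rule complex_vector.span_minimal[OF _ M(1)]) (use EM invariant in blast)
    have "b \<in> cspan (T ` M \<union> ?E)" if b: "b \<in> B" for b
    proof -
      have "(b - s b - w b) + s b + w b \<in> cspan (T ` M \<union> ?E)"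
        by (intro complex_vector.span_add complex_vector.span_base) (use sw[OF b] b in auto)
      then show ?thesis by simp
    qed
    then have "T ` M \<union> B \<subseteq> cspan (T ` M \<union> ?E)"
      using complex_vector.span_superset[of "T ` M \<union> ?E"] by blast
    then show "M \<subseteq> cspan (T ` M \<union> ?E)"
      by (subst B(2)) (rule complex_vector.span_minimal[OF _ complex_vector.subspace_span])
  qed
  have E_decomp: "\<exists>a\<in>cspan (s ` B). \<exists>b\<in>cspan B1. v = a + b" if v: "v \<in> cspan ?E" for v
  proof -
    obtain a b where "a \<in> cspan (s ` B)" "b \<in> cspan (w ` B)" "v = a + b"
      using v unfolding complex_vector.span_Un by blast
    moreover have "cspan (w ` B) \<subseteq> cspan B1"
      by (rule complex_vector.span_minimal[OF _ complex_vector.subspace_span]) (use sw in blast)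
    ultimately show ?thesis by blast
  qed
  have spansH: "cspan (s ` B) \<subseteq> H"
    by (rule complex_vector.span_minimal[OF _ subH]) (use sw in blast)
  have E_V: "v \<in> H" if vE: "v \<in> cspan ?E" and vV: "v \<in> V" for v
  proof -
    obtain a b where ab: "a \<in> cspan (s ` B)" "b \<in> cspan B1" "v = a + b" using E_decomp[OF vE] by blast
    have "v - a \<in> V"
      by (rule complex_vector.subspace_diff[OF subV vV]) (use ab(1) spansH HV in blast)
    then have "b = 0" using ab B1(3) by auto
    then show ?thesis using ab spansH by auto
  qed
  have M_decomp: "\<exists>x\<in>M. \<exists>v\<in>cspan ?E. y = T x + v" if "y \<in> M" for y
    using that M_E finite_codim_iff_decomp by blast
  have closedV: "closed V"
  proof -
    define g where "g p = T (fst p) + snd p" for p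
    have g: "bounded_linear g" unfolding g_def
      by (intro bounded_linear_add bounded_linear_compose[OF T.bounded_linear_axioms]
          bounded_linear_fst bounded_linear_snd)
    have gV: "g ` (M \<times> cspan (s ` B)) = V"
    proof
      show "g ` (M \<times> cspan (s ` B)) \<subseteq> V" unfolding g_def V_def using spansH by fastforce
      show "V \<subseteq> g ` (M \<times> cspan (s ` B))"
      proof
        fix v assume v: "v \<in> V"
        then obtain x e where x: "x \<in> M" "e \<in> cspan ?E" "v = T x + e" using VM M_decomp by blast
        obtain a b where ab: "a \<in> cspan (s ` B)" "b \<in> cspan B1" "e = a + b" using E_decomp[OF x(2)] by blast
        have "v - (T x + a) \<in> V"
          using ab(1) spansH x(1) by (intro complex_vector.subspace_diff[OF subV v]) (auto simp: V_def)
        then have "b = 0" using ab B1(3) x(3) by auto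
        then show "v \<in> g ` (M \<times> cspan (s ` B))" using x ab by (force simp: g_def)
      qed
    qed
    have "closed (g ` (M \<times> cspan (s ` B)))"
    proof (rule closed_range_if_finite_codim[OF g])
      show "subspace (M \<times> cspan (s ` B))"
        by (intro subspace_Times subM) (simp add: csubspace_imp_subspace)
      show "closed (M \<times> cspan (s ` B))"
        by (intro closed_Times M closed_cspan_finite finite_imageI B)
      show "csubspace (g ` (M \<times> cspan (s ` B)))" unfolding gV by (rule subV)
      show "closed (cspan (g ` (M \<times> cspan (s ` B)) \<union> B1))" unfolding gV spanV by (rule M(2))
    qed (rule finB1)
    then show ?thesis by (simp only: gV)
  qed
  obtain \<phi>0 :: "'a \<Rightarrow> complex" where \<phi>0: "bounded_clinear \<phi>0" "\<And>v. v \<in> V \<Longrightarrow> \<phi>0 v = 0" "\<phi>0 y0 \<noteq> 0"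
    using ex_functional_separating[OF subV closedV y0(2)] by blast
  \<comment> \<open>\<open>X\<close> is a bounded choice of solutions of \<open>y = T x + v\<close>. It need not be
    linear, but the \<open>\<phi>\<^sub>n\<close> are, since two solutions differ by an element of \<open>H\<close>.\<close>
  obtain C where C: "C > 0"
    "\<And>y. y \<in> M \<Longrightarrow> \<exists>x\<in>M. \<exists>v\<in>cspan ?E. y = T x + v \<and> norm x \<le> C * norm y \<and> norm v \<le> C * norm y"
    using open_mapping_finite_codim[OF finE M_E] by blast
  then obtain X where X: "\<And>y. y \<in> M \<Longrightarrow> X y \<in> M \<and> y - T (X y) \<in> cspan ?E \<and> norm (X y) \<le> C * norm y"
    by (metis add_diff_cancel_left')
  have X_unique: "X y - x \<in> H" if "y \<in> M" "x \<in> M" "y - T x \<in> cspan ?E" for x y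
  proof -
    have in_M: "X y - x \<in> M" using X[OF that(1)] that(2) subspace_diff[OF subM] by blast
    have "(y - T x) - (y - T (X y)) \<in> cspan ?E"
      using X[OF that(1)] that(3) by (intro complex_vector.span_diff[of "y - T x"]) auto
    then have "T (X y - x) \<in> cspan ?E" by (simp add: T.diff)
    then have "T (X y - x) \<in> H" using E_V TMV in_M by blast
    then show ?thesis using T_H in_M by blast
  qed
  define \<phi> where "\<phi> n y = \<phi>0 ((X ^^ n) y)" for n y
  have \<phi>_Suc: "\<phi> (Suc n) y = \<phi> n (X y)" for n y by (simp add: \<phi>_def funpow_swap1)
  obtain K where K: "\<And>x. norm (\<phi>0 x) \<le> norm x * K"
    using bounded_linear.bounded[OF bounded_clinear_bounded_linear[OF \<phi>0(1)]] by blast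
  have main: "clinear_on M (\<phi> n) \<and> (\<forall>x\<in>H. \<phi> n x = 0) \<and> (\<forall>x\<in>M. cmod (\<phi> n x) \<le> \<bar>K\<bar> * C ^ n * norm x)" for n
  proof (induction n)
    case 0
    have "\<phi>0 (x + y) = \<phi>0 x + \<phi>0 y" for x y
      using bounded_clinear_bounded_linear[OF \<phi>0(1)] by (simp add: bounded_linear.linear linear_add)
    moreover have "\<phi>0 (c *\<^sub>C x) = c * \<phi>0 x" for c x
      using \<phi>0(1) by (simp add: bounded_clinear_def scaleC_complex_def)
    moreover have "cmod (\<phi>0 x) \<le> \<bar>K\<bar> * norm x" for x
      using K[of x] mult_right_mono[OF abs_ge_self[of K], of "norm x"] by (simp add: mult.commute)
    ultimately show ?case using \<phi>0(2) HV by (auto simp: \<phi>_def clinear_on_def)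
  next
    case (Suc n)
    have add: "\<phi> n (x + y) = \<phi> n x + \<phi> n y" if "x \<in> M" "y \<in> M" for x y
      using Suc that by (simp add: clinear_on_def)
    have scale: "\<phi> n (c *\<^sub>C x) = c * \<phi> n x" if "x \<in> M" for x c
      using Suc that by (simp add: clinear_on_def)
    have eq: "\<phi> (Suc n) y = \<phi> n x" if "y \<in> M" "x \<in> M" "y - T x \<in> cspan ?E" for x y
    proof -
      have "X y - x \<in> H" by (rule X_unique[OF that])
      then have "\<phi> n (X y - x) = 0" "X y - x \<in> M" using Suc HM by auto
      then show ?thesis using add[of "X y - x" x] that(2) by (simp add: \<phi>_Suc)
    qed
    show ?case
    proof (intro conjI ballI)
      show "clinear_on M (\<phi> (Suc n))" unfolding clinear_on_def
      proof (intro conjI ballI allI)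
        fix x assume x: "x \<in> M"
        note Xx = X[OF x]
        have "c *\<^sub>C (x - T (X x)) \<in> cspan ?E" for c
          by (rule complex_vector.span_scale) (simp add: Xx)
        then have "c *\<^sub>C x - T (c *\<^sub>C X x) \<in> cspan ?E" for c
          by (simp add: T_scaleC complex_vector.scale_right_diff_distrib)
        then have "\<phi> (Suc n) (c *\<^sub>C x) = \<phi> n (c *\<^sub>C X x)" for c
          by (intro eq[of "c *\<^sub>C x" "c *\<^sub>C X x"] complex_vector.subspace_scale[OF M(1)]) (simp_all add: x Xx)
        then show "\<phi> (Suc n) (c *\<^sub>C x) = c * \<phi> (Suc n) x" for c
          using scale Xx by (simp add: \<phi>_Suc)
        fix y assume y: "y \<in> M"
        note Xy = X[OF y]
        have "(x - T (X x)) + (y - T (X y)) \<in> cspan ?E"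
          by (rule complex_vector.span_add) (simp_all add: Xx Xy)
        then have "x + y - T (X x + X y) \<in> cspan ?E" by (simp add: T.add algebra_simps)
        then have "\<phi> (Suc n) (x + y) = \<phi> n (X x + X y)"
          by (intro eq[of "x + y" "X x + X y"] complex_vector.subspace_add[OF M(1)]) (simp_all add: x y Xx Xy)
        then show "\<phi> (Suc n) (x + y) = \<phi> (Suc n) x + \<phi> (Suc n) y"
          using add Xx Xy by (simp add: \<phi>_Suc)
      qed
      fix x assume "x \<in> H"
      then have x: "x \<in> M" "x \<in> V" "x \<in> H" using HM HV by auto
      note Xx = X[OF x(1)]
      have TXM: "T (X x) \<in> V" using Xx TMV by blast
      then have "x - T (X x) \<in> H"
        using Xx by (intro E_V) (auto intro: complex_vector.subspace_diff[OF subV x(2)])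
      then have "x - (x - T (X x)) \<in> H" by (rule complex_vector.subspace_diff[OF subH x(3)])
      then have "X x \<in> H" using Xx by (auto intro: T_H[of "X x"])
      then show "\<phi> (Suc n) x = 0" using Suc by (simp add: \<phi>_Suc)
    next
      fix x assume x: "x \<in> M"
      have "cmod (\<phi> n (X x)) \<le> \<bar>K\<bar> * C ^ n * norm (X x)" using Suc X[OF x] by simp
      also have "\<dots> \<le> \<bar>K\<bar> * C ^ n * (C * norm x)"
        using X[OF x] C(1) by (intro mult_left_mono) auto
      finally show "cmod (\<phi> (Suc n) x) \<le> \<bar>K\<bar> * C ^ Suc n * norm x" by (simp add: \<phi>_Suc mult_ac)
    qed
  qed
  have "\<phi> (Suc n) (T x) = \<phi> n x" if x: "x \<in> M" for n x
  proof -
    have Tx: "T x \<in> M" using x invariant by blast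
    have "X (T x) - x \<in> H"
      by (rule X_unique[OF Tx x]) (simp add: complex_vector.span_zero)
    then have "\<phi> n (X (T x) - x) = 0" "X (T x) - x \<in> M" using main HM by auto
    moreover have "\<phi> n ((X (T x) - x) + x) = \<phi> n (X (T x) - x) + \<phi> n x"
      using main calculation(2) x unfolding clinear_on_def by blast
    ultimately show ?thesis by (simp add: \<phi>_Suc)
  qed
  moreover have "\<phi> 0 (T x) = 0" if "x \<in> M" for x using \<phi>0(2) TMV that by (auto simp: \<phi>_def)
  moreover have "\<phi> 0 y0 \<noteq> 0" using \<phi>0(3) by (simp add: \<phi>_def)
  ultimately show ?thesis
    using C(1) y0(1) main by (intro exI[of _ \<phi>] exI[of _ "\<bar>K\<bar>"] exI[of _ C]) blast
qed

text \<open>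
  Finite ascent makes \<open>T\<close> injective and finite descent makes it surjective on \<open>T\<^sup>q M\<close> for large \<open>q\<close>.
\<close>

lemma bij_betw_funpow_image:
  assumes fred: "fredholm_on M T"
    and asc: "\<And>x. x \<in> (T ^^ p) ` M \<Longrightarrow> T x = 0 \<Longrightarrow> x = 0"
    and desc: "\<And>y. y \<in> M \<Longrightarrow> \<exists>x\<in>M. \<exists>v\<in>M. (T ^^ n) v = 0 \<and> y = T x + v"
  shows "\<exists>q. bij_betw T ((T ^^ q) ` M) ((T ^^ q) ` M) \<and> closed ((T ^^ q) ` M)"
proof -
  let ?q = "max p n"
  let ?R = "(T ^^ ?q) ` M"
  have "T ` ?R = ?R"
  proof
    show "T ` ?R \<subseteq> ?R" by (rule invariant_funpow_image)
    show "?R \<subseteq> T ` ?R"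
    proof
      fix z assume "z \<in> ?R"
      then obtain y where y: "y \<in> M" "z = (T ^^ ?q) y" by blast
      obtain x v where x: "x \<in> M" "v \<in> M" "(T ^^ n) v = 0" "y = T x + v" using desc[OF y(1)] by blast
      have "(T ^^ ?q) v = (T ^^ (?q - n)) ((T ^^ n) v)"
        by (metis comp_apply Nat.funpow_add le_add_diff_inverse2 max.cobounded2)
      then have "z = T ((T ^^ ?q) x)" using x by (simp add: y(2) funpow_add funpow_zero funpow_swap1)
      then show "z \<in> T ` ?R" using x(1) by blast
    qed
  qed
  moreover have "inj_on T ?R"
  proof (rule inj_onI)
    fix x y assume xy: "x \<in> ?R" "y \<in> ?R" "T x = T y"
    have "x - y \<in> ?R" using complex_vector.subspace_diff[OF csubspace_funpow_image] xy by blast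
    then have "x - y \<in> (T ^^ p) ` M" using funpow_image_antimono[of p ?q] by auto
    then show "x = y" using asc[of "x - y"] xy(3) by (simp add: T.diff)
  qed
  ultimately show ?thesis using closed_funpow_image[OF fred] by (metis bij_betw_def)
qed

text \<open>
  At points \<open>z\<close> near 0 where \<open>T - z\<close> is injective on \<open>M\<close>, the eigenvector built from a chain is 0, and
  where \<open>T - z\<close> is onto, so is the functional built from a dual chain. Both depend continuously on \<open>z\<close>,
  so the chains would start with 0; hence ascent and descent are finite.
\<close>

theorem bij_betw_funpow_image_if_near_bij:
  assumes fred: "fredholm_on M T"
    and near: "\<And>e. e > 0 \<Longrightarrow> \<exists>z. cmod z < e \<and> bij_betw (shift T z) M M"
  shows "\<exists>q. bij_betw T ((T ^^ q) ` M) ((T ^^ q) ` M) \<and> closed ((T ^^ q) ` M)"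
proof -
  have "\<exists>p. \<forall>x\<in>(T ^^ p) ` M. T x = 0 \<longrightarrow> x = 0"
  proof (rule ccontr)
    assume "\<not> ?thesis"
    then have "\<exists>x\<in>(T ^^ n) ` M. T x = 0 \<and> x \<noteq> 0" for n by blast
    from ex_backward_chain[OF fred this] obtain x K C
      where C: "C > 0" and x: "T (x 0) = 0" "x 0 \<noteq> 0" "\<And>n. x n \<in> M" "\<And>n. T (x (Suc n)) = x n"
        "\<And>n. norm (x n) \<le> K * C ^ n" by blast
    let ?r = "1 / (2 * C)"
    have r: "?r > 0" using C by simp
    obtain f where f: "\<And>z. cmod z < ?r \<Longrightarrow> (\<lambda>n. z ^ n *\<^sub>C x n) sums f z"
      "vec_analytic_on f (ball 0 ?r)" "f 0 = x 0" using vec_power_series[OF x(5) C] by blast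
    have "f 0 = 0"
    proof (rule continuous_zero_if_zeros_accumulate[OF vec_analytic_on_imp_continuous_on[OF f(2)] r])
      fix e :: real assume "e > 0"
      then obtain z where z: "cmod z < min e ?r" "bij_betw (shift T z) M M" using near[of "min e ?r"] r by auto
      have sums: "(\<lambda>n. z ^ n *\<^sub>C x n) sums f z" using z by (intro f(1)) simp
      have "f z \<in> M"
        using sums unfolding sums_def
        by (rule closed_sequentially[OF M(2), rotated])
          (intro complex_vector.subspace_sum[OF M(1)] complex_vector.subspace_scale[OF M(1)] x(3))
      moreover have "shift T z (f z) = shift T z 0"
        using eigenvector_of_chain[OF T x(1,4) sums] by (simp add: T.zero)
      ultimately have "f z = 0"
        using z(2) complex_vector.subspace_0[OF M(1)] unfolding bij_betw_def inj_on_def by blast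
      then show "\<exists>z. cmod z < e \<and> f z = 0" using z(1) by auto
    qed
    then show False using f(3) x(2) by simp
  qed
  then obtain p where p: "\<And>x. x \<in> (T ^^ p) ` M \<Longrightarrow> T x = 0 \<Longrightarrow> x = 0" by blast
  have "\<exists>n. \<forall>y\<in>M. \<exists>x\<in>M. \<exists>v\<in>M. (T ^^ n) v = 0 \<and> y = T x + v"
  proof (rule ccontr)
    assume "\<not> ?thesis"
    then have "\<not> (\<forall>y\<in>M. \<exists>x\<in>M. \<exists>v\<in>M. (T ^^ n) v = 0 \<and> y = T x + v)" for n by blast
    from ex_dual_chain[OF fred this] obtain \<phi> K C y
      where C: "C > 0" and \<phi>: "\<And>x. x \<in> M \<Longrightarrow> \<phi> 0 (T x) = 0" "y \<in> M" "\<phi> 0 y \<noteq> 0"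
        "\<And>n. clinear_on M (\<phi> n)" "\<And>n x. x \<in> M \<Longrightarrow> \<phi> (Suc n) (T x) = \<phi> n x"
        "\<And>n x. x \<in> M \<Longrightarrow> cmod (\<phi> n x) \<le> K * C ^ n * norm x" by metis
    let ?r = "1 / (2 * C)"
    have r: "?r > 0" using C by simp
    have bd: "norm (\<phi> n x) \<le> (K * norm x) * C ^ n" if "x \<in> M" for n x
      using \<phi>(6)[OF that, of n] by (simp add: mult_ac)
    obtain f where f: "\<And>z. cmod z < ?r \<Longrightarrow> (\<lambda>n. z ^ n *\<^sub>C \<phi> n y) sums f z"
      "vec_analytic_on f (ball 0 ?r)" "f 0 = \<phi> 0 y" using vec_power_series[OF bd[OF \<phi>(2)] C] by blast
    have "f 0 = 0"
    proof (rule continuous_zero_if_zeros_accumulate[OF vec_analytic_on_imp_continuous_on[OF f(2)] r])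
      fix e :: real assume "e > 0"
      then obtain z where z: "cmod z < min e ?r" "bij_betw (shift T z) M M" using near[of "min e ?r"] r by auto
      obtain x where x: "x \<in> M" "y = shift T z x" using z(2) \<phi>(2) by (auto simp: bij_betw_def)
      obtain g where "\<And>z. cmod z < ?r \<Longrightarrow> (\<lambda>n. z ^ n *\<^sub>C \<phi> n x) sums g z"
        using vec_power_series[OF bd[OF x(1)] C] by blast
      then have gz: "(\<lambda>n. z ^ n * \<phi> n x) sums g z" using z(1) by (simp add: scaleC_complex_def)
      have Tx: "T x \<in> M" using x(1) invariant by blast
      have \<phi>y: "\<phi> n y = \<phi> n (T x) - z * \<phi> n x" for n
      proof -
        have "T x = y + z *\<^sub>C x" using x(2) by simp
        then have "\<phi> n (T x) = \<phi> n y + z * \<phi> n x"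
          using \<phi>(4)[of n] \<phi>(2) x(1) complex_vector.subspace_scale[OF M(1) x(1)]
          by (simp add: clinear_on_def)
        then show ?thesis by simp
      qed
      then have eq: "z ^ n *\<^sub>C \<phi> n y = z ^ n * \<phi> n (T x) - z * (z ^ n * \<phi> n x)" for n
        unfolding scaleC_complex_def \<phi>y[of n] by (simp add: algebra_simps)
      have "(\<lambda>n. z ^ Suc n * \<phi> (Suc n) (T x)) sums (z * g z)"
        using sums_mult[OF gz, of z] by (simp add: \<phi>(5)[OF x(1)] mult.assoc)
      then have "(\<lambda>n. z ^ n * \<phi> n (T x)) sums (z * g z)"
        by (subst (asm) sums_Suc_iff) (simp add: \<phi>(1)[OF x(1)])
      from sums_diff[OF this sums_mult[OF gz, of z]]
      have "(\<lambda>n. z ^ n *\<^sub>C \<phi> n y) sums 0" by (simp add: eq)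
      moreover have "(\<lambda>n. z ^ n *\<^sub>C \<phi> n y) sums f z" using z by (intro f(1)) simp
      ultimately have "f z = 0" by (rule sums_unique2[symmetric])
      then show "\<exists>z. cmod z < e \<and> f z = 0" using z(1) by auto
    qed
    then show False using f(3) \<phi>(3) by simp
  qed
  then obtain n where "\<And>y. y \<in> M \<Longrightarrow> \<exists>x\<in>M. \<exists>v\<in>M. (T ^^ n) v = 0 \<and> y = T x + v" by blast
  from bij_betw_funpow_image[OF fred p this] show ?thesis .
qed

end

section \<open>The adjoint\<close>

lemma cdual_eqI: "(\<And>x. cdual_apply f x = cdual_apply g x) \<Longrightarrow> f = g"
  by (metis cdual_apply_inject ext)

lemma bounded_clinear_adjoint_op:
  assumes T: "bounded_clinear T"
  shows "bounded_clinear (adjoint_op T)"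
proof -
  note simps = cdual_apply_adjoint_op[OF T] plus_cdual.rep_eq scaleC_cdual.rep_eq
  have scale: "adjoint_op T (c *\<^sub>C f) = c *\<^sub>C adjoint_op T f" for c f
    by (rule cdual_eqI) (simp add: simps)
  have bl: "bounded_linear T" by (rule bounded_clinear_bounded_linear[OF T])
  have "bounded_linear (adjoint_op T)"
  proof (rule bounded_linear_intro[of _ "onorm T"])
    show "adjoint_op T (f + g) = adjoint_op T f + adjoint_op T g" for f g
      by (rule cdual_eqI) (simp add: simps)
    show "adjoint_op T (r *\<^sub>R f) = r *\<^sub>R adjoint_op T f" for r f
      by (simp add: scaleR_scaleC scale)
    show "norm (adjoint_op T f) \<le> norm f * onorm T" for f
      unfolding norm_cdual.rep_eq[of "adjoint_op T f"]
    proof (rule onorm_bound)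
      show "0 \<le> norm f * onorm T" by (simp add: onorm_pos_le[OF bl])
      fix x
      have "norm (cdual_apply f (T x)) \<le> norm f * norm (T x)" by (rule norm_cdual_apply)
      also have "\<dots> \<le> norm f * (onorm T * norm x)" by (intro mult_left_mono onorm[OF bl]) simp
      finally show "norm (cdual_apply (adjoint_op T f) x) \<le> norm f * onorm T * norm x"
        by (simp add: cdual_apply_adjoint_op[OF T] mult.assoc)
    qed
  qed
  then show ?thesis by (simp add: bounded_clinear_def scale)
qed

lemma cdual_apply_shift_adjoint_op:
  assumes T: "bounded_clinear T"
  shows "cdual_apply (shift (adjoint_op T) z f) x = cdual_apply f (shift T z x)"
proof -
  interpret f: bounded_linear "cdual_apply f" by (rule bounded_linear_cdual_apply)
  show ?thesis
    by (simp add: cdual_apply_adjoint_op[OF T] minus_cdual.rep_eq scaleC_cdual.rep_eq f.diff cdual_apply_scaleC)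
qed

section \<open>The resolvent set\<close>

text \<open>
  By the bounded inverse theorem an algebraic inverse of a bounded operator is bounded.
\<close>

definition resolvent_set :: "('a::complex_normed_vector \<Rightarrow> 'a) \<Rightarrow> complex set"
  where "resolvent_set T = {z. bij (shift T z)}"

lemma shift_shift: "shift (shift T l) z = shift T (l + z)"
  by (simp add: fun_eq_iff scaleC_add_left algebra_simps)

lemma closed_invariant_subspace_UNIV:
  "bounded_clinear T \<Longrightarrow> closed_invariant_subspace (T :: 'a::complex_banach \<Rightarrow> 'a) UNIV"
  by (simp add: closed_invariant_subspace_def)

lemma closure_resolvent_set_iff:
  "l \<in> closure (resolvent_set T) \<longleftrightarrow> (\<forall>e>0. \<exists>z. cmod z < e \<and> bij (shift (shift T l) z))"
proof -
  have "l \<in> closure (resolvent_set T) \<longleftrightarrow> (\<forall>e>0. \<exists>z. cmod (z - l) < e \<and> bij (shift T z))"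
    unfolding closure_approachable resolvent_set_def by (auto simp: dist_norm)
  also have "\<dots> \<longleftrightarrow> (\<forall>e>0. \<exists>z. cmod z < e \<and> bij (shift T (l + z)))"
    by (metis add_diff_cancel_left' diff_add_cancel add.commute)
  finally show ?thesis unfolding shift_shift .
qed

lemma open_resolvent_set:
  fixes T :: "'a::complex_banach \<Rightarrow> 'a"
  assumes T: "bounded_clinear T"
  shows "open (resolvent_set T)"
  unfolding open_dist
proof
  fix l assume l: "l \<in> resolvent_set T"
  interpret A: closed_invariant_subspace "shift T l" UNIV
    by (rule closed_invariant_subspace_UNIV[OF bounded_clinear_shift[OF T]])
  obtain e where e: "e > 0" "\<And>z. cmod z < e \<Longrightarrow> bij (shift (shift T l) z)"
    using A.bij_betw_shift_small l by (auto simp: resolvent_set_def)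
  have "z \<in> resolvent_set T" if "dist z l < e" for z
    using e(2)[of "z - l"] that unfolding shift_shift by (simp add: resolvent_set_def dist_norm)
  then show "\<exists>e>0. \<forall>z. dist z l < e \<longrightarrow> z \<in> resolvent_set T" using e(1) by blast
qed

text \<open>
  The identity theorem for scalar functions, applied to the compositions with bounded functionals.
\<close>

lemma vec_analytic_zero_on_connected:
  fixes f :: "complex \<Rightarrow> 'b::complex_normed_vector"
  assumes U: "open U" "connected U" and f: "vec_analytic_on f U"
    and W: "open W" "W \<noteq> {}" "W \<subseteq> U" "\<And>z. z \<in> W \<Longrightarrow> f z = 0" and z: "z \<in> U"
  shows "f z = 0"
proof (rule ccontr)
  assume nz: "f z \<noteq> 0"
  obtain \<phi> :: "'b \<Rightarrow> complex" where \<phi>: "bounded_clinear \<phi>" "\<phi> (f z) \<noteq> 0"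
    using ex_functional_separating[of "{0}" "f z"] nz by auto
  interpret \<phi>: bounded_linear \<phi> by (rule bounded_clinear_bounded_linear[OF \<phi>(1)])
  have "(\<lambda>z. \<phi> (f z)) holomorphic_on U"
    unfolding holomorphic_on_open[OF U(1)]
  proof (intro ballI)
    fix w assume "w \<in> U"
    then obtain D where D: "(f has_derivative (\<lambda>h. h *\<^sub>C D)) (at w)"
      using f unfolding vec_analytic_on_def by blast
    have "((\<lambda>z. \<phi> (f z)) has_derivative (\<lambda>h. \<phi> (h *\<^sub>C D))) (at w)"
      by (rule \<phi>.has_derivative[OF D])
    moreover have "(\<lambda>h. \<phi> (h *\<^sub>C D)) = (*) (\<phi> D)"
      using \<phi>(1) by (simp add: fun_eq_iff bounded_clinear_def scaleC_complex_def mult.commute)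
    ultimately have "((\<lambda>z. \<phi> (f z)) has_field_derivative \<phi> D) (at w)"
      by (simp only: has_field_derivative_def)
    then show "\<exists>f'. ((\<lambda>z. \<phi> (f z)) has_field_derivative f') (at w)" by blast
  qed
  from analytic_continuation_open[OF W(1) U(1) W(2) U(2) W(3) this holomorphic_on_const[of 0] _ z]
  show False using W(4) \<phi>(2) \<phi>.zero by simp
qed

text \<open>
  On the nonempty open set of resolvent points in \<open>U\<close> the operators \<open>T - z\<close> and \<open>T* - z\<close> are injective
  (the latter since \<open>T - z\<close> is onto), so a solution of the eigenvalue equation vanishes there, and then
  on all of \<open>U\<close>.
\<close>

lemma svep_at_if_in_closure_resolvent_set:
  fixes T :: "'a::complex_banach \<Rightarrow> 'a"
  assumes T: "bounded_clinear T" and l: "l \<in> closure (resolvent_set T)"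
  shows "svep_at T l \<and> svep_at (adjoint_op T) l"
proof -
  have main: "svep_at S l" if S: "\<And>z y. z \<in> resolvent_set T \<Longrightarrow> shift S z y = 0 \<Longrightarrow> y = 0"
    for S :: "'b::complex_normed_vector \<Rightarrow> 'b"
    unfolding svep_at_def
  proof (intro allI impI, elim conjE)
    fix U and f :: "complex \<Rightarrow> 'b"
    assume U: "open U" "connected U" "l \<in> U" and f: "vec_analytic_on f U"
      and eig: "\<forall>z\<in>U. shift S z (f z) = 0"
    let ?W = "U \<inter> resolvent_set T"
    have "?W \<noteq> {}" using l U(3) open_Int_closure_eq_empty[OF U(1)] by blast
    moreover have "f z = 0" if "z \<in> ?W" for z using that eig S by blast
    moreover have "open ?W" by (rule open_Int[OF U(1) open_resolvent_set[OF T]])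
    ultimately show "\<forall>z\<in>U. f z = 0"
      using vec_analytic_zero_on_connected[OF U(1,2) f, of ?W] by blast
  qed
  have "svep_at T l"
  proof (rule main)
    fix z y assume z: "z \<in> resolvent_set T" and "shift T z y = 0"
    moreover have "shift T z 0 = 0"
      using linear_0[OF bounded_linear.linear[OF bounded_clinear_bounded_linear[OF T]]] by simp
    ultimately have "shift T z y = shift T z 0" by (simp only:)
    moreover have "inj (shift T z)" using z by (simp add: resolvent_set_def bij_def)
    ultimately show "y = 0" by (rule injD[rotated])
  qed
  moreover have "svep_at (adjoint_op T) l"
  proof (rule main)
    fix z f assume z: "z \<in> resolvent_set T" and f: "shift (adjoint_op T) z f = 0"
    show "f = 0"
    proof (rule cdual_eqI)
      fix x
      obtain y where "x = shift T z y"
        using z by (auto simp: resolvent_set_def bij_def surj_def)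
      then have "cdual_apply f x = cdual_apply (shift (adjoint_op T) z f) y"
        by (simp add: cdual_apply_shift_adjoint_op[OF T])
      then show "cdual_apply f x = cdual_apply 0 x" by (simp add: f zero_cdual.rep_eq)
    qed
  qed
  ultimately show ?thesis by blast
qed

section \<open>Reducing pairs\<close>

lemma reducing_pair_shift:
  assumes "reducing_pair T X1 X2"
  shows "reducing_pair (shift T z) X1 X2"
proof -
  have "shift T z ` M \<subseteq> M" if "csubspace M" "T ` M \<subseteq> M" for M
    using that by (auto intro: complex_vector.subspace_diff complex_vector.subspace_scale)
  then show ?thesis using assms by (simp add: reducing_pair_def)
qed

lemma closed_invariant_subspace_reducing_pair:
  assumes "bounded_clinear (T :: 'a::complex_banach \<Rightarrow> 'a)" "reducing_pair T X1 X2"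
  shows "closed_invariant_subspace T X1" "closed_invariant_subspace T X2"
  using assms by (simp_all add: closed_invariant_subspace_def reducing_pair_def)

lemma bij_iff_bij_betw_reducing_pair:
  fixes T :: "'a::complex_banach \<Rightarrow> 'a"
  assumes T: "bounded_clinear T" and red: "reducing_pair T X1 X2"
  shows "bij T \<longleftrightarrow> bij_betw T X1 X1 \<and> bij_betw T X2 X2"
proof -
  interpret X1: closed_invariant_subspace T X1 by (rule closed_invariant_subspace_reducing_pair[OF T red])
  interpret X2: closed_invariant_subspace T X2 by (rule closed_invariant_subspace_reducing_pair[OF T red])
  have int: "X1 \<inter> X2 = {0}" and sum: "\<And>x. \<exists>u\<in>X1. \<exists>v\<in>X2. x = u + v"
    using red by (auto simp: reducing_pair_def)
  have onto: "T ` A = A" if bij: "bij T" and A: "subspace A" "T ` A \<subseteq> A" and B: "T ` B \<subseteq> B" "A \<inter> B = {0}"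
    and sum: "\<And>x. \<exists>u\<in>A. \<exists>v\<in>B. x = u + v" for A B
  proof
    show "A \<subseteq> T ` A"
    proof
      fix y assume y: "y \<in> A"
      obtain x where x: "y = T x" using bij by (metis bij_pointE)
      obtain u v where uv: "u \<in> A" "v \<in> B" "x = u + v" using sum by blast
      have Tv: "T v = y - T u" using x uv(3) by (simp add: X1.T.add)
      then have "T v \<in> A" using subspace_diff[OF A(1) y] uv(1) A(2) by (auto simp: image_subset_iff)
      then have "T v = 0" using B uv(2) by blast
      then show "y \<in> T ` A" using Tv uv(1) by simp
    qed
  qed (rule A)
  show ?thesis
  proof
    assume bij: "bij T"
    have "T ` X1 = X1" by (rule onto[OF bij X1.subM X1.invariant X2.invariant int sum])
    moreover have "T ` X2 = X2"
    proof (rule onto[OF bij X2.subM X2.invariant X1.invariant])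
      show "\<exists>u\<in>X2. \<exists>v\<in>X1. x = u + v" for x using sum[of x] by (metis add.commute)
    qed (use int in blast)
    ultimately show "bij_betw T X1 X1 \<and> bij_betw T X2 X2"
      using bij unfolding bij_betw_def by (meson inj_on_subset subset_UNIV)
  next
    assume bij: "bij_betw T X1 X1 \<and> bij_betw T X2 X2"
    have "x = 0" if x: "T x = 0" for x
    proof -
      obtain u v where uv: "u \<in> X1" "v \<in> X2" "x = u + v" using sum by blast
      have Tu: "T u = - T v" using x uv(3) by (simp add: X1.T.add eq_neg_iff_add_eq_0)
      moreover have "- T v \<in> X2" using uv(2) X2.invariant subspace_neg[OF X2.subM] by blast
      moreover have "T u \<in> X1" using uv(1) X1.invariant by blast
      ultimately have "T u \<in> X1 \<inter> X2" by simp
      then have "T u = 0" using int by blast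
      then have "T u = 0" "T v = 0" using Tu by simp_all
      then have "u = 0" "v = 0"
        using bij uv(1,2) X1.bij_betw_iff_trivial_kernel X2.bij_betw_iff_trivial_kernel
        by (auto simp: kernel_def)
      then show ?thesis using uv(3) by simp
    qed
    then have "inj T" using linear_injective_0[OF X1.T.linear_axioms] by blast
    moreover have "y \<in> range T" for y
    proof -
      obtain u v where uv: "u \<in> X1" "v \<in> X2" "y = u + v" using sum by blast
      obtain a b where "u = T a" "v = T b" using bij uv(1,2) unfolding bij_betw_def by blast
      then have "y = T (a + b)" by (simp add: uv(3) X1.T.add)
      then show ?thesis by blast
    qed
    ultimately show "bij T" by (auto simp: bij_def)
  qed
qed

lemma quasinilpotent_on_iff_bij_betw:
  assumes "closed_invariant_subspace T M"
  shows "quasinilpotent_on M T \<longleftrightarrow> (\<forall>z. z \<noteq> 0 \<longrightarrow> bij_betw (shift T z) M M)"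
proof -
  have "invertible_on M (shift T z) \<longleftrightarrow> bij_betw (shift T z) M M" for z
    by (rule closed_invariant_subspace.invertible_on_iff_bij_betw)
      (rule closed_invariant_subspace.shift_subspace[OF assms])
  then show ?thesis unfolding quasinilpotent_on_def spectrum_on_def by auto
qed

text \<open>
  The projection onto \<open>X1\<close> along \<open>X2\<close>; it is bounded by the open mapping theorem for addition on
  \<open>X1 \<times> X2\<close>.
\<close>

lemma reducing_pair_projection:
  fixes T :: "'a::complex_banach \<Rightarrow> 'a"
  assumes T: "bounded_clinear T" and red: "reducing_pair T X1 X2"
  obtains P where "bounded_clinear P" "\<And>x. P x \<in> X1" "\<And>x. x - P x \<in> X2"
    "\<And>x. x \<in> X1 \<Longrightarrow> P x = x" "\<And>x. x \<in> X2 \<Longrightarrow> P x = 0" "\<And>x. T (P x) = P (T x)"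
proof -
  interpret X1: closed_invariant_subspace T X1 by (rule closed_invariant_subspace_reducing_pair[OF T red])
  interpret X2: closed_invariant_subspace T X2 by (rule closed_invariant_subspace_reducing_pair[OF T red])
  have int: "X1 \<inter> X2 = {0}" and sum: "\<And>x. \<exists>u\<in>X1. \<exists>v\<in>X2. x = u + v"
    using red by (auto simp: reducing_pair_def)
  have "\<forall>x. \<exists>u. u \<in> X1 \<and> x - u \<in> X2" using sum by (metis add_diff_cancel_left')
  then obtain P where P: "\<And>x. P x \<in> X1" "\<And>x. x - P x \<in> X2" by metis
  have uniq: "P x = u" if "u \<in> X1" "x - u \<in> X2" for x u
  proof -
    have "P x - u \<in> X1" by (rule subspace_diff[OF X1.subM P(1) that(1)])
    moreover have "(x - u) - (x - P x) \<in> X2" by (rule subspace_diff[OF X2.subM that(2) P(2)])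
    ultimately have "P x - u \<in> X1 \<inter> X2" by simp
    then show ?thesis using int by auto
  qed
  have add: "P (x + y) = P x + P y" for x y
  proof (rule uniq)
    show "P x + P y \<in> X1" by (rule subspace_add[OF X1.subM P(1) P(1)])
    have "(x - P x) + (y - P y) \<in> X2" by (rule subspace_add[OF X2.subM P(2) P(2)])
    then show "x + y - (P x + P y) \<in> X2" by (simp add: algebra_simps)
  qed
  have scale: "P (c *\<^sub>C x) = c *\<^sub>C P x" for c x
  proof (rule uniq)
    show "c *\<^sub>C P x \<in> X1" by (rule complex_vector.subspace_scale[OF X1.M(1) P(1)])
    have "c *\<^sub>C (x - P x) \<in> X2" by (rule complex_vector.subspace_scale[OF X2.M(1) P(2)])
    then show "c *\<^sub>C x - c *\<^sub>C P x \<in> X2" by (simp add: complex_vector.scale_right_diff_distrib)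
  qed
  define g :: "'a \<times> 'a \<Rightarrow> 'a" where "g p = fst p + snd p" for p
  have g: "bounded_linear g" unfolding g_def
    by (intro bounded_linear_add bounded_linear_fst bounded_linear_snd)
  have gU: "g ` (X1 \<times> X2) = UNIV" using sum by (force simp: g_def)
  obtain C where C: "C > 0" "\<And>y. \<exists>p\<in>X1 \<times> X2. g p = y \<and> norm p \<le> C * norm y"
    using open_mapping[OF g subspace_Times[OF X1.subM X2.subM] closed_Times[OF X1.M(2) X2.M(2)]] gU
    by (metis UNIV_I closed_UNIV)
  have "norm (P x) \<le> norm x * C" for x
  proof -
    obtain u v where uv: "u \<in> X1" "v \<in> X2" "u + v = x" "norm (u, v) \<le> C * norm x"
      using C(2)[of x] by (force simp: g_def)
    have "P x = u" using uv by (intro uniq) auto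
    then show ?thesis using uv(4) norm_fst_le[of u v] by (simp add: mult.commute)
  qed
  then have "bounded_linear P"
    by (intro bounded_linear_intro[of P C] add) (simp_all add: scaleR_scaleC scale)
  then have "bounded_clinear P" by (simp add: bounded_clinear_def scale)
  moreover have "P x = x" if "x \<in> X1" for x
    using that subspace_0[OF X2.subM] by (intro uniq) auto
  moreover have "P x = 0" if "x \<in> X2" for x
    using that subspace_0[OF X1.subM] by (intro uniq) auto
  moreover have "T (P x) = P (T x)" for x
  proof (rule uniq[symmetric])
    show "T (P x) \<in> X1" using P(1) X1.invariant by blast
    have "T (x - P x) \<in> X2" using P(2) X2.invariant by blast
    then show "T x - T (P x) \<in> X2" by (simp add: X1.T.diff)
  qed
  ultimately show ?thesis using P that by blast
qed

text \<open>
  The factorization of \<open>T\<^sup>n - z\<^sup>n\<close> by \<open>T - z\<close>, with the cofactor preserving \<open>U\<close>.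
\<close>

lemma ex_funpow_diff_eq_shift:
  assumes T: "bounded_clinear T" and U: "csubspace U" "T ` U \<subseteq> U" and y: "y \<in> U"
  shows "\<exists>w\<in>U. (T ^^ n) y - z ^ n *\<^sub>C y = shift T z w"
  using y
proof (induction n arbitrary: y)
  case 0
  have "shift T z 0 = 0"
    using linear_0[OF bounded_linear.linear[OF bounded_clinear_bounded_linear[OF T]]] by simp
  then show ?case
    using complex_vector.subspace_0[OF U(1)] by (intro bexI[of _ 0]) (simp_all add: scaleC_one)
next
  case (Suc n)
  have "T y \<in> U" using Suc.prems U(2) by blast
  then obtain w where w: "w \<in> U" "(T ^^ n) (T y) - z ^ n *\<^sub>C T y = shift T z w"
    using Suc.IH by blast
  have Tl: "T (c *\<^sub>C x) = c *\<^sub>C T x" "T (x + x') = T x + T x'" for c x x'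
    using T by (simp_all add: bounded_clinear_def bounded_linear.linear linear_add)
  have "(T ^^ Suc n) y - z ^ Suc n *\<^sub>C y
      = ((T ^^ n) (T y) - z ^ n *\<^sub>C T y) + (z ^ n *\<^sub>C T y - z ^ Suc n *\<^sub>C y)"
    by (simp add: funpow_swap1)
  also have "\<dots> = shift T z (w + z ^ n *\<^sub>C y)"
    unfolding w(2) by (simp add: Tl scaleC_add_right scaleC_scaleC)
  finally show ?case
    using w(1) Suc.prems complex_vector.subspace_add[OF U(1)] complex_vector.subspace_scale[OF U(1)] by blast
qed

lemma funpow_eigenvector:
  assumes T: "bounded_clinear T" and x: "T x = z *\<^sub>C x"
  shows "(T ^^ n) x = z ^ n *\<^sub>C x"
proof (induction n)
  case (Suc n)
  then show ?case using T x by (simp add: bounded_clinear_def scaleC_scaleC mult.commute)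
qed (simp add: scaleC_one)

lemma bij_betw_shift_nilpotent:
  assumes T: "bounded_clinear T" and U: "csubspace U" "T ` U \<subseteq> U"
    and nil: "\<And>x. x \<in> U \<Longrightarrow> (T ^^ q) x = 0" and z: "z \<noteq> 0"
  shows "bij_betw (shift T z) U U"
proof -
  have T': "bounded_clinear (shift T z)" by (rule bounded_clinear_shift[OF T])
  then have lin: "linear (shift T z)" by (simp add: bounded_clinear_def bounded_linear.linear)
  have inv: "shift T z ` U \<subseteq> U"
    using U by (auto intro: complex_vector.subspace_diff complex_vector.subspace_scale)
  have "inj_on (shift T z) U"
  proof (rule inj_onI)
    fix x y assume xy: "x \<in> U" "y \<in> U" "shift T z x = shift T z y"
    have d: "x - y \<in> U" by (rule complex_vector.subspace_diff[OF U(1) xy(1,2)])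
    have "shift T z (x - y) = 0" using linear_diff[OF lin, of x y] xy(3) by simp
    then have "z ^ q *\<^sub>C (x - y) = 0"
      using funpow_eigenvector[OF T, of "x - y" z q] nil[OF d] by simp
    then show "x = y" using z by (simp add: complex_vector.scale_eq_0_iff)
  qed
  moreover have "y \<in> shift T z ` U" if y: "y \<in> U" for y
  proof -
    obtain w where w: "w \<in> U" "(T ^^ q) y - z ^ q *\<^sub>C y = shift T z w"
      using ex_funpow_diff_eq_shift[OF T U y] by blast
    let ?c = "- inverse (z ^ q)"
    have "shift T z (?c *\<^sub>C w) = ?c *\<^sub>C shift T z w" using T' by (simp only: bounded_clinear_def)
    also have "\<dots> = y" unfolding w(2)[symmetric] nil[OF y] using z by (simp add: scaleC_scaleC scaleC_one)
    finally have "y = shift T z (?c *\<^sub>C w)" by (rule sym)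
    then show ?thesis by (rule image_eqI) (rule complex_vector.subspace_scale[OF U(1) w(1)])
  qed
  ultimately show ?thesis using inv by (auto simp: bij_betw_def)
qed

section \<open>Fredholm points near B-Fredholm and pseudo B-Fredholm points\<close>

text \<open>
  On \<open>X1\<close> the Fredholm property is stable, and on \<open>X2\<close> the shifted operator is bijective for \<open>z \<noteq> 0\<close>.
\<close>

lemma fredholm_shift_if_pseudo_b_fredholm:
  fixes T :: "'a::complex_banach \<Rightarrow> 'a"
  assumes T: "bounded_clinear T" and pBF: "pseudo_b_fredholm T"
  shows "\<exists>e>0. \<forall>z. z \<noteq> 0 \<longrightarrow> cmod z < e \<longrightarrow> fredholm (shift T z)"
proof -
  obtain X1 X2 where red: "reducing_pair T X1 X2" and fred: "fredholm_on X1 T"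
    and quasi: "quasinilpotent_on X2 T" using pBF by (auto simp: pseudo_b_fredholm_def)
  note inv = closed_invariant_subspace_reducing_pair[OF T red]
  obtain e where e: "e > 0" "\<And>z. cmod z < e \<Longrightarrow> fredholm_on X1 (shift T z)"
    using closed_invariant_subspace.fredholm_on_shift[OF inv(1) fred] by blast
  have "fredholm (shift T z)" if z: "z \<noteq> 0" "cmod z < e" for z
  proof -
    let ?S = "shift T z"
    have S: "bounded_clinear ?S" by (rule bounded_clinear_shift[OF T])
    interpret S: closed_invariant_subspace ?S UNIV by (rule closed_invariant_subspace_UNIV[OF S])
    interpret S1: closed_invariant_subspace ?S X1 by (rule closed_invariant_subspace.shift_subspace[OF inv(1)])
    interpret S2: closed_invariant_subspace ?S X2 by (rule closed_invariant_subspace.shift_subspace[OF inv(2)])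
    have bij2: "bij_betw ?S X2 X2" using quasi z quasinilpotent_on_iff_bij_betw[OF inv(2)] by blast
    from fredholm_on_def[of X1 ?S] e(2)[OF z(2)] obtain N B where N: "finite N" "X1 \<inter> kernel ?S = cspan N"
      and B: "finite B" "X1 = cspan (?S ` X1 \<union> B)" by blast
    obtain P where P: "bounded_clinear P" "\<And>x. P x \<in> X1" "\<And>x. x - P x \<in> X2"
      "\<And>x. x \<in> X1 \<Longrightarrow> P x = x" "\<And>x. x \<in> X2 \<Longrightarrow> P x = 0" "\<And>x. ?S (P x) = P (?S x)"
      using reducing_pair_projection[OF S reducing_pair_shift[OF red]] by blast
    have P0: "P 0 = 0" using linear_0[OF bounded_linear.linear[OF bounded_clinear_bounded_linear[OF P(1)]]] .
    have "x \<in> X1" if x: "?S x = 0" for x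
    proof -
      have "?S (x - P x) = 0" using x P(6)[of x] P0 S.T.diff[of x "P x"] by simp
      then have "x - P x \<in> X2 \<inter> kernel ?S" using P(3) by (simp add: kernel_def)
      then have "x = P x" using bij2 S2.bij_betw_iff_trivial_kernel by auto
      then show ?thesis using P(2) by metis
    qed
    then have "UNIV \<inter> kernel ?S = cspan N" unfolding N(2)[symmetric] by (auto simp: kernel_def)
    moreover have "UNIV = cspan (range ?S \<union> B)"
      unfolding S.finite_codim_iff_decomp
    proof (intro conjI ballI)
      fix y
      obtain x v where x: "x \<in> X1" "v \<in> cspan B" "P y = ?S x + v"
        using P(2) B(2) S1.finite_codim_iff_decomp by blast
      obtain w where w: "y - P y = ?S w" using bij2 P(3) unfolding bij_betw_def by blast
      have "y = P y + ?S w" unfolding w[symmetric] by simp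
      also have "\<dots> = ?S (x + w) + v" unfolding x(3) S.T.add by simp
      finally show "\<exists>x\<in>UNIV. \<exists>v\<in>cspan B. y = ?S x + v" using x(2) by blast
    qed simp
    ultimately show ?thesis unfolding fredholm_on_def using N(1) B(1) by blast
  qed
  then show ?thesis using e(1) by blast
qed

text \<open>
  For \<open>z \<noteq> 0\<close>, the factorization of \<open>T\<^sup>n - z\<^sup>n\<close> shows that the
  kernel of \<open>T - z\<close> lies in \<open>M = R(T\<^sup>n)\<close> and that the whole space is \<open>R(T - z) + M\<close>. So it suffices that
  the restriction of \<open>T - z\<close> to \<open>M\<close> is Fredholm.
\<close>

lemma fredholm_shift_if_b_fredholm:
  fixes T :: "'a::complex_banach \<Rightarrow> 'a"
  assumes T: "bounded_clinear T" and BF: "b_fredholm T"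
  shows "\<exists>e>0. \<forall>z. z \<noteq> 0 \<longrightarrow> cmod z < e \<longrightarrow> fredholm (shift T z)"
proof -
  obtain n where cl: "closed (range (T ^^ n))" and fred: "fredholm_on (range (T ^^ n)) T"
    using BF by (auto simp: b_fredholm_def)
  let ?M = "range (T ^^ n)"
  interpret T: closed_invariant_subspace T UNIV by (rule closed_invariant_subspace_UNIV[OF T])
  interpret M: closed_invariant_subspace T ?M
    using T cl T.csubspace_funpow_image T.invariant_funpow_image by unfold_locales
  obtain e where e: "e > 0" "\<And>z. cmod z < e \<Longrightarrow> fredholm_on ?M (shift T z)"
    using M.fredholm_on_shift[OF fred] by blast
  have "fredholm (shift T z)" if z: "z \<noteq> 0" "cmod z < e" for z
  proof -
    let ?S = "shift T z"
    interpret S: closed_invariant_subspace ?S UNIV by (rule T.shift_subspace)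
    interpret S1: closed_invariant_subspace ?S ?M by (rule M.shift_subspace)
    from fredholm_on_def[of ?M ?S] e(2)[OF z(2)] obtain N B where N: "finite N" "?M \<inter> kernel ?S = cspan N"
      and B: "finite B" "?M = cspan (?S ` ?M \<union> B)" by blast
    have "x \<in> ?M" if x: "?S x = 0" for x
    proof -
      have "(T ^^ n) (inverse (z ^ n) *\<^sub>C x) = x"
        using funpow_eigenvector[OF T, of x z n] x z(1) by (simp add: T.funpow_scaleC scaleC_scaleC scaleC_one)
      then show ?thesis by (metis rangeI)
    qed
    then have "UNIV \<inter> kernel ?S = cspan N" unfolding N(2)[symmetric] by (auto simp: kernel_def)
    moreover have "UNIV = cspan (range ?S \<union> B)"
      unfolding S.finite_codim_iff_decomp
    proof (intro conjI ballI)
      fix y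
      obtain w where w: "(T ^^ n) y - z ^ n *\<^sub>C y = ?S w"
        using ex_funpow_diff_eq_shift[OF T complex_vector.subspace_UNIV, of y n z] by blast
      obtain x v where x: "v \<in> cspan B" "(T ^^ n) y = ?S x + v"
        using B(2) S1.finite_codim_iff_decomp by blast
      let ?c = "inverse (z ^ n)"
      have "?S x + v - ?S w = z ^ n *\<^sub>C y" unfolding x(2)[symmetric] w[symmetric] by simp
      then have "?c *\<^sub>C z ^ n *\<^sub>C y = ?c *\<^sub>C (?S (x - w) + v)" unfolding S.T.diff by (simp add: algebra_simps)
      then have "y = ?S (?c *\<^sub>C (x - w)) + ?c *\<^sub>C v"
        unfolding S.T_scaleC using z(1) by (simp add: scaleC_add_right scaleC_scaleC scaleC_one)
      then show "\<exists>x\<in>UNIV. \<exists>v\<in>cspan B. y = ?S x + v"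
        using complex_vector.span_scale[OF x(1)] by blast
    qed simp
    ultimately show ?thesis unfolding fredholm_on_def using N(1) B(1) by blast
  qed
  then show ?thesis using e(1) by blast
qed

lemma in_closure_if_punctured_ball:
  assumes "e > 0" "\<And>z. z \<noteq> 0 \<Longrightarrow> cmod z < e \<Longrightarrow> l + z \<in> A"
  shows "l \<in> closure A"
  unfolding closure_approachable
proof (intro allI impI)
  fix d :: real assume d: "d > 0"
  let ?z = "complex_of_real (min d e / 2)"
  have "?z \<noteq> 0" "cmod ?z < e" "cmod ?z < d" using d assms(1) by (auto simp: min_def)
  then show "\<exists>y\<in>A. dist y l < d" using assms(2)[of ?z] by (intro bexI[of _ "l + ?z"]) (auto simp: dist_norm)
qed

lemma in_closure_complement_essential_spectrum:
  fixes T :: "'a::complex_banach \<Rightarrow> 'a"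
  assumes T: "bounded_clinear T" and l: "l \<notin> \<sigma>_BF T \<or> l \<notin> \<sigma>_pBF T"
  shows "l \<in> closure (- \<sigma>_e T)"
proof -
  have "\<exists>e>0. \<forall>z. z \<noteq> 0 \<longrightarrow> cmod z < e \<longrightarrow> fredholm (shift (shift T l) z)"
    using l fredholm_shift_if_pseudo_b_fredholm fredholm_shift_if_b_fredholm bounded_clinear_shift[OF T]
    by (auto simp: \<sigma>_BF_def \<sigma>_pBF_def)
  then obtain e where "e > 0" "\<And>z. z \<noteq> 0 \<Longrightarrow> cmod z < e \<Longrightarrow> fredholm (shift T (l + z))"
    unfolding shift_shift by blast
  then show ?thesis by (intro in_closure_if_punctured_ball[of e]) (auto simp: \<sigma>_e_def)
qed

section \<open>Drazin and generalized Drazin invertibility\<close>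

lemma in_closure_resolvent_set_if_gen_drazin_invertible:
  fixes T :: "'a::complex_banach \<Rightarrow> 'a"
  assumes T: "bounded_clinear T" and l: "l \<notin> \<sigma>_gD T"
  shows "l \<in> closure (resolvent_set T)"
proof -
  let ?A = "shift T l"
  have A: "bounded_clinear ?A" by (rule bounded_clinear_shift[OF T])
  obtain X1 X2 where red: "reducing_pair ?A X1 X2" and inv1: "invertible_on X1 ?A"
    and quasi: "quasinilpotent_on X2 ?A" using l by (auto simp: \<sigma>_gD_def gen_drazin_invertible_def)
  note inv = closed_invariant_subspace_reducing_pair[OF A red]
  have "bij_betw ?A X1 X1" using inv1 closed_invariant_subspace.invertible_on_iff_bij_betw[OF inv(1)] by blast
  then obtain e where e: "e > 0" "\<And>z. cmod z < e \<Longrightarrow> bij_betw (shift ?A z) X1 X1"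
    using closed_invariant_subspace.bij_betw_shift_small[OF inv(1)] by blast
  have bij: "bij (shift ?A z)" if "z \<noteq> 0" "cmod z < e" for z
    using bij_iff_bij_betw_reducing_pair[OF bounded_clinear_shift[OF A] reducing_pair_shift[OF red]]
      e(2) quasi quasinilpotent_on_iff_bij_betw[OF inv(2)] that by blast
  show ?thesis
    by (rule in_closure_if_punctured_ball[OF e(1)])
      (use bij in \<open>simp add: resolvent_set_def shift_shift[symmetric]\<close>)
qed

text \<open>
  Fitting's decomposition \<open>X1 = T\<^sup>q X1 \<oplus> N(T\<^sup>q)\<close>, with \<open>X2\<close> added to the second summand. Describing that
  summand as the kernel of \<open>T\<^sup>q P\<close> for the projection \<open>P\<close> onto \<open>X1\<close> makes it visibly closed.
\<close>

lemma reducing_pair_fitting: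
  fixes T :: "'a::complex_banach \<Rightarrow> 'a"
  assumes T: "bounded_clinear T" and red: "reducing_pair T X1 X2"
    and P: "bounded_clinear P" "\<And>x. P x \<in> X1" "\<And>x. x \<in> X1 \<Longrightarrow> P x = x" "\<And>x. T (P x) = P (T x)"
    and bij: "bij_betw T ((T ^^ q) ` X1) ((T ^^ q) ` X1)" and cl: "closed ((T ^^ q) ` X1)"
  shows "reducing_pair T ((T ^^ q) ` X1) {x. (T ^^ q) (P x) = 0}"
proof -
  interpret X1: closed_invariant_subspace T X1 by (rule closed_invariant_subspace_reducing_pair[OF T red])
  let ?R = "(T ^^ q) ` X1"
  let ?g = "\<lambda>x. (T ^^ q) (P x)"
  have g: "bounded_clinear ?g" by (rule bounded_clinear_compose[OF X1.funpow_linear P(1)])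
  have K: "{x. ?g x = 0} = kernel ?g" by (simp add: kernel_def)
  have bijq: "bij_betw (T ^^ q) ?R ?R" by (rule bij_betw_funpow[OF bij])
  have RX: "?R \<subseteq> X1" using X1.funpow_in by blast
  have zero: "0 \<in> ?R" by (rule complex_vector.subspace_0[OF X1.csubspace_funpow_image])
  have "x = 0" if x: "x \<in> ?R" "?g x = 0" for x
  proof -
    have "(T ^^ q) x = (T ^^ q) 0" using x RX P(3)[of x] X1.funpow_zero by auto
    then show ?thesis using bij_betw_imp_inj_on[OF bijq] x(1) zero by (meson inj_onD)
  qed
  moreover have "?g 0 = 0" using linear_0[OF bounded_linear.linear[OF bounded_clinear_bounded_linear[OF g]]] .
  ultimately have "?R \<inter> {x. ?g x = 0} = {0}" using zero by auto
  moreover have "\<exists>u\<in>?R. \<exists>v\<in>{x. ?g x = 0}. x = u + v" for x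
  proof -
    have "?g x \<in> ?R" using P(2) by blast
    then obtain w where w: "w \<in> ?R" "?g x = (T ^^ q) w" using bijq unfolding bij_betw_def by blast
    have "?g (x - w) = ?g x - ?g w"
      using linear_diff[OF bounded_linear.linear[OF bounded_clinear_bounded_linear[OF g]]] .
    also have "\<dots> = 0" using w RX P(3)[of w] by auto
    finally show ?thesis using w(1) by (intro bexI[of _ w] bexI[of _ "x - w"]) auto
  qed
  moreover have "T ` {x. ?g x = 0} \<subseteq> {x. ?g x = 0}"
    using X1.T.zero by (auto simp: P(4)[symmetric] X1.funpow_Suc_in[symmetric])
  ultimately show ?thesis
    unfolding reducing_pair_def
    using X1.csubspace_funpow_image cl X1.invariant_funpow_image csubspace_kernel[OF g] closed_kernel[OF g]
    by (simp add: K)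
qed

text \<open>
  On the second summand of Fitting's decomposition \<open>T\<close> is the sum of a nilpotent part in \<open>X1\<close> and the
  quasi-nilpotent part in \<open>X2\<close>.
\<close>

lemma gen_drazin_invertible_if_fitting:
  fixes T :: "'a::complex_banach \<Rightarrow> 'a"
  assumes T: "bounded_clinear T" and red: "reducing_pair T X1 X2" and quasi: "quasinilpotent_on X2 T"
    and bij: "bij_betw T ((T ^^ q) ` X1) ((T ^^ q) ` X1)" and cl: "closed ((T ^^ q) ` X1)"
  shows "gen_drazin_invertible T"
proof -
  note inv = closed_invariant_subspace_reducing_pair[OF T red]
  interpret X1: closed_invariant_subspace T X1 by (rule inv)
  interpret X2: closed_invariant_subspace T X2 by (rule inv)
  obtain P where P: "bounded_clinear P" "\<And>x. P x \<in> X1" "\<And>x. x - P x \<in> X2"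
    "\<And>x. x \<in> X1 \<Longrightarrow> P x = x" "\<And>x. x \<in> X2 \<Longrightarrow> P x = 0" "\<And>x. T (P x) = P (T x)"
    using reducing_pair_projection[OF T red] by blast
  interpret P: bounded_linear P by (rule bounded_clinear_bounded_linear[OF P(1)])
  let ?R = "(T ^^ q) ` X1" and ?K = "{x. (T ^^ q) (P x) = 0}"
  have red': "reducing_pair T ?R ?K" by (rule reducing_pair_fitting[OF T red P(1,2,4,6) bij cl])
  note inv' = closed_invariant_subspace_reducing_pair[OF T red']
  let ?U = "X1 \<inter> kernel (T ^^ q)"
  have U: "csubspace ?U" by (intro complex_vector.subspace_inter X1.M csubspace_kernel X1.funpow_linear)
  have TU: "T ` ?U \<subseteq> ?U"
    using X1.invariant X1.T.zero by (auto simp: kernel_def X1.funpow_Suc_in[symmetric])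
  have "bij_betw (shift T z) ?K ?K" if z: "z \<noteq> 0" for z
  proof -
    let ?S = "shift T z"
    interpret S: closed_invariant_subspace ?S ?K by (rule closed_invariant_subspace.shift_subspace[OF inv'(2)])
    interpret S2: closed_invariant_subspace ?S X2 by (rule X2.shift_subspace)
    have bijU: "bij_betw ?S ?U ?U"
      by (rule bij_betw_shift_nilpotent[OF T U TU _ z, of q]) (simp add: kernel_def)
    have bij2: "bij_betw ?S X2 X2" using quasi z quasinilpotent_on_iff_bij_betw[OF inv(2)] by blast
    have PS: "?S (P x) = P (?S x)" for x
      using P(1) by (simp add: P(6) P.diff bounded_clinear_def)
    have "x = 0" if x: "x \<in> ?K" "?S x = 0" for x
    proof -
      have "P x \<in> ?U" using x(1) P(2) by (simp add: kernel_def)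
      moreover have "?S (P x) = ?S 0" unfolding PS x(2) P.zero S.T.zero ..
      moreover have "0 \<in> ?U" by (rule complex_vector.subspace_0[OF U])
      ultimately have Px: "P x = 0" using bijU unfolding bij_betw_def by (meson inj_onD)
      then have "x \<in> X2 \<inter> kernel ?S" using P(3)[of x] x(2) by (simp add: kernel_def)
      then show ?thesis using bij2 S2.bij_betw_iff_trivial_kernel by blast
    qed
    moreover have "\<exists>x\<in>?K. \<exists>v\<in>cspan {}. y = ?S x + v" if y: "y \<in> ?K" for y
    proof -
      have "P y \<in> ?U" using y P(2) by (simp add: kernel_def)
      then obtain u where u: "u \<in> ?U" "P y = ?S u" using bijU unfolding bij_betw_def by blast
      obtain w where w: "w \<in> X2" "y - P y = ?S w" using bij2 P(3) unfolding bij_betw_def by blast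
      have "P (u + w) = u" using u(1) w(1) P(4,5) by (simp add: P.add)
      then have "u + w \<in> ?K" using u(1) by (simp add: kernel_def)
      moreover have "y = ?S (u + w)" unfolding S.T.add u(2)[symmetric] w(2)[symmetric] by simp
      ultimately show ?thesis by (intro bexI[of _ "u + w"] bexI[of _ 0]) auto
    qed
    ultimately show ?thesis
      unfolding S.bij_betw_iff_trivial_kernel S.finite_codim_iff_decomp by (auto simp: kernel_def)
  qed
  then have "quasinilpotent_on ?K T" using quasinilpotent_on_iff_bij_betw[OF inv'(2)] by blast
  moreover have "invertible_on ?R T"
    using bij closed_invariant_subspace.invertible_on_iff_bij_betw[OF inv'(1)] by blast
  ultimately show ?thesis using red' unfolding gen_drazin_invertible_def by blast
qed

lemma reducing_pair_UNIV_zero: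
  fixes T :: "'a::complex_banach \<Rightarrow> 'a"
  assumes T: "bounded_clinear T"
  shows "reducing_pair T UNIV {0}" "quasinilpotent_on {0} T"
proof -
  have T0: "T 0 = 0" using linear_0[OF bounded_linear.linear[OF bounded_clinear_bounded_linear[OF T]]] .
  show red: "reducing_pair T UNIV {0}" by (auto simp: reducing_pair_def T0)
  show "quasinilpotent_on {0} T"
    unfolding quasinilpotent_on_iff_bij_betw[OF closed_invariant_subspace_reducing_pair(2)[OF T red]]
    by (auto simp: bij_betw_def T0)
qed

text \<open>
  The range of \<open>T\<^sup>k\<close> is the range of the idempotent \<open>S T\<close>, thus closed, and \<open>S\<close> inverts \<open>T\<close> on it.
  Conversely, \<open>S\<close> is the projection onto the range of \<open>T\<^sup>q\<close> along the kernel of \<open>T\<^sup>q\<close>, followed by the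
  inverse of \<open>T\<close> on that range.
\<close>

lemma drazin_invertible_iff:
  fixes T :: "'a::complex_banach \<Rightarrow> 'a"
  assumes T: "bounded_clinear T"
  shows "drazin_invertible T \<longleftrightarrow>
    (\<exists>q. bij_betw T (range (T ^^ q)) (range (T ^^ q)) \<and> closed (range (T ^^ q)))"
proof
  assume "drazin_invertible T"
  then obtain k S where S: "bounded_clinear S" and comm: "\<And>x. S (T x) = T (S x)"
    and k: "\<And>x. (T ^^ (k + 1)) (S x) = (T ^^ k) x"
    unfolding drazin_invertible_def by (metis comp_apply)
  have commn: "S ((T ^^ n) x) = (T ^^ n) (S x)" for n x
    by (induction n) (simp_all add: comm)
  have STk: "S (T ((T ^^ k) x)) = (T ^^ k) x" for x
    using k[of x] commn[of "k + 1" x] by simp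
  have "bij_betw T (range (T ^^ k)) (range (T ^^ k))"
  proof (rule bij_betw_byWitness[of _ S])
    show "\<forall>a\<in>range (T ^^ k). S (T a) = a" using STk by blast
    then show "\<forall>a\<in>range (T ^^ k). T (S a) = a" by (simp only: comm)
    show "T ` range (T ^^ k) \<subseteq> range (T ^^ k)" by (auto simp: funpow_swap1)
    show "S ` range (T ^^ k) \<subseteq> range (T ^^ k)" by (auto simp: commn)
  qed
  moreover have "range (T ^^ k) = kernel (\<lambda>y. y - S (T y))"
  proof
    show "range (T ^^ k) \<subseteq> kernel (\<lambda>y. y - S (T y))" by (auto simp: kernel_def STk)
    have "y \<in> range (T ^^ n)" if "S (T y) = y" for n y
      using that
    proof (induction n arbitrary: y)
      case (Suc n)
      have "S (T (S y)) = S y" using Suc.prems comm by simp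
      then obtain x where "S y = (T ^^ n) x" using Suc.IH by blast
      then have "y = (T ^^ Suc n) x" using Suc.prems comm by simp
      then show ?case by blast
    qed simp
    then show "kernel (\<lambda>y. y - S (T y)) \<subseteq> range (T ^^ k)" by (auto simp: kernel_def)
  qed
  moreover have "bounded_clinear (\<lambda>y. y - S (T y))"
    using bounded_clinear_compose[OF S T] bounded_clinear_ident
    by (simp add: bounded_clinear_def bounded_linear_sub complex_vector.scale_right_diff_distrib)
  ultimately show "\<exists>q. bij_betw T (range (T ^^ q)) (range (T ^^ q)) \<and> closed (range (T ^^ q))"
    using closed_kernel by metis
next
  assume "\<exists>q. bij_betw T (range (T ^^ q)) (range (T ^^ q)) \<and> closed (range (T ^^ q))"
  then obtain q where bij: "bij_betw T (range (T ^^ q)) (range (T ^^ q))" and cl: "closed (range (T ^^ q))" by blast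
  let ?R = "range (T ^^ q)" and ?K = "{x. (T ^^ q) x = 0}"
  have red: "reducing_pair T ?R ?K"
    by (rule reducing_pair_fitting[OF T reducing_pair_UNIV_zero(1)[OF T] bounded_clinear_ident _ _ _ bij cl]) simp_all
  obtain P where P: "bounded_clinear P" "\<And>x. P x \<in> ?R" "\<And>x. x - P x \<in> ?K"
    "\<And>x. x \<in> ?R \<Longrightarrow> P x = x" "\<And>x. x \<in> ?K \<Longrightarrow> P x = 0" "\<And>x. T (P x) = P (T x)"
    using reducing_pair_projection[OF T red] by blast
  interpret P: bounded_linear P by (rule bounded_clinear_bounded_linear[OF P(1)])
  interpret R: closed_invariant_subspace T ?R by (rule closed_invariant_subspace_reducing_pair[OF T red])
  obtain S0 where S0: "bounded_clinear_on ?R S0" "\<And>x. x \<in> ?R \<Longrightarrow> S0 (T x) = x" "\<And>x. x \<in> ?R \<Longrightarrow> T (S0 x) = x"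
    using bij R.invertible_on_iff_bij_betw unfolding invertible_on_def by blast
  define S where "S x = S0 (P x)" for x
  have scale: "S (c *\<^sub>C x) = c *\<^sub>C S x" for c x
  proof -
    have "P (c *\<^sub>C x) = c *\<^sub>C P x" using P(1) by (simp add: bounded_clinear_def)
    moreover have "S0 (c *\<^sub>C P x) = c *\<^sub>C S0 (P x)" using S0(1) P(2) unfolding bounded_clinear_on_def by blast
    ultimately show ?thesis by (simp only: S_def)
  qed
  have S0_add: "S0 (x + y) = S0 x + S0 y" if "x \<in> ?R" "y \<in> ?R" for x y
    using S0(1)[unfolded bounded_clinear_on_def, THEN conjunct2, THEN conjunct1] that by (elim ballE) auto
  obtain K where K: "\<And>x. x \<in> ?R \<Longrightarrow> norm (S0 x) \<le> K * norm x" using S0(1) unfolding bounded_clinear_on_def by blast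
  obtain L where L: "\<And>x. norm (P x) \<le> norm x * L" using P.bounded by blast
  have "bounded_linear S"
  proof (rule bounded_linear_intro[of _ "\<bar>K\<bar> * L"])
    show "S (x + y) = S x + S y" for x y
      unfolding S_def P.add by (rule S0_add[OF P(2) P(2)])
    show "S (r *\<^sub>R x) = r *\<^sub>R S x" for r x by (simp add: scaleR_scaleC scale)
    fix x
    have "norm (S x) \<le> K * norm (P x)" unfolding S_def by (rule K[OF P(2)])
    also have "\<dots> \<le> \<bar>K\<bar> * norm (P x)" by (intro mult_right_mono) auto
    also have "\<dots> \<le> \<bar>K\<bar> * (norm x * L)" by (intro mult_left_mono L) auto
    finally show "norm (S x) \<le> norm x * (\<bar>K\<bar> * L)" by (simp add: mult_ac)
  qed
  then have S: "bounded_clinear S" by (simp add: bounded_clinear_def scale)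
  have ST: "S (T x) = P x" for x by (simp add: S_def P(6)[symmetric] S0(2) P(2))
  have TS: "T (S x) = P x" for x by (simp add: S_def S0(3) P(2))
  have TqP: "(T ^^ q) (P x) = (T ^^ q) x" for x
    using P(3)[of x] R.funpow_diff[of q x "P x"] by simp
  have "(T ^^ (Suc q + 1)) (S x) = T ((T ^^ q) (T (S x)))" for x
    by (simp add: funpow_swap1)
  then have "(T ^^ (Suc q + 1)) (S x) = (T ^^ Suc q) x" for x
    by (simp only: TS TqP) simp
  moreover have "S (S (T x)) = S x" for x unfolding ST by (simp add: S_def P(2,4))
  ultimately show "drazin_invertible T"
    unfolding drazin_invertible_def using S ST TS
    by (intro exI[of _ "Suc q"] exI[of _ S]) (simp add: fun_eq_iff numeral_2_eq_2)
qed

lemma gen_drazin_invertible_if_drazin_invertible: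
  fixes T :: "'a::complex_banach \<Rightarrow> 'a"
  assumes T: "bounded_clinear T" and "drazin_invertible T"
  shows "gen_drazin_invertible T"
  using assms(2) gen_drazin_invertible_if_fitting[OF T reducing_pair_UNIV_zero[OF T]]
  unfolding drazin_invertible_iff[OF T] by blast

lemma fredholm_on_if_bij_betw:
  assumes "closed_invariant_subspace T M" "bij_betw T M M"
  shows "fredholm_on M T"
proof -
  interpret closed_invariant_subspace T M by (rule assms)
  have "M \<inter> kernel T = cspan {}"
    using assms(2) bij_betw_iff_trivial_kernel subspace_0[OF subM] T.zero by (auto simp: kernel_def)
  moreover have "M = cspan (T ` M \<union> {})" using assms(2) bij_betw_iff_trivial_kernel by blast
  ultimately show ?thesis unfolding fredholm_on_def by blast
qed

lemma b_fredholm_if_drazin_invertible: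
  fixes T :: "'a::complex_banach \<Rightarrow> 'a"
  assumes T: "bounded_clinear T" and D: "drazin_invertible T"
  shows "b_fredholm T"
proof -
  obtain q where q: "bij_betw T (range (T ^^ q)) (range (T ^^ q))" "closed (range (T ^^ q))"
    using D drazin_invertible_iff[OF T] by blast
  interpret T: closed_invariant_subspace T UNIV by (rule closed_invariant_subspace_UNIV[OF T])
  have "closed_invariant_subspace T (range (T ^^ q))"
    using T q(2) T.csubspace_funpow_image T.invariant_funpow_image by unfold_locales
  then show ?thesis unfolding b_fredholm_def using fredholm_on_if_bij_betw q by blast
qed

lemma pseudo_b_fredholm_if_gen_drazin_invertible:
  fixes T :: "'a::complex_banach \<Rightarrow> 'a"
  assumes T: "bounded_clinear T" and D: "gen_drazin_invertible T"
  shows "pseudo_b_fredholm T"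
proof -
  obtain X1 X2 where red: "reducing_pair T X1 X2" and inv1: "invertible_on X1 T"
    and quasi: "quasinilpotent_on X2 T" using D by (auto simp: gen_drazin_invertible_def)
  note inv = closed_invariant_subspace_reducing_pair(1)[OF T red]
  have "fredholm_on X1 T"
    using inv1 closed_invariant_subspace.invertible_on_iff_bij_betw[OF inv] fredholm_on_if_bij_betw[OF inv] by blast
  then show ?thesis unfolding pseudo_b_fredholm_def using red quasi by blast
qed

lemma ascent_finite_iff: "ascent T < \<infinity> \<longleftrightarrow> (\<exists>p. kernel (T ^^ p) = kernel (T ^^ (p + 1)))"
proof
  assume fin: "ascent T < \<infinity>"
  show "\<exists>p. kernel (T ^^ p) = kernel (T ^^ (p + 1))"
  proof (rule ccontr)
    assume "\<not> ?thesis"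
    then have "{enat p | p. kernel (T ^^ p) = kernel (T ^^ (p + 1))} = {}" by blast
    then show False using fin unfolding ascent_def by (simp only: Inf_enat_def if_True) simp
  qed
next
  assume "\<exists>p. kernel (T ^^ p) = kernel (T ^^ (p + 1))"
  then obtain p where "kernel (T ^^ p) = kernel (T ^^ (p + 1))" by blast
  then have "ascent T \<le> enat p" unfolding ascent_def by (intro Inf_lower) blast
  then show "ascent T < \<infinity>" using enat_ord_simps(4) order_le_less_trans by blast
qed

lemma descent_finite_iff: "descent T < \<infinity> \<longleftrightarrow> (\<exists>q. range (T ^^ q) = range (T ^^ (q + 1)))"
proof
  assume fin: "descent T < \<infinity>"
  show "\<exists>q. range (T ^^ q) = range (T ^^ (q + 1))"
  proof (rule ccontr)
    assume "\<not> ?thesis"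
    then have "{enat q | q. range (T ^^ q) = range (T ^^ (q + 1))} = {}" by blast
    then show False using fin unfolding descent_def by (simp only: Inf_enat_def if_True) simp
  qed
next
  assume "\<exists>q. range (T ^^ q) = range (T ^^ (q + 1))"
  then obtain q where "range (T ^^ q) = range (T ^^ (q + 1))" by blast
  then have "descent T \<le> enat q" unfolding descent_def by (intro Inf_lower) blast
  then show "descent T < \<infinity>" using enat_ord_simps(4) order_le_less_trans by blast
qed

lemma browder_iff:
  fixes T :: "'a::complex_banach \<Rightarrow> 'a"
  assumes T: "bounded_clinear T"
  shows "browder T \<longleftrightarrow> fredholm T \<and> drazin_invertible T"
proof -
  interpret T: closed_invariant_subspace T UNIV by (rule closed_invariant_subspace_UNIV[OF T])
  have "drazin_invertible T" if br: "browder T"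
  proof -
    have fred: "fredholm T" using br by (simp add: browder_def)
    obtain p n where p: "kernel (T ^^ p) = kernel (T ^^ (p + 1))" and n: "range (T ^^ n) = range (T ^^ (n + 1))"
      using br unfolding browder_def ascent_finite_iff descent_finite_iff by blast
    have "\<exists>q. bij_betw T ((T ^^ q) ` UNIV) ((T ^^ q) ` UNIV) \<and> closed ((T ^^ q) ` UNIV)"
    proof (rule T.bij_betw_funpow_image[OF fred])
      fix x assume "x \<in> range (T ^^ p)" "T x = 0"
      then obtain y where y: "x = (T ^^ p) y" by blast
      then have "y \<in> kernel (T ^^ (p + 1))" using \<open>T x = 0\<close> by (simp add: kernel_def)
      then show "x = 0" unfolding p[symmetric] by (simp add: y kernel_def)
    next
      fix y
      obtain x where "(T ^^ n) y = (T ^^ (n + 1)) x" using n by (metis rangeE rangeI)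
      then have "(T ^^ n) (y - T x) = 0" by (simp add: T.funpow_diff funpow_swap1)
      then show "\<exists>x\<in>UNIV. \<exists>v\<in>UNIV. (T ^^ n) v = 0 \<and> y = T x + v"
        by (intro bexI[of _ x] bexI[of _ "y - T x"]) auto
    qed
    then show ?thesis unfolding drazin_invertible_iff[OF T] .
  qed
  moreover have "browder T" if fred: "fredholm T" and D: "drazin_invertible T"
  proof -
    obtain q where bij: "bij_betw T (range (T ^^ q)) (range (T ^^ q))" using D drazin_invertible_iff[OF T] by blast
    have "kernel (T ^^ (q + 1)) \<subseteq> kernel (T ^^ q)"
    proof
      fix x assume "x \<in> kernel (T ^^ (q + 1))"
      then have "T ((T ^^ q) x) = T ((T ^^ q) 0)" by (simp add: kernel_def T.funpow_zero T.T.zero)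
      then have "(T ^^ q) x = (T ^^ q) 0" using bij unfolding bij_betw_def by (meson inj_onD rangeI)
      then show "x \<in> kernel (T ^^ q)" by (simp add: kernel_def T.funpow_zero)
    qed
    moreover have "kernel (T ^^ q) \<subseteq> kernel (T ^^ (q + 1))" by (auto simp: kernel_def T.T.zero)
    moreover have "range (T ^^ q) = range (T ^^ (q + 1))"
    proof -
      have "range (T ^^ (q + 1)) = T ` range (T ^^ q)" by (simp add: image_image)
      then show ?thesis using bij unfolding bij_betw_def by (simp only:)
    qed
    ultimately show ?thesis
      using fred unfolding browder_def ascent_finite_iff descent_finite_iff by (metis subset_antisym)
  qed
  ultimately show ?thesis by (auto simp: browder_def)
qed

section \<open>Points in the closure of the resolvent set\<close>

text \<open>
  \<open>T - z\<close> commutes with \<open>T\<^sup>n\<close>, so a bijective \<open>T - z\<close> also maps the range of \<open>T\<^sup>n\<close> onto itself.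
\<close>

lemma drazin_invertible_if_b_fredholm:
  fixes T :: "'a::complex_banach \<Rightarrow> 'a"
  assumes T: "bounded_clinear T" and l: "l \<in> closure (resolvent_set T)" and BF: "b_fredholm (shift T l)"
  shows "drazin_invertible (shift T l)"
proof -
  let ?A = "shift T l"
  have A: "bounded_clinear ?A" by (rule bounded_clinear_shift[OF T])
  obtain n where cl: "closed (range (?A ^^ n))" and fred: "fredholm_on (range (?A ^^ n)) ?A"
    using BF by (auto simp: b_fredholm_def)
  let ?M = "range (?A ^^ n)"
  interpret A: closed_invariant_subspace ?A UNIV by (rule closed_invariant_subspace_UNIV[OF A])
  interpret M: closed_invariant_subspace ?A ?M
    using A cl A.csubspace_funpow_image A.invariant_funpow_image by unfold_locales
  have bij_M: "bij_betw (shift ?A z) ?M ?M" if bij: "bij (shift ?A z)" for z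
  proof -
    have "shift ?A z ((?A ^^ n) x) = (?A ^^ n) (shift ?A z x)" for x
      using A.funpow_diff[of n "?A x" "z *\<^sub>C x"] by (simp only: A.funpow_scaleC A.funpow_Suc_in)
    then have "shift ?A z ` ?M = (?A ^^ n) ` range (shift ?A z)"
      by (simp only: image_image)
    also have "\<dots> = ?M" using bij by (simp only: bij_def)
    finally show ?thesis using bij unfolding bij_betw_def by (meson inj_on_subset subset_UNIV)
  qed
  have "\<exists>q. bij_betw ?A ((?A ^^ q) ` ?M) ((?A ^^ q) ` ?M) \<and> closed ((?A ^^ q) ` ?M)"
  proof (rule M.bij_betw_funpow_image_if_near_bij[OF fred])
    fix e :: real assume "e > 0"
    then show "\<exists>z. cmod z < e \<and> bij_betw (shift ?A z) ?M ?M"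
      using l bij_M unfolding closure_resolvent_set_iff by blast
  qed
  then obtain q where q: "bij_betw ?A ((?A ^^ q) ` ?M) ((?A ^^ q) ` ?M)" "closed ((?A ^^ q) ` ?M)" by blast
  have "(?A ^^ q) ` ?M = range (?A ^^ (q + n))" by (simp only: funpow_add image_comp)
  then show ?thesis using q unfolding drazin_invertible_iff[OF A] by metis
qed

lemma gen_drazin_invertible_if_pseudo_b_fredholm:
  fixes T :: "'a::complex_banach \<Rightarrow> 'a"
  assumes T: "bounded_clinear T" and l: "l \<in> closure (resolvent_set T)" and pBF: "pseudo_b_fredholm (shift T l)"
  shows "gen_drazin_invertible (shift T l)"
proof -
  let ?A = "shift T l"
  have A: "bounded_clinear ?A" by (rule bounded_clinear_shift[OF T])
  obtain X1 X2 where red: "reducing_pair ?A X1 X2" and fred: "fredholm_on X1 ?A"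
    and quasi: "quasinilpotent_on X2 ?A" using pBF by (auto simp: pseudo_b_fredholm_def)
  interpret X1: closed_invariant_subspace ?A X1 by (rule closed_invariant_subspace_reducing_pair[OF A red])
  have "\<exists>q. bij_betw ?A ((?A ^^ q) ` X1) ((?A ^^ q) ` X1) \<and> closed ((?A ^^ q) ` X1)"
  proof (rule X1.bij_betw_funpow_image_if_near_bij[OF fred])
    fix e :: real assume "e > 0"
    then obtain z where "cmod z < e" "bij (shift ?A z)" using l unfolding closure_resolvent_set_iff by blast
    then show "\<exists>z. cmod z < e \<and> bij_betw (shift ?A z) X1 X1"
      using bij_iff_bij_betw_reducing_pair[OF bounded_clinear_shift[OF A] reducing_pair_shift[OF red]] by blast
  qed
  then show ?thesis using gen_drazin_invertible_if_fitting[OF A red quasi] by blast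
qed

text \<open>
  A chain for \<open>T - l\<close> contradicts the single valued extension property of \<open>T\<close>; a dual chain on the whole
  space consists of elements of the dual space and is a chain for \<open>T* - l\<close>.
\<close>

lemma drazin_invertible_if_svep:
  fixes T :: "'a::complex_banach \<Rightarrow> 'a"
  assumes T: "bounded_clinear T" and fred: "fredholm (shift T l)"
    and svep: "svep_at T l" "svep_at (adjoint_op T) l"
  shows "drazin_invertible (shift T l)"
proof -
  let ?A = "shift T l"
  have A: "bounded_clinear ?A" by (rule bounded_clinear_shift[OF T])
  interpret A: closed_invariant_subspace ?A UNIV by (rule closed_invariant_subspace_UNIV[OF A])
  have "\<exists>p. \<forall>x\<in>range (?A ^^ p). ?A x = 0 \<longrightarrow> x = 0"
  proof (rule ccontr)
    assume "\<not> ?thesis"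
    then have "\<exists>x\<in>range (?A ^^ n). ?A x = 0 \<and> x \<noteq> 0" for n by blast
    from A.ex_backward_chain[OF fred this] obtain x K C where "C > 0" "?A (x 0) = 0" "x 0 \<noteq> 0"
      "\<And>n. ?A (x (Suc n)) = x n" "\<And>n. norm (x n) \<le> K * C ^ n" by blast
    then show False using svep_at_chain_zero[OF T svep(1), of x K C] by blast
  qed
  then obtain p where p: "\<And>x. x \<in> range (?A ^^ p) \<Longrightarrow> ?A x = 0 \<Longrightarrow> x = 0" by blast
  have "\<exists>n. \<forall>y\<in>UNIV. \<exists>x\<in>UNIV. \<exists>v\<in>UNIV. (?A ^^ n) v = 0 \<and> y = ?A x + v"
  proof (rule ccontr)
    assume "\<not> ?thesis"
    then have "\<not> (\<forall>y\<in>UNIV. \<exists>x\<in>UNIV. \<exists>v\<in>UNIV. (?A ^^ n) v = 0 \<and> y = ?A x + v)" for n by blast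
    from A.ex_dual_chain[OF fred this] obtain \<phi> K C y
      where C: "C > 0" and \<phi>: "\<And>x. \<phi> 0 (?A x) = 0" "\<phi> 0 y \<noteq> 0"
        "\<And>n. clinear_on UNIV (\<phi> n)" "\<And>n x. \<phi> (Suc n) (?A x) = \<phi> n x"
        "\<And>n x. cmod (\<phi> n x) \<le> K * C ^ n * norm x" by (metis UNIV_I)
    have bc: "bounded_clinear (\<phi> n)" for n
      unfolding bounded_clinear_def
    proof
      show "bounded_linear (\<phi> n)"
        using \<phi>(3)[of n] \<phi>(5)[of n]
        by (intro bounded_linear_intro[of _ "K * C ^ n"])
          (simp_all add: clinear_on_def scaleR_scaleC scaleC_complex_def mult.commute)
    qed (use \<phi>(3)[of n] in \<open>simp add: clinear_on_def scaleC_complex_def\<close>)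
    define g where "g n = Abs_cdual (\<phi> n)" for n
    have g: "cdual_apply (g n) = \<phi> n" for n using bc by (simp add: g_def Abs_cdual_inverse)
    have "g 0 = 0"
    proof (rule svep_at_chain_zero[OF bounded_clinear_adjoint_op[OF T] svep(2)])
      show "shift (adjoint_op T) l (g 0) = 0"
        by (rule cdual_eqI) (simp only: cdual_apply_shift_adjoint_op[OF T] g \<phi>(1) zero_cdual.rep_eq)
      show "shift (adjoint_op T) l (g (Suc n)) = g n" for n
        by (rule cdual_eqI) (simp only: cdual_apply_shift_adjoint_op[OF T] g \<phi>(4))
      show "norm (g n) \<le> \<bar>K\<bar> * C ^ n" for n
        unfolding norm_cdual.rep_eq g
      proof (rule onorm_bound)
        show "0 \<le> \<bar>K\<bar> * C ^ n" using C by simp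
        have "K * C ^ n * norm x \<le> \<bar>K\<bar> * C ^ n * norm x" for x :: 'a
          using C by (intro mult_right_mono) auto
        then show "norm (\<phi> n x) \<le> \<bar>K\<bar> * C ^ n * norm x" for x using \<phi>(5)[of n x] order_trans by blast
      qed
    qed (rule C)
    then show False using fun_cong[OF g[of 0], of y] \<phi>(2) by (simp add: zero_cdual.rep_eq)
  qed
  then obtain n where "\<And>y. y \<in> UNIV \<Longrightarrow> \<exists>x\<in>UNIV. \<exists>v\<in>UNIV. (?A ^^ n) v = 0 \<and> y = ?A x + v" by blast
  from A.bij_betw_funpow_image[OF fred p this] show ?thesis unfolding drazin_invertible_iff[OF A] .
qed

lemma fredholm_imp_b_fredholm: "fredholm T \<Longrightarrow> b_fredholm T"
  unfolding b_fredholm_def by (intro exI[of _ 0]) simp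

lemma fredholm_imp_pseudo_b_fredholm:
  "bounded_clinear (T :: 'a::complex_banach \<Rightarrow> 'a) \<Longrightarrow> fredholm T \<Longrightarrow> pseudo_b_fredholm T"
  unfolding pseudo_b_fredholm_def using reducing_pair_UNIV_zero by blast

theorem corollary2p1:
  fixes T :: "'a::complex_banach \<Rightarrow> 'a"
  assumes "bounded_clinear T"
  shows
    "(\<sigma>_e T = \<sigma>_B T \<longleftrightarrow>
        (\<forall>l. l \<notin> \<sigma>_e T \<longrightarrow> svep_at T l \<and> svep_at (adjoint_op T) l)) \<and>
     ((\<forall>l. l \<notin> \<sigma>_e T \<longrightarrow> svep_at T l \<and> svep_at (adjoint_op T) l) \<longleftrightarrow>
        (\<forall>l. l \<notin> \<sigma>_BF T \<longrightarrow> svep_at T l \<and> svep_at (adjoint_op T) l)) \<and>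
     ((\<forall>l. l \<notin> \<sigma>_BF T \<longrightarrow> svep_at T l \<and> svep_at (adjoint_op T) l) \<longleftrightarrow>
        \<sigma>_BF T = \<sigma>_D T) \<and>
     (\<sigma>_BF T = \<sigma>_D T \<longleftrightarrow>
        (\<forall>l. l \<notin> \<sigma>_pBF T \<longrightarrow> svep_at T l \<and> svep_at (adjoint_op T) l)) \<and>
     ((\<forall>l. l \<notin> \<sigma>_pBF T \<longrightarrow> svep_at T l \<and> svep_at (adjoint_op T) l) \<longleftrightarrow>
        \<sigma>_gD T = \<sigma>_pBF T)"
proof -
  note T = assms
  note shift = bounded_clinear_shift[OF T]
  \<comment> \<open>All six statements are compared with this one.\<close>
  let ?C = "- \<sigma>_e T \<subseteq> closure (resolvent_set T)"
  let ?svep = "\<lambda>l. svep_at T l \<and> svep_at (adjoint_op T) l"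
  have BF_e: "\<sigma>_BF T \<subseteq> \<sigma>_e T" using fredholm_imp_b_fredholm by (auto simp: \<sigma>_BF_def \<sigma>_e_def)
  have pBF_e: "\<sigma>_pBF T \<subseteq> \<sigma>_e T"
    using fredholm_imp_pseudo_b_fredholm[OF shift] by (auto simp: \<sigma>_pBF_def \<sigma>_e_def)
  have B: "\<sigma>_B T = \<sigma>_e T \<union> \<sigma>_D T" using browder_iff[OF shift] by (auto simp: \<sigma>_B_def \<sigma>_e_def \<sigma>_D_def)
  have BF_D: "\<sigma>_BF T \<subseteq> \<sigma>_D T" using b_fredholm_if_drazin_invertible[OF shift] by (auto simp: \<sigma>_BF_def \<sigma>_D_def)
  have gD_D: "\<sigma>_gD T \<subseteq> \<sigma>_D T" using gen_drazin_invertible_if_drazin_invertible[OF shift] by (auto simp: \<sigma>_gD_def \<sigma>_D_def)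
  have pBF_gD: "\<sigma>_pBF T \<subseteq> \<sigma>_gD T"
    using pseudo_b_fredholm_if_gen_drazin_invertible[OF shift] by (auto simp: \<sigma>_gD_def \<sigma>_pBF_def)
  have gD: "- \<sigma>_gD T \<subseteq> closure (resolvent_set T)"
    using in_closure_resolvent_set_if_gen_drazin_invertible[OF T] by blast
  have BF_cl: "- \<sigma>_BF T \<subseteq> closure (resolvent_set T)" and pBF_cl: "- \<sigma>_pBF T \<subseteq> closure (resolvent_set T)" if ?C
    using in_closure_complement_essential_spectrum[OF T] closure_minimal[OF that closed_closure] by blast+
  have svep: "?svep l" if "l \<in> closure (resolvent_set T)" for l
    by (rule svep_at_if_in_closure_resolvent_set[OF T that])
  have BF_D_eq: "\<sigma>_BF T = \<sigma>_D T" if ?C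
    using BF_cl[OF that] drazin_invertible_if_b_fredholm[OF T] BF_D by (auto simp: \<sigma>_BF_def \<sigma>_D_def)
  have pBF_gD_eq: "\<sigma>_gD T = \<sigma>_pBF T" if ?C
    using pBF_cl[OF that] gen_drazin_invertible_if_pseudo_b_fredholm[OF T] pBF_gD
    by (auto simp: \<sigma>_gD_def \<sigma>_pBF_def)
  have c1: "\<sigma>_e T = \<sigma>_B T \<longleftrightarrow> ?C"
    using B BF_e BF_D_eq gD_D gD by blast
  have c2: "(\<forall>l. l \<notin> \<sigma>_e T \<longrightarrow> ?svep l) \<longleftrightarrow> ?C"
  proof
    assume sv: "\<forall>l. l \<notin> \<sigma>_e T \<longrightarrow> ?svep l"
    have "- \<sigma>_e T \<subseteq> - \<sigma>_D T"
      using drazin_invertible_if_svep[OF T] sv by (auto simp: \<sigma>_D_def \<sigma>_e_def)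
    then show ?C using gD_D gD by blast
  qed (use svep in blast)
  have c3: "(\<forall>l. l \<notin> \<sigma>_BF T \<longrightarrow> ?svep l) \<longleftrightarrow> ?C"
    using c2 BF_e BF_cl svep by blast
  have c4: "\<sigma>_BF T = \<sigma>_D T \<longleftrightarrow> ?C"
    using BF_D_eq BF_e gD_D gD by blast
  have c5: "(\<forall>l. l \<notin> \<sigma>_pBF T \<longrightarrow> ?svep l) \<longleftrightarrow> ?C"
    using c2 pBF_e pBF_cl svep by blast
  have c6: "\<sigma>_gD T = \<sigma>_pBF T \<longleftrightarrow> ?C"
    using pBF_gD_eq pBF_e gD by blast
  show ?thesis using c1 c2 c3 c4 c5 c6 by simp
qed

end
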